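(* Let $\mathcal{H}_u$ be a separable Hilbert space equipped with the Gaussian measure $\mu_0=\mathcal{N}(0,\mathcal{C}_0)$, and let $\mathcal{H}=\mathcal{H}(\mu_0)$ be the Cameron-Martin space of $\mu_0$. Let $\Theta=\Theta_1\times\cdots\times\Theta_N$ be a parameter set and $\theta=(\theta_1,\ldots,\theta_N)\in\Theta$. For each $n=1,\ldots,N$ let $f_{\theta_n}^{(n)}(u)=u+\mathcal{F}_{\theta_n}^{(n)}(u)$, where $\mathcal{F}_{\theta_n}^{(n)}:\mathcal{H}_u\to\mathcal{H}_u$ is a Fréchet differentiable (possibly nonlinear) operator with Fréchet derivative $D\mathcal{F}_{\theta_n}^{(n)}(u)$ at $u$. Let $f_\theta=f_{\theta_N}^{(N)}\circ f_{\theta_{N-1}}^{(N-1)}\circ\cdots\circ f_{\theta_1}^{(1)}$ and let $\mu_{f_\theta}=\mu_0\circ f_\theta^{-1}$ be the push-forward of $\mu_0$ under $f_\theta$. Assume that for any $\theta\in\Theta$ the following hold for all $n=1,\ldots,N$: (1) $\mathrm{Im}(\mathcal{F}_{\theta_n}^{(n)})\subset\mathcal{H}$; (2) $\mathcal{F}_{\theta_n}^{(n)}$ has finite dimensional range; (3) $f_{\theta_n}^{(n)}:\mathcal{H}_u\to\mathcal{H}_u$ is bijective; (4) for any $u\in\mathcal{H}_u$, no element of the point spectrum of $D\mathcal{F}_{\theta_n}^{(n)}(u)$ lies in $(-\infty,-1]$. Then, for every $\theta \in \Theta$, $\mu_{f_\theta}$ is equivalent to $\mu_0$ (mutually absolutely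 continuous), and the Radon-Nikodym derivative of $\mu_{f_\theta}$ with respect to $\mu_0$ is given, for $\mu_0$-almost every $u$, by $$\frac{d\mu_{f_\theta}}{d\mu_0}(f_\theta(u))=\prod_{n=1}^{N}\left|{\det}_1\big(Df_{\theta_n}^{(n)}(u_{n-1})\big)\right|^{-1}\exp\left(\frac12\langle f_\theta(u)-u,f_\theta(u)-u\rangle_{\mathcal{H}}+\langle u,f_\theta(u)-u\rangle_{\mathcal{H}}\right),$$ where $u_0=u$, $u_n=f_{\theta_n}^{(n)}\circ\cdots\circ f_{\theta_1}^{(1)}(u)$ for $n=1,\ldots,N$, and ${\det}_1$ is the Fredholm-Carleman determinant.
   Context: "Finite dimensional range" means the image is contained in a finite-dimensional linear subspace. The Cameron-Martin space $\mathcal{H}$ of $\mu_0=\mathcal{N}(0,\mathcal{C}_0)$ (with $\mathcal{C}_0$ a trace class covariance operator) carries the inner product $\langle u,v\rangle_{\mathcal{H}}=\langle\mathcal{C}_0^{-1/2}u,\mathcal{C}_0^{-1/2}v\rangle_{\mathcal{H}_u}$. Fredholm-Carleman determinant: for a finite-rank linear operator $\mathcal{K}:\mathcal{H}_u\to\mathcal{H}_u$ with range $\mathcal{K}(\mathcal{H}_u)$, ${\det}_1(I+\mathcal{K})=\det\big((I+\mathcal{K})|_{\mathcal{K}(\mathcal{H}_u)}\big)$, the determinant of $I+\mathcal{K}$ restricted to the finite-dimensional subspace $\mathcal{K}(\mathcal{H}_u)$. Here $Df_{\theta_n}^{(n)}(u)=I+D\mathcal{F}_{\theta_n}^{(n)}(u)$.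 Since $u\sim\mu_0$ need not lie in $\mathcal{H}$, the expression $\langle u,T(u)\rangle_{\mathcal{H}}$, for a map $T$ with values in a finite-dimensional subspace of $\mathcal{H}$ having $\mathcal{H}$-orthonormal basis $e_1,\ldots,e_M$, denotes $\sum_{i=1}^M\widehat{e}_i(u)\langle T(u),e_i\rangle_{\mathcal{H}}$, where $\widehat{h}$ is the $\mu_0$-measurable linear functional generated by $h\in\mathcal{H}$ (formally $\widehat h(u)=\langle u,\mathcal{C}_0^{-1}h\rangle_{\mathcal{H}_u}$). For $u\in\mathcal{H}$ this agrees with the ordinary $\mathcal{H}$-inner product. It is applied with $T(u)=f_\theta(u)-u$. *)

theory Defs
  imports "HOL-Probability.Probability" "Jordan_Normal_Form.Determinant"
begin

section \<open>Gaussian measures on a separable Hilbert space\<close>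

text \<open>
  A separable real Hilbert space is a type of the classes \<^class>\<open>real_inner\<close> and
  \<^class>\<open>polish_space\<close>
  (complete and second countable). The notation for the inner product is shared with the scalar
  product of the matrix library, so \<^term>\<open>inner u v\<close> is written out.
\<close>

definition hilbert_basis :: "'a::real_inner set \<Rightarrow> bool" where
  "hilbert_basis B \<longleftrightarrow>
     (\<forall>e\<in>B. \<forall>e'\<in>B. inner e e' = (if e = e' then 1 else 0)) \<and> closure (span B) = UNIV"

definition nonneg_selfadjoint :: "('a::real_inner \<Rightarrow> 'a) \<Rightarrow> bool" where
  "nonneg_selfadjoint A \<longleftrightarrow>
     bounded_linear A \<and> (\<forall>u v. inner (A u) v = inner u (A v)) \<and> (\<forall>u. 0 \<le> inner (A u) u)"

text \<open>
  For a nonnegative self-adjoint operator, the trace is the same (possibly infinite) number for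
  every orthonormal basis, so finiteness for one basis is the trace class condition.
  Injectivity is not required.
\<close>

definition covariance_operator :: "('a::real_inner \<Rightarrow> 'a) \<Rightarrow> bool" where
  "covariance_operator C \<longleftrightarrow>
     nonneg_selfadjoint C \<and> (\<exists>B. hilbert_basis B \<and> (\<lambda>e. inner (C e) e) summable_on B)"

text \<open>
  \<^term>\<open>M\<close> is \<open>N(0, C)\<close>: a Borel measure under which every functional \<open>\<langle>h, \<cdot>\<rangle>\<close> has the law
  \<open>N(0, \<langle>h, C h\<rangle>)\<close>, which is a point mass when the variance vanishes.
\<close>

definition centered_gaussian :: "'a::real_inner measure \<Rightarrow> ('a \<Rightarrow> 'a) \<Rightarrow> bool" where
  "centered_gaussian M C \<longleftrightarrow>
     sets M = sets borel \<and>
     (\<forall>h. distr M borel (inner h) =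
        (if inner h (C h) = 0 then return borel 0
         else density lborel (\<lambda>x. ennreal (normal_density 0 (sqrt (inner h (C h))) x))))"


section \<open>The Cameron--Martin space\<close>

text \<open>The nonnegative self-adjoint square root exists and is unique for such \<^term>\<open>C\<close>.\<close>

definition op_sqrt :: "('a::real_inner \<Rightarrow> 'a) \<Rightarrow> 'a \<Rightarrow> 'a" where
  "op_sqrt C = (SOME S. nonneg_selfadjoint S \<and> S \<circ> S = C)"

text \<open>
  \<open>C\<^sup>-\<^sup>1\<^sup>/\<^sup>2\<close> on the range of \<open>C\<^sup>1\<^sup>/\<^sup>2\<close>: the preimage orthogonal to the kernel. This is the ordinary
  inverse when \<^term>\<open>C\<close> is injective and the usual pseudo-inverse otherwise.
\<close>

definition op_inv_sqrt :: "('a::real_inner \<Rightarrow> 'a) \<Rightarrow> 'a \<Rightarrow> 'a" where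
  "op_inv_sqrt C u =
     (THE x. op_sqrt C x = u \<and> (\<forall>y. op_sqrt C y = 0 \<longrightarrow> inner x y = 0))"

definition cameron_martin :: "('a::real_inner \<Rightarrow> 'a) \<Rightarrow> 'a set" where
  "cameron_martin C = range (op_sqrt C)"

definition cm_inner :: "('a::real_inner \<Rightarrow> 'a) \<Rightarrow> 'a \<Rightarrow> 'a \<Rightarrow> real" where
  "cm_inner C u v = inner (op_inv_sqrt C u) (op_inv_sqrt C v)"

definition cm_orthonormal :: "('a::real_inner \<Rightarrow> 'a) \<Rightarrow> 'a set \<Rightarrow> bool" where
  "cm_orthonormal C E \<longleftrightarrow>
     finite E \<and> E \<subseteq> cameron_martin C \<and>
     (\<forall>e\<in>E. \<forall>e'\<in>E. cm_inner C e e' = (if e = e' then 1 else 0))"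

text \<open>
  The measurable linear functional generated by \<open>h\<close>: the element of the closure in \<open>L\<^sup>2(M)\<close> of the
  continuous linear functionals whose covariance with each \<open>\<langle>k, \<cdot>\<rangle>\<close> is \<open>\<langle>k, h\<rangle>\<close>. These
  conditions determine it up to a null set; a representative is chosen. If \<open>h = C k\<close>, it is
  \<open>\<langle>k, \<cdot>\<rangle>\<close>, in accordance with the formal expression \<open>\<langle>\<cdot>, C\<^sup>-\<^sup>1 h\<rangle>\<close>.
\<close>

definition cm_functional :: "'a::real_inner measure \<Rightarrow> 'a \<Rightarrow> 'a \<Rightarrow> real" where
  "cm_functional M h = (SOME X. X \<in> borel_measurable M \<and>
     (\<forall>\<epsilon>>0. \<exists>k. (\<integral>\<^sup>+u. ennreal ((X u - inner k u)\<^sup>2) \<partial>M) < ennreal \<epsilon>) \<and>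
     (\<forall>k. (\<integral>u. inner k u * X u \<partial>M) = inner k h))"

text \<open>
  \<open>\<langle>u, v\<rangle>\<close> in the Cameron--Martin space, extended to arbitrary \<open>u\<close> and \<open>v\<close> in the span of the finite
  orthonormal system \<open>E\<close>.
\<close>

definition cm_pairing ::
    "'a::real_inner measure \<Rightarrow> ('a \<Rightarrow> 'a) \<Rightarrow> 'a set \<Rightarrow> 'a \<Rightarrow> 'a \<Rightarrow> real" where
  "cm_pairing M C E u v = (\<Sum>e\<in>E. cm_functional M e u * cm_inner C v e)"


section \<open>Determinants and point spectrum\<close>

text \<open>
  Determinant of the restriction of \<^term>\<open>A\<close> to an \<^term>\<open>A\<close>-invariant finite-dimensional
  subspace, through the matrix of the restriction in a basis; the value does not depend on the basis.
\<close>

definition det_on :: "'a::real_vector set \<Rightarrow> ('a \<Rightarrow> 'a) \<Rightarrow> real" where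
  "det_on V A =
     (let b = (SOME b. distinct b \<and> independent (set b) \<and> span (set b) = V)
      in Determinant.det (Matrix.mat (length b) (length b)
           (\<lambda>(i, j). representation (set b) (A (b ! j)) (b ! i))))"

text \<open>For \<open>A = I + K\<close> with \<open>K\<close> of finite rank, the determinant of \<open>A\<close> restricted to the range of \<open>K\<close>.\<close>

definition fredholm_det1 :: "('a::real_vector \<Rightarrow> 'a) \<Rightarrow> real" where
  "fredholm_det1 A = det_on (range (\<lambda>v. A v - v)) A"

text \<open>
  Only real eigenvalues are recorded; the real eigenvalues of an operator and of its
  complexification are the same.
\<close>

definition point_spectrum :: "('a::real_vector \<Rightarrow> 'a) \<Rightarrow> real set" where
  "point_spectrum A = {c. \<exists>v. v \<noteq> 0 \<and> A v = c *\<^sub>R v}"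


section \<open>Compositions of layers\<close>

definition layer :: "(nat \<Rightarrow> 'p \<Rightarrow> 'a \<Rightarrow> 'a::real_vector) \<Rightarrow> (nat \<Rightarrow> 'p) \<Rightarrow> nat \<Rightarrow> 'a \<Rightarrow> 'a" where
  "layer F \<theta> n u = u + F n (\<theta> n) u"

primrec flow :: "(nat \<Rightarrow> 'p \<Rightarrow> 'a \<Rightarrow> 'a::real_vector) \<Rightarrow> (nat \<Rightarrow> 'p) \<Rightarrow> nat \<Rightarrow> 'a \<Rightarrow> 'a" where
  "flow F \<theta> 0 u = u"
| "flow F \<theta> (Suc n) u = layer F \<theta> (Suc n) (flow F \<theta> n u)"

end

theory Submission
  imports Defs
begin

text \<open>
  One layer \<open>f = I + F\<close> only moves points inside the cosets of a finite-dimensional subspace \<open>V\<close> of the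
  Cameron--Martin space. Splitting \<open>u\<close> into standard normal coordinates along an orthonormal basis of
  \<open>V\<close> and an independent remainder, \<open>f\<close> acts for each value of the remainder as an everywhere
  differentiable bijection of \<open>\<real>\<^sup>m\<close> whose Jacobian determinant is \<open>det\<^sub>1 (Df)\<close>, nonzero because \<open>-1\<close> is
  not an eigenvalue of \<open>DF\<close>. The change of variables formula therefore gives
  \<open>\<integral> \<phi> d\<mu>\<^sub>0 = \<integral> \<phi> (f u) \<rho> u d\<mu>\<^sub>0(u)\<close> with \<open>\<rho> = \<bar>det\<^sub>1 (Df)\<bar> exp (- \<bar>F u\<bar>\<^sup>2 / 2 - \<langle>u, F u\<rangle>)\<close>. These
  identities compose, the exponents adding up because the measurable functionals are additive under
  Cameron--Martin shifts, and \<open>\<rho> > 0\<close> turns the composed identity into equivalence of measures with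
  density \<open>1 / \<rho>\<close> along \<open>f\<close>.

  The dimension \<open>m\<close> is a number and not a type, so \<open>\<real>\<^sup>m\<close> is the finite product measure space of
  functions on \<open>{..<m}\<close> (extensional, that is \<open>undefined\<close> outside), for which the change of variables
  formula is proved here.
\<close>

section \<open>Lebesgue measure on coordinate spaces\<close>

abbreviation lborel_n :: "nat \<Rightarrow> (nat \<Rightarrow> real) measure" where
  "lborel_n m \<equiv> Pi\<^sub>M {..<m} (\<lambda>_. lborel)"

abbreviation coords :: "nat \<Rightarrow> (nat \<Rightarrow> real) set" where
  "coords m \<equiv> Pi\<^sub>E {..<m} (\<lambda>_. UNIV)"

interpretation lborel_product: product_sigma_finite "\<lambda>_::nat. lborel :: real measure"
  by standard

lemma space_lborel_n: "space (lborel_n m) = coords m"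
  by (simp add: space_PiM)

lemma measurable_into_lborel_n:
  assumes "\<And>x i. x \<in> space M \<Longrightarrow> \<not> i < m \<Longrightarrow> f x i = undefined"
    and "\<And>i. i < m \<Longrightarrow> (\<lambda>x. f x i) \<in> borel_measurable M"
  shows "f \<in> measurable M (lborel_n m)"
  by (rule measurable_PiM_single') (use assms in \<open>auto simp: PiE_def extensional_def\<close>)

lemma measurable_coord: "i < m \<Longrightarrow> (\<lambda>x. x i) \<in> borel_measurable (lborel_n m)"
  using measurable_component_singleton[of i "{..<m}" "\<lambda>_. lborel :: real measure"] by simp

lemma nn_integral_coordinate_affine:
  fixes c :: real
  assumes k: "k < m" and c: "c \<noteq> 0" and [measurable]: "\<phi> \<in> borel_measurable (lborel_n m)"
    and g: "g \<in> borel_measurable (lborel_n m)" "\<And>x y. g (x(k := y)) = g x"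
  shows "ennreal \<bar>c\<bar> * (\<integral>\<^sup>+x. \<phi> (x(k := c * x k + g x)) \<partial>lborel_n m) = (\<integral>\<^sup>+x. \<phi> x \<partial>lborel_n m)"
proof -
  let ?I = "{..<m} - {k}"
  have I: "{..<m} = insert k ?I" "finite ?I" "k \<notin> ?I" using k by auto
  have upd: "(\<lambda>x. x(k := c * x k + g x)) \<in> measurable (lborel_n m) (lborel_n m)"
  proof (rule measurable_into_lborel_n)
    show "(x(k := c * x k + g x)) i = undefined" if "x \<in> space (lborel_n m)" "\<not> i < m" for x i
      using that k by (auto simp: space_PiM PiE_def extensional_def)
    show "(\<lambda>x. (x(k := c * x k + g x)) i) \<in> borel_measurable (lborel_n m)" if "i < m" for i
      using g(1) measurable_coord[OF that] measurable_coord[OF k] by (cases "i = k") auto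
  qed
  have f2: "(\<lambda>x. \<phi> (x(k := c * x k + g x))) \<in> borel_measurable (Pi\<^sub>M (insert k ?I) (\<lambda>_. lborel))"
    using measurable_compose[OF upd assms(3)] I(1) by simp
  have f1: "\<phi> \<in> borel_measurable (Pi\<^sub>M (insert k ?I) (\<lambda>_. lborel))"
    using assms(3) I(1) by simp
  have sec: "(\<lambda>y. \<phi> (x(k := y))) \<in> borel_measurable lborel" if "x \<in> space (Pi\<^sub>M ?I (\<lambda>_. lborel))" for x
  proof (rule measurable_compose[OF _ assms(3)], rule measurable_into_lborel_n)
    show "(x(k := y)) i = undefined" if "\<not> i < m" for y i
      using that k \<open>x \<in> _\<close> by (auto simp: space_PiM PiE_def extensional_def)
    show "(\<lambda>y. (x(k := y)) i) \<in> borel_measurable lborel" for i by (cases "i = k") auto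
  qed
  have "(\<integral>\<^sup>+x. \<phi> (x(k := c * x k + g x)) \<partial>lborel_n m)
      = (\<integral>\<^sup>+x. (\<integral>\<^sup>+y. \<phi> (x(k := c * y + g x)) \<partial>lborel) \<partial>Pi\<^sub>M ?I (\<lambda>_. lborel))"
    using lborel_product.product_nn_integral_insert[OF I(2,3) f2] I(1) g(2) by simp
  also have "ennreal \<bar>c\<bar> * \<dots> = (\<integral>\<^sup>+x. ennreal \<bar>c\<bar> * (\<integral>\<^sup>+y. \<phi> (x(k := c * y + g x)) \<partial>lborel) \<partial>Pi\<^sub>M ?I (\<lambda>_. lborel))"
  proof (rule nn_integral_cmult[symmetric])
    have "(\<lambda>x. \<integral>\<^sup>+y. (\<lambda>x. \<phi> (x(k := c * x k + g x))) (x(k := y)) \<partial>lborel) \<in> borel_measurable (Pi\<^sub>M ?I (\<lambda>_. lborel))"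
      by (rule lborel.borel_measurable_nn_integral)
        (use measurable_compose[OF measurable_add_dim[of k ?I "\<lambda>_. lborel :: real measure"] f2] in \<open>simp add: split_def\<close>)
    then show "(\<lambda>x. \<integral>\<^sup>+y. \<phi> (x(k := c * y + g x)) \<partial>lborel) \<in> borel_measurable (Pi\<^sub>M ?I (\<lambda>_. lborel))"
      using g(2) by simp
  qed
  also have "\<dots> = (\<integral>\<^sup>+x. (\<integral>\<^sup>+y. \<phi> (x(k := y)) \<partial>lborel) \<partial>Pi\<^sub>M ?I (\<lambda>_. lborel))"
  proof (rule nn_integral_cong)
    fix x assume "x \<in> space (Pi\<^sub>M ?I (\<lambda>_. lborel :: real measure))"
    from nn_integral_real_affine[OF sec[OF this, unfolded measurable_lborel2] c, of "g x"]
    show "ennreal \<bar>c\<bar> * (\<integral>\<^sup>+y. \<phi> (x(k := c * y + g x)) \<partial>lborel) = (\<integral>\<^sup>+y. \<phi> (x(k := y)) \<partial>lborel)"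
      by (simp add: add.commute)
  qed
  also have "\<dots> = (\<integral>\<^sup>+x. \<phi> x \<partial>lborel_n m)"
    using lborel_product.product_nn_integral_insert[OF I(2,3) f1] I(1) by simp
  finally show ?thesis .
qed

definition mat_act :: "nat \<Rightarrow> real mat \<Rightarrow> (nat \<Rightarrow> real) \<Rightarrow> nat \<Rightarrow> real" where
  "mat_act m A x = (\<lambda>i\<in>{..<m}. \<Sum>j<m. A $$ (i, j) * x j)"

lemma mat_act_coords [simp]: "mat_act m A x \<in> coords m"
  by (auto simp: mat_act_def)

lemma measurable_mat_act [measurable]: "mat_act m A \<in> measurable (lborel_n m) (lborel_n m)"
  unfolding mat_act_def by (rule measurable_into_lborel_n) (auto intro!: borel_measurable_sum borel_measurable_times measurable_coord)

lemma mat_act_mult: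
  assumes "A \<in> carrier_mat m m" "B \<in> carrier_mat m m"
  shows "mat_act m (A * B) x = mat_act m A (mat_act m B x)"
proof
  fix i
  show "mat_act m (A * B) x i = mat_act m A (mat_act m B x) i"
  proof (cases "i < m")
    case True
    have "(\<Sum>j<m. (A * B) $$ (i, j) * x j) = (\<Sum>j<m. \<Sum>k<m. A $$ (i, k) * B $$ (k, j) * x j)"
      using assms True by (auto intro!: sum.cong simp: scalar_prod_def sum_distrib_right lessThan_atLeast0)
    also have "\<dots> = (\<Sum>k<m. A $$ (i, k) * (\<Sum>j<m. B $$ (k, j) * x j))"
      by (subst sum.swap) (simp add: sum_distrib_left mult.assoc)
    finally show ?thesis using True by (simp add: mat_act_def)
  qed (simp add: mat_act_def)
qed

lemma mat_act_one: "x \<in> coords m \<Longrightarrow> mat_act m (1\<^sub>m m) x = x"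
proof
  fix i assume x: "x \<in> coords m"
  have "(\<Sum>j<m. 1\<^sub>m m $$ (i, j) * x j) = x i" if "i < m"
  proof -
    have "(\<Sum>j<m. 1\<^sub>m m $$ (i, j) * x j) = (\<Sum>j<m. if i = j then x j else 0)"
      by (rule sum.cong) (use that in auto)
    then show ?thesis using that by simp
  qed
  then show "mat_act m (1\<^sub>m m) x i = x i"
    using x by (auto simp: mat_act_def PiE_def extensional_def)
qed

definition row_replace :: "nat \<Rightarrow> nat \<Rightarrow> (nat \<Rightarrow> real) \<Rightarrow> real mat" where
  "row_replace m k r = Matrix.mat m m (\<lambda>(i, j). if i = k then r j else if i = j then 1 else 0)"

lemma row_replace_carrier [simp]: "row_replace m k r \<in> carrier_mat m m"
  by (simp add: row_replace_def)

lemma det_zero_by_permutations: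
  fixes A :: "real mat"
  assumes "A \<in> carrier_mat m m" "\<And>p. p permutes {0..<m} \<Longrightarrow> \<exists>i<m. A $$ (i, p i) = 0"
  shows "Determinant.det A = 0"
proof -
  have "(\<Prod>i = 0..<m. A $$ (i, p i)) = 0" if p: "p permutes {0..<m}" for p
    using assms(2)[OF p] by (auto intro!: prod_zero)
  then show ?thesis using assms(1) by (auto simp: Determinant.det_def intro!: sum.neutral)
qed

lemma det_row_replace:
  assumes k: "k < m"
  shows "Determinant.det (row_replace m k r) = r k"
proof -
  let ?A = "row_replace m k r"
  have fix0: "(\<Prod>i = 0..<m. ?A $$ (i, p i)) = 0" if p: "p permutes {0..<m}" "p \<noteq> id" for p
  proof -
    have "\<exists>i<m. i \<noteq> k \<and> p i \<noteq> i"
    proof (rule ccontr)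
      assume "\<not> ?thesis"
      then have fixed: "p i = i" if "i \<noteq> k" for i
        using p(1) that by (cases "i < m") (auto simp: permutes_def)
      then have "p k = k" using permutes_inj[OF p(1)] by (metis injD)
      with fixed have "p = id" by (metis eq_id_iff)
      with p(2) show False by simp
    qed
    then obtain i where "i < m" "i \<noteq> k" "p i \<noteq> i" by auto
    moreover have "p i < m" using p(1) \<open>i < m\<close> permutes_in_image by fastforce
    ultimately have "?A $$ (i, p i) = 0" by (simp add: row_replace_def)
    with \<open>i < m\<close> show ?thesis by (auto intro!: prod_zero)
  qed
  have "Determinant.det ?A = (\<Sum>p\<in>{p. p permutes {0..<m}}. signof p * (\<Prod>i = 0..<m. ?A $$ (i, p i)))"
    by (simp add: Determinant.det_def row_replace_def)
  also have "\<dots> = (\<Sum>p\<in>{id}. signof p * (\<Prod>i = 0..<m. ?A $$ (i, p i)))"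
    by (rule sum.mono_neutral_right) (use fix0 in \<open>auto simp: permutes_id finite_permutations\<close>)
  also have "\<dots> = (\<Prod>i = 0..<m. ?A $$ (i, i))" by simp
  also have "\<dots> = (\<Prod>i = 0..<m. if i = k then r k else 1)"
    by (rule prod.cong) (auto simp: row_replace_def)
  also have "\<dots> = r k" using k by (subst prod.delta) auto
  finally show ?thesis .
qed

lemma mat_act_row_replace:
  assumes "k < m" "x \<in> coords m"
  shows "mat_act m (row_replace m k r) x = x(k := r k * x k + (\<Sum>j\<in>{..<m} - {k}. r j * x j))"
proof
  fix i
  have "(\<Sum>j<m. row_replace m k r $$ (i, j) * x j) = x i" if "i < m" "i \<noteq> k"
  proof -
    have "(\<Sum>j<m. row_replace m k r $$ (i, j) * x j) = (\<Sum>j<m. if i = j then x j else 0)"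
      by (rule sum.cong) (use that in \<open>auto simp: row_replace_def\<close>)
    then show ?thesis using that by simp
  qed
  moreover have "(\<Sum>j<m. row_replace m k r $$ (k, j) * x j) = r k * x k + (\<Sum>j\<in>{..<m} - {k}. r j * x j)"
    using assms(1) by (subst sum.remove[of _ k]) (auto simp: row_replace_def)
  ultimately show "mat_act m (row_replace m k r) x i = (x(k := r k * x k + (\<Sum>j\<in>{..<m} - {k}. r j * x j))) i"
    using assms by (auto simp: mat_act_def PiE_def extensional_def)
qed

lemma nn_integral_row_replace:
  assumes "k < m" "r k \<noteq> 0" "\<phi> \<in> borel_measurable (lborel_n m)"
  shows "ennreal \<bar>r k\<bar> * (\<integral>\<^sup>+x. \<phi> (mat_act m (row_replace m k r) x) \<partial>lborel_n m) = (\<integral>\<^sup>+x. \<phi> x \<partial>lborel_n m)"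
proof -
  have "(\<integral>\<^sup>+x. \<phi> (mat_act m (row_replace m k r) x) \<partial>lborel_n m)
      = (\<integral>\<^sup>+x. \<phi> (x(k := r k * x k + (\<Sum>j\<in>{..<m} - {k}. r j * x j))) \<partial>lborel_n m)"
    by (rule nn_integral_cong) (simp only: space_lborel_n mat_act_row_replace[OF assms(1)])
  then show ?thesis
    using nn_integral_coordinate_affine[OF assms, of "\<lambda>x. \<Sum>j\<in>{..<m} - {k}. r j * x j"]
    by (simp add: measurable_coord)
qed

text \<open>
  Multiplying by a row replacement on the right is a column operation, so one such factor clears a
  whole row; Gaussian elimination writes every invertible matrix as a product of row replacements.
\<close>

lemma nn_integral_linear:
  assumes "A \<in> carrier_mat m m" "Determinant.det A \<noteq> 0" "\<phi> \<in> borel_measurable (lborel_n m)"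
  shows "ennreal \<bar>Determinant.det A\<bar> * (\<integral>\<^sup>+x. \<phi> (mat_act m A x) \<partial>lborel_n m) = (\<integral>\<^sup>+x. \<phi> x \<partial>lborel_n m)"
proof -
  define P where "P A \<longleftrightarrow> (\<forall>\<phi>\<in>borel_measurable (lborel_n m).
    ennreal \<bar>Determinant.det A\<bar> * (\<integral>\<^sup>+x. \<phi> (mat_act m A x) \<partial>lborel_n m) = (\<integral>\<^sup>+x. \<phi> x \<partial>lborel_n m))" for A
  have factor: "P A" if A: "A \<in> carrier_mat m m" and k: "k < m" and r: "r k \<noteq> 0"
    and PAE: "P (A * row_replace m k r)" for A k r
    unfolding P_def
  proof
    fix \<phi> :: "_ \<Rightarrow> ennreal" assume \<phi>: "\<phi> \<in> borel_measurable (lborel_n m)"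
    have [measurable]: "(\<lambda>x. \<phi> (mat_act m A x)) \<in> borel_measurable (lborel_n m)"
      using measurable_compose[OF measurable_mat_act \<phi>] .
    have "ennreal \<bar>Determinant.det A\<bar> * (\<integral>\<^sup>+x. \<phi> (mat_act m A x) \<partial>lborel_n m)
       = ennreal \<bar>Determinant.det A\<bar> * (ennreal \<bar>r k\<bar> * (\<integral>\<^sup>+x. \<phi> (mat_act m A (mat_act m (row_replace m k r) x)) \<partial>lborel_n m))"
      using nn_integral_row_replace[where k = k and r = r and \<phi> = "\<lambda>x. \<phi> (mat_act m A x)"] k r by simp
    also have "\<dots> = ennreal \<bar>Determinant.det (A * row_replace m k r)\<bar> * (\<integral>\<^sup>+x. \<phi> (mat_act m (A * row_replace m k r) x) \<partial>lborel_n m)"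
      using A by (simp add: mat_act_mult det_mult det_row_replace[OF k] abs_mult ennreal_mult mult.assoc)
    finally show "ennreal \<bar>Determinant.det A\<bar> * (\<integral>\<^sup>+x. \<phi> (mat_act m A x) \<partial>lborel_n m) = (\<integral>\<^sup>+x. \<phi> x \<partial>lborel_n m)"
      using PAE \<phi> by (simp add: P_def)
  qed
  have entry: "(A * row_replace m k r) $$ (i, j) = (if j = k then 0 else A $$ (i, j)) + A $$ (i, k) * r j"
    if "A \<in> carrier_mat m m" "i < m" "j < m" "k < m" for A k r i j
  proof -
    have "(A * row_replace m k r) $$ (i, j) = (\<Sum>l<m. A $$ (i, l) * row_replace m k r $$ (l, j))"
      using that by (auto simp: row_replace_def scalar_prod_def lessThan_atLeast0 intro!: sum.cong)
    also have "\<dots> = A $$ (i, k) * r j + (\<Sum>l\<in>{..<m} - {k}. A $$ (i, l) * row_replace m k r $$ (l, j))"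
      using that by (subst sum.remove[of _ k]) (auto simp: row_replace_def)
    also have "(\<Sum>l\<in>{..<m} - {k}. A $$ (i, l) * row_replace m k r $$ (l, j)) = (\<Sum>l\<in>{..<m} - {k}. if l = j then A $$ (i, j) else 0)"
      using that by (intro sum.cong) (auto simp: row_replace_def)
    finally show ?thesis using that by auto
  qed
  have "P A" if "A \<in> carrier_mat m m" "Determinant.det A \<noteq> 0" "k \<le> m"
    "\<forall>i<k. \<forall>j<m. A $$ (i, j) = (if i = j then 1 else 0)" for k A
    using that(3,1,2,4)
  proof (induction k arbitrary: A rule: inc_induct)
    case base
    then have "A = 1\<^sub>m m" by (intro eq_matI) auto
    then show ?case unfolding P_def
      by (auto intro!: nn_integral_cong simp: space_lborel_n mat_act_one)
  next
    case (step k)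
    note A = step.prems(1) and k = step.hyps(2)
    have clear: "P B" if B: "B \<in> carrier_mat m m" "Determinant.det B \<noteq> 0" "B $$ (k, k) \<noteq> 0"
      "\<forall>i<k. \<forall>j<m. B $$ (i, j) = (if i = j then 1 else 0)" for B
    proof -
      define r where "r j = (if j = k then 1 / B $$ (k, k) else - B $$ (k, j) / B $$ (k, k))" for j
      have r: "r k \<noteq> 0" using B by (simp add: r_def)
      have e: "(B * row_replace m k r) $$ (i, j) = (if i = j then 1 else 0)" if "i < Suc k" "j < m" for i j
        using that k B(3,4) entry[OF B(1), of i j k r]
        by (cases "i = k") (auto simp: r_def field_simps)
      have "P (B * row_replace m k r)"
        by (rule step.IH) (use B r e in \<open>auto simp: det_mult det_row_replace[OF k]\<close>)
      then show ?thesis by (rule factor[where k = k and r = r, OF B(1) k r])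
    qed
    show ?case
    proof (cases "A $$ (k, k) = 0")
      case False
      then show ?thesis using clear step.prems by blast
    next
      case True
      have "\<exists>j. k < j \<and> j < m \<and> A $$ (k, j) \<noteq> 0"
      proof (rule ccontr)
        assume "\<not> ?thesis"
        with True have zero: "A $$ (k, j) = 0" if "k \<le> j" "j < m" for j
          using that by (metis le_neq_implies_less)
        have "\<exists>i<m. A $$ (i, p i) = 0" if p: "p permutes {0..<m}" for p
        proof (rule ccontr)
          assume "\<not> ?thesis"
          then have nz: "A $$ (i, p i) \<noteq> 0" if "i < m" for i using that by blast
          have pm: "p i < m" if "i < m" for i using p that permutes_in_image by fastforce
          have "p i = i" if "i < k" for i
            using step.prems(3) nz[of i] pm[of i] that k by (metis less_trans)
          then have "p k \<ge> k" using permutes_inj[OF p] by (metis injD not_le less_irrefl)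
          then show False using zero nz k pm by blast
        qed
        then show False using det_zero_by_permutations[OF A] step.prems(2) by blast
      qed
      then obtain j where j: "k < j" "j < m" "A $$ (k, j) \<noteq> 0" by blast
      define r where "r i = (if i = j \<or> i = k then 1 else 0 :: real)" for i
      have e: "(A * row_replace m j r) $$ (i, l) = A $$ (i, l) + (if l = k then A $$ (i, j) else 0)" if "i < m" "l < m" for i l
        using entry[OF A that j(2), of r] j(1) by (auto simp: r_def)
      have "P (A * row_replace m j r)"
      proof (rule clear)
        show "(A * row_replace m j r) $$ (k, k) \<noteq> 0" using e[OF k k] True j by simp
        show "\<forall>i<k. \<forall>l<m. (A * row_replace m j r) $$ (i, l) = (if i = l then 1 else 0)"
          using e step.prems(3) j k by auto
      qed (use A step.prems(2) det_row_replace[OF j(2), of r] in \<open>auto simp: det_mult r_def\<close>)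
      then show ?thesis by (rule factor[where k = j and r = r, OF A j(2), rotated]) (simp add: r_def)
    qed
  qed
  from this[of A 0] assms show ?thesis by (simp add: P_def)
qed

lemma emeasure_mat_act_image:
  assumes A: "A \<in> carrier_mat m m" "Determinant.det A \<noteq> 0" and S: "S \<in> sets (lborel_n m)"
  shows "mat_act m A ` S \<in> sets (lborel_n m)"
    and "emeasure (lborel_n m) (mat_act m A ` S) = ennreal \<bar>Determinant.det A\<bar> * emeasure (lborel_n m) S"
proof -
  obtain B where B: "B \<in> carrier_mat m m" "A * B = 1\<^sub>m m" "B * A = 1\<^sub>m m"
    using det_non_zero_imp_unit[OF A] by (auto simp: Units_def ring_mat_def)
  have AB: "mat_act m A (mat_act m B x) = x" "mat_act m B (mat_act m A x) = x" if "x \<in> coords m" for x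
    using mat_act_mult[OF A(1) B(1)] mat_act_mult[OF B(1) A(1)] B mat_act_one[OF that] by metis+
  have sub: "S \<subseteq> coords m" using sets.sets_into_space[OF S] by (simp add: space_PiM)
  have img: "mat_act m A ` S = mat_act m B -` S \<inter> space (lborel_n m)"
  proof (intro Set.set_eqI iffI)
    fix x assume "x \<in> mat_act m A ` S"
    then obtain y where y: "y \<in> S" "x = mat_act m A y" by blast
    then have "mat_act m B x = y" using AB(2) sub by (simp add: subset_iff)
    then show "x \<in> mat_act m B -` S \<inter> space (lborel_n m)"
      using y mat_act_coords[of m A y] unfolding space_lborel_n by simp
  next
    fix x assume x: "x \<in> mat_act m B -` S \<inter> space (lborel_n m)"
    then have "x = mat_act m A (mat_act m B x)" using AB(1)[of x] unfolding space_lborel_n by simp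
    then show "x \<in> mat_act m A ` S" using x by (metis IntE imageI vimageE)
  qed
  show 1: "mat_act m A ` S \<in> sets (lborel_n m)"
    unfolding img using measurable_sets[OF measurable_mat_act S] .
  have "emeasure (lborel_n m) (mat_act m A ` S) = (\<integral>\<^sup>+x. indicator (mat_act m A ` S) x \<partial>lborel_n m)"
    using 1 by simp
  also have "\<dots> = ennreal \<bar>Determinant.det A\<bar> * (\<integral>\<^sup>+x. indicator (mat_act m A ` S) (mat_act m A x) \<partial>lborel_n m)"
    by (rule nn_integral_linear[symmetric]) (use A 1 in auto)
  also have "(\<integral>\<^sup>+x. indicator (mat_act m A ` S) (mat_act m A x) \<partial>lborel_n m) = (\<integral>\<^sup>+x. indicator S x \<partial>lborel_n m)"
  proof (rule nn_integral_cong)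
    fix x assume "x \<in> space (lborel_n m)"
    then have x: "x \<in> coords m" by (simp only: space_lborel_n)
    have "mat_act m A x \<in> mat_act m A ` S \<longleftrightarrow> x \<in> S"
    proof
      assume "mat_act m A x \<in> mat_act m A ` S"
      then obtain y where "y \<in> S" "mat_act m A x = mat_act m A y" by blast
      then show "x \<in> S" using AB(2)[OF x] AB(2)[of y] sub by (metis subsetD)
    qed simp
    then show "indicator (mat_act m A ` S) (mat_act m A x) = (indicator S x :: ennreal)"
      by (simp add: indicator_def)
  qed
  finally show "emeasure (lborel_n m) (mat_act m A ` S) = ennreal \<bar>Determinant.det A\<bar> * emeasure (lborel_n m) S"
    using S by simp
qed

section \<open>Borel sets and dyadic cubes in coordinate spaces\<close>

lemma borel_image_inj_sigma_compact:
  fixes f :: "'a::t2_space \<Rightarrow> 'b::t2_space" and K :: "nat \<Rightarrow> 'a set"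
  assumes K: "\<And>n. compact (K n)" and cont: "\<And>n. continuous_on (K n) f"
    and inj: "inj_on f (\<Union>n. K n)" and A: "A \<in> sets borel"
  shows "f ` (A \<inter> (\<Union>n. K n)) \<in> sets borel"
proof -
  have "f ` (A \<inter> K n) \<in> sets borel" for n
  proof -
    have injK: "inj_on f (K n)" by (rule inj_on_subset[OF inj]) auto
    have "A \<in> sigma_sets UNIV (Collect closed)"
      using A by (simp add: borel_eq_closed)
    then show ?thesis
    proof induction
      case (Basic A)
      have "compact (K n \<inter> A)" using K[of n] Basic by (simp add: compact_Int_closed)
      then have "compact (f ` (K n \<inter> A))"
        by (rule compact_continuous_image[rotated]) (rule continuous_on_subset[OF cont[of n]], auto)
      then show ?case by (simp add: Int_commute compact_imp_closed borel_closed)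
    next
      case (Compl A)
      have "f ` ((UNIV - A) \<inter> K n) = f ` K n - f ` (A \<inter> K n)"
        using injK by (auto simp: inj_on_def)
      moreover have "f ` K n \<in> sets borel"
        using compact_continuous_image[OF cont[of n] K[of n]] by (simp add: compact_imp_closed borel_closed)
      ultimately show ?case using Compl by auto
    next
      case (Union A)
      have "f ` (\<Union>(range A) \<inter> K n) = (\<Union>i. f ` (A i \<inter> K n))" by auto
      then show ?case using Union by auto
    qed simp
  qed
  moreover have "f ` (A \<inter> (\<Union>n. K n)) = (\<Union>n. f ` (A \<inter> K n))" by auto
  ultimately show ?thesis by auto
qed

lemma closed_coords: "closed (coords m)"
proof -
  have "coords m = (\<Inter>i\<in>{i. \<not> i < m}. {x. x i = undefined})"
    by (auto simp: PiE_def extensional_def)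
  moreover have "closed {x :: nat \<Rightarrow> real. x i = undefined}" for i
    by (rule closed_Collect_eq) (auto intro: continuous_on_product_coordinates)
  ultimately show ?thesis by auto
qed

lemma borel_lborel_n: assumes "A \<in> sets (lborel_n m)" shows "A \<in> sets borel"
proof -
  have "(\<lambda>x. restrict x {..<m}) \<in> measurable borel (lborel_n m)"
    by (rule measurable_into_lborel_n) auto
  from measurable_sets[OF this assms]
  have 1: "(\<lambda>x. restrict x {..<m}) -` A \<in> sets borel" by simp
  have "A = (\<lambda>x. restrict x {..<m}) -` A \<inter> coords m"
    using sets.sets_into_space[OF assms] by (auto simp: space_PiM PiE_restrict subset_iff)
  moreover have "coords m \<in> sets borel" using closed_coords by (rule borel_closed)
  ultimately show ?thesis using 1 by (metis sets.Int)
qed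

lemma measurable_id_borel: "(\<lambda>x. x) \<in> measurable (lborel_n m) borel"
proof (rule measurable_coordinatewise_then_product)
  fix i show "(\<lambda>x. x i) \<in> borel_measurable (lborel_n m)"
  proof (cases "i < m")
    case False
    have "(\<lambda>x. x i) \<in> borel_measurable (lborel_n m) \<longleftrightarrow> (\<lambda>x. undefined :: real) \<in> borel_measurable (lborel_n m)"
      by (rule measurable_cong) (use False in \<open>auto simp: space_PiM PiE_def extensional_def\<close>)
    then show ?thesis by simp
  qed (rule measurable_coord)
qed

lemma lborel_n_borel: assumes "A \<in> sets borel" shows "A \<inter> coords m \<in> sets (lborel_n m)"
  using measurable_sets[OF measurable_id_borel assms] by (simp add: space_PiM vimage_def)

lemma open_fun_contains_box:
  fixes U :: "(nat \<Rightarrow> real) set"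
  assumes "open U" "x \<in> U" "x \<in> coords m"
  shows "\<exists>e>0. \<forall>y\<in>coords m. (\<forall>i<m. \<bar>y i - x i\<bar> < e) \<longrightarrow> y \<in> U"
proof -
  have "openin (product_topology (\<lambda>_. euclidean) UNIV) U"
    using assms(1) by (metis euclidean_product_topology open_openin)
  from product_topology_open_contains_basis[OF this assms(2)]
  obtain X where X: "x \<in> Pi\<^sub>E UNIV X" "\<And>i. open (X i)" "Pi\<^sub>E UNIV X \<subseteq> U"
    by auto
  have "\<exists>e>0. \<forall>t. \<bar>t - x i\<bar> < e \<longrightarrow> t \<in> X i" for i
    using X(1) X(2)[of i] unfolding open_dist by (auto simp: dist_real_def PiE_def Pi_def)
  then obtain e where e: "\<And>i. e i > 0" "\<And>i t. \<bar>t - x i\<bar> < e i \<Longrightarrow> t \<in> X i" by metis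
  define d where "d = Min (insert 1 (e ` {..<m}))"
  have "d > 0" using e(1) by (auto simp: d_def)
  moreover have "y \<in> U" if y: "y \<in> coords m" "\<forall>i<m. \<bar>y i - x i\<bar> < d" for y
  proof -
    have "y i \<in> X i" for i
    proof (cases "i < m")
      case True
      then have "d \<le> e i" by (auto simp: d_def)
      then show ?thesis using e(2) y(2) True by fastforce
    next
      case False
      then have "y i = x i" using y(1) assms(3) by (auto simp: PiE_def extensional_def)
      then show ?thesis using X(1) by auto
    qed
    then show ?thesis using X(3) by (auto simp: PiE_def)
  qed
  ultimately show ?thesis by blast
qed

definition dyadic_cube :: "nat \<Rightarrow> nat \<Rightarrow> (nat \<Rightarrow> int) \<Rightarrow> (nat \<Rightarrow> real) set" where
  "dyadic_cube m n k = Pi\<^sub>E {..<m} (\<lambda>i. {of_int (k i) / 2 ^ n ..< (of_int (k i) + 1) / 2 ^ n})"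

lemma mem_dyadic_cube: "x \<in> dyadic_cube m n k \<longleftrightarrow> x \<in> coords m \<and> (\<forall>i<m. \<lfloor>2 ^ n * x i\<rfloor> = k i)"
  by (auto simp: dyadic_cube_def PiE_def Pi_def floor_eq_iff field_simps)

lemma sets_dyadic_cube [measurable]: "dyadic_cube m n k \<in> sets (lborel_n m)"
  unfolding dyadic_cube_def by (rule sets_PiM_I_finite) auto

lemma emeasure_box:
  assumes "\<And>i. i < m \<Longrightarrow> a i \<le> b i"
  shows "emeasure (lborel_n m) (Pi\<^sub>E {..<m} (\<lambda>i. {a i .. b i})) = ennreal (\<Prod>i<m. b i - a i)"
  using assms by (subst lborel_product.emeasure_PiM) (auto intro!: prod_ennreal)

lemma emeasure_dyadic_cube: "emeasure (lborel_n m) (dyadic_cube m n k) = ennreal ((1 / 2 ^ n) ^ m)"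
  unfolding dyadic_cube_def
  by (subst lborel_product.emeasure_PiM) (auto simp: divide_right_mono simp flip: diff_divide_distrib ennreal_power)

text \<open>
  An open set is the increasing union over \<open>n\<close> of the disjoint cubes of side \<open>2\<^sup>-\<^sup>n\<close> that it contains,
  and Lebesgue measure is outer regular.
\<close>

lemma emeasure_le_of_dyadic_cubes:
  assumes \<nu>: "sets \<nu> = sets (lborel_n m)" and c: "c \<ge> 0"
    and cube: "\<And>n k. emeasure \<nu> (dyadic_cube m n k) \<le> ennreal c * emeasure (lborel_n m) (dyadic_cube m n k)"
    and A: "A \<in> sets (lborel_n m)"
  shows "emeasure \<nu> A \<le> ennreal c * emeasure (lborel_n m) A"
proof -
  let ?L = "lborel_n m" and ?K = "Pi\<^sub>E {..<m} (\<lambda>_. UNIV :: int set)"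
  have [measurable_cong]: "sets \<nu> = sets ?L" by (rule \<nu>)
  have opn: "emeasure \<nu> W \<le> ennreal c * emeasure ?L W"
    if W: "W \<in> sets ?L" and int: "\<And>x. x \<in> W \<Longrightarrow> \<exists>e>0. \<forall>y\<in>coords m. (\<forall>i<m. \<bar>y i - x i\<bar> < e) \<longrightarrow> y \<in> W" for W
  proof -
    define I where "I n = {k \<in> ?K. dyadic_cube m n k \<subseteq> W}" for n
    define U where "U n = (\<Union>k\<in>I n. dyadic_cube m n k)" for n
    have cI: "countable (I n)" for n unfolding I_def
      by (rule countable_subset[of _ ?K]) (auto intro: countable_PiE)
    have disj: "disjoint_family_on (dyadic_cube m n) (I n)" for n
    proof (unfold disjoint_family_on_def, intro ballI impI, rule ccontr)
      fix k l assume kl: "k \<in> I n" "l \<in> I n" "k \<noteq> l" "dyadic_cube m n k \<inter> dyadic_cube m n l \<noteq> {}"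
      then obtain x where "x \<in> dyadic_cube m n k" "x \<in> dyadic_cube m n l" by auto
      then have "k i = l i" if "i < m" for i using that by (auto simp: mem_dyadic_cube)
      then have "k = l" using kl(1,2) by (intro PiE_ext[of k "{..<m}" _ l]) (auto simp: I_def)
      with kl(3) show False by simp
    qed
    have Us: "U n \<in> sets ?L" for n unfolding U_def using cI by (intro sets.countable_UN') auto
    have le: "emeasure \<nu> (U n) \<le> ennreal c * emeasure ?L (U n)" for n
    proof -
      have "emeasure \<nu> (U n) = (\<integral>\<^sup>+k. emeasure \<nu> (dyadic_cube m n k) \<partial>count_space (I n))"
        unfolding U_def by (rule emeasure_UN_countable) (use cI disj \<nu> in auto)
      also have "\<dots> \<le> (\<integral>\<^sup>+k. ennreal c * emeasure ?L (dyadic_cube m n k) \<partial>count_space (I n))"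
        by (rule nn_integral_mono) (rule cube)
      also have "\<dots> = ennreal c * (\<integral>\<^sup>+k. emeasure ?L (dyadic_cube m n k) \<partial>count_space (I n))"
        by (rule nn_integral_cmult) auto
      also have "(\<integral>\<^sup>+k. emeasure ?L (dyadic_cube m n k) \<partial>count_space (I n)) = emeasure ?L (U n)"
        unfolding U_def by (rule emeasure_UN_countable[symmetric]) (use cI disj in auto)
      finally show ?thesis .
    qed
    have inc: "incseq U"
    proof (rule incseq_SucI, rule subsetI)
      fix n x assume "x \<in> U n"
      then obtain k where k: "k \<in> I n" "x \<in> dyadic_cube m n k" by (auto simp: U_def)
      define l where "l = (\<lambda>i\<in>{..<m}. \<lfloor>2 ^ Suc n * x i\<rfloor>)"
      have xl: "x \<in> dyadic_cube m (Suc n) l" using k by (auto simp: mem_dyadic_cube l_def)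
      have "dyadic_cube m (Suc n) l \<subseteq> dyadic_cube m n k"
      proof
        fix y assume y: "y \<in> dyadic_cube m (Suc n) l"
        have "\<lfloor>2 ^ n * y i\<rfloor> = k i" if i: "i < m" for i
        proof -
          have "\<lfloor>2 * (2 ^ n * y i)\<rfloor> = \<lfloor>2 * (2 ^ n * x i)\<rfloor>"
            using y xl i by (auto simp: mem_dyadic_cube mult.assoc)
          moreover have "\<lfloor>t\<rfloor> = \<lfloor>2 * t\<rfloor> div 2" for t :: real by linarith
          ultimately have "\<lfloor>2 ^ n * y i\<rfloor> = \<lfloor>2 ^ n * x i\<rfloor>" by metis
          then show ?thesis using k(2) i by (auto simp: mem_dyadic_cube)
        qed
        then show "y \<in> dyadic_cube m n k" using y by (auto simp: mem_dyadic_cube)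
      qed
      then have "l \<in> I (Suc n)" using k(1) by (auto simp: I_def l_def)
      then show "x \<in> U (Suc n)" using xl by (auto simp: U_def)
    qed
    have UW: "(\<Union>n. U n) = W"
    proof (intro equalityI subsetI)
      fix x assume x: "x \<in> W"
      then have xc: "x \<in> coords m" using sets.sets_into_space[OF W] by (auto simp: space_PiM)
      obtain e where e: "e > 0" "\<And>y. y \<in> coords m \<Longrightarrow> (\<forall>i<m. \<bar>y i - x i\<bar> < e) \<Longrightarrow> y \<in> W"
        using int[OF x] by auto
      obtain n where n: "1 / 2 ^ n < e"
        using real_arch_pow_inv[OF e(1), of "1/2"] by (auto simp: power_one_over)
      define k where "k = (\<lambda>i\<in>{..<m}. \<lfloor>2 ^ n * x i\<rfloor>)"
      have xk: "x \<in> dyadic_cube m n k" using xc by (auto simp: mem_dyadic_cube k_def)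
      have "y \<in> W" if y: "y \<in> dyadic_cube m n k" for y
      proof (rule e(2))
        show "y \<in> coords m" using y by (simp add: mem_dyadic_cube)
        show "\<forall>i<m. \<bar>y i - x i\<bar> < e"
        proof (intro allI impI)
          fix i assume "i < m"
          then have "\<lfloor>2 ^ n * x i\<rfloor> = \<lfloor>2 ^ n * y i\<rfloor>" using xk y by (auto simp: mem_dyadic_cube)
          then have "\<bar>2 ^ n * y i - 2 ^ n * x i\<bar> < 1" by linarith
          moreover have "\<bar>2 ^ n * y i - 2 ^ n * x i\<bar> = 2 ^ n * \<bar>y i - x i\<bar>"
            by (simp add: abs_mult flip: right_diff_distrib)
          ultimately have "\<bar>y i - x i\<bar> < 1 / 2 ^ n" by (simp add: field_simps)
          then show "\<bar>y i - x i\<bar> < e" using n by simp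
        qed
      qed
      then have "k \<in> I n" by (auto simp: I_def k_def)
      then show "x \<in> (\<Union>n. U n)" using xk by (auto simp: U_def)
    qed (auto simp: U_def I_def)
    have "emeasure \<nu> W = (SUP n. emeasure \<nu> (U n))"
      using SUP_emeasure_incseq[of U \<nu>] inc Us \<nu> UW by (simp add: image_subset_iff)
    also have "\<dots> \<le> ennreal c * emeasure ?L W"
    proof (rule SUP_least)
      fix n
      have "emeasure ?L (U n) \<le> emeasure ?L W"
        using W UW by (intro emeasure_mono) auto
      then show "emeasure \<nu> (U n) \<le> ennreal c * emeasure ?L W"
        using le[of n] by (meson mult_left_mono order_trans zero_le)
    qed
    finally show ?thesis .
  qed
  define B where "B N = Pi\<^sub>E {..<m} (\<lambda>_. {- real N <..< real N})" for N
  have Bs [measurable]: "B N \<in> sets ?L" for N unfolding B_def by (rule sets_PiM_I_finite) auto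
  have Bfin: "emeasure ?L (B N) < \<infinity>" for N
    unfolding B_def by (subst lborel_product.emeasure_PiM) (auto simp: power_less_top_ennreal)
  have bdd: "emeasure \<nu> S \<le> ennreal c * emeasure ?L S" if S: "S \<in> sets ?L" "S \<subseteq> B N" for S N
  proof -
    define M where "M = distr (density ?L (indicator (B N))) borel (\<lambda>x. x)"
    have meas: "(\<lambda>x. x) \<in> measurable (density ?L (indicator (B N))) borel"
      using measurable_id_borel by simp
    have M: "emeasure M T = emeasure ?L (T \<inter> coords m \<inter> B N)" if "T \<in> sets borel" for T
    proof -
      have "emeasure M T = emeasure (density ?L (indicator (B N))) (T \<inter> coords m)"
        unfolding M_def using that meas by (simp add: emeasure_distr space_PiM vimage_def)
      also have "\<dots> = emeasure ?L (B N \<inter> (T \<inter> coords m))"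
        using lborel_n_borel[OF that, of m] Bs[of N] by (simp add: emeasure_restricted)
      finally show ?thesis by (simp add: Int_commute)
    qed
    have fin: "emeasure M (space M) \<noteq> \<infinity>"
    proof -
      have "emeasure M (space M) \<le> emeasure ?L (B N)"
        using M[of UNIV] by (simp add: M_def emeasure_mono)
      then show ?thesis using Bfin[of N] by (auto simp: top_unique)
    qed
    have Sc: "S \<inter> coords m \<inter> B N = S"
      using S sets.sets_into_space[OF S(1)] by (auto simp: space_PiM)
    have MS: "emeasure M S = emeasure ?L S" using M[OF borel_lborel_n[OF S(1)]] Sc by simp
    have INF: "emeasure M S = (INF U\<in>{U. S \<subseteq> U \<and> open U}. emeasure M U)"
      by (rule outer_regular) (use fin borel_lborel_n[OF S(1)] in \<open>auto simp: M_def\<close>)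
    show ?thesis
    proof (rule ennreal_le_epsilon)
      fix e :: real assume e: "0 < e"
      define d where "d = e / (c + 1)"
      have d: "d > 0" "c * d \<le> e" using e c by (auto simp: d_def field_simps)
      have Sfin: "emeasure M S \<noteq> \<infinity>"
        using fin emeasure_space[of M S] by (auto simp: top_unique)
      have "emeasure M S < emeasure M S + ennreal d"
        using Sfin d(1) by (cases "emeasure M S") (auto simp: ennreal_less_iff simp flip: ennreal_plus)
      then obtain U where U: "S \<subseteq> U" "open U" "emeasure M U < emeasure M S + ennreal d"
        unfolding INF[symmetric] using INF by (auto simp: INF_less_iff)
      define W where "W = U \<inter> coords m \<inter> B N"
      have Ws: "W \<in> sets ?L" unfolding W_def using lborel_n_borel[OF borel_open[OF U(2)]] by auto
      have "emeasure \<nu> S \<le> emeasure \<nu> W"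
        using U(1) Sc Ws \<nu> by (intro emeasure_mono) (auto simp: W_def)
      also have "\<dots> \<le> ennreal c * emeasure ?L W"
      proof (rule opn[OF Ws])
        fix x assume x: "x \<in> W"
        obtain e1 where e1: "e1 > 0" "\<forall>y\<in>coords m. (\<forall>i<m. \<bar>y i - x i\<bar> < e1) \<longrightarrow> y \<in> U"
          using open_fun_contains_box[OF U(2), of x m] x unfolding W_def by blast
        define e2 where "e2 = Min (insert 1 ((\<lambda>i. real N - \<bar>x i\<bar>) ` {..<m}))"
        have "\<bar>x i\<bar> < real N" if "i < m" for i
        proof -
          have "x i \<in> {- real N <..< real N}"
            using x that unfolding W_def B_def by (meson IntD2 PiE_mem lessThan_iff)
          then show ?thesis by auto
        qed
        then have "e2 > 0" by (auto simp: e2_def)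
        have e2': "e2 \<le> real N - \<bar>x i\<bar>" if "i < m" for i using that by (auto simp: e2_def)
        have "y \<in> W" if y: "y \<in> coords m" "\<forall>i<m. \<bar>y i - x i\<bar> < min e1 e2" for y
        proof -
          have "y i \<in> {- real N <..< real N}" if "i < m" for i
            using e2'[OF that] y(2)[rule_format, OF that] by auto
          then show ?thesis using y e1(2) by (auto simp: W_def B_def PiE_def Pi_def)
        qed
        then show "\<exists>e>0. \<forall>y\<in>coords m. (\<forall>i<m. \<bar>y i - x i\<bar> < e) \<longrightarrow> y \<in> W"
          using e1(1) \<open>e2 > 0\<close> by (intro exI[of _ "min e1 e2"]) auto
      qed
      also have "\<dots> = ennreal c * emeasure M U" using M[OF borel_open[OF U(2)]] by (simp add: W_def)
      also have "\<dots> \<le> ennreal c * (emeasure ?L S + ennreal d)"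
        using U(3) MS by (intro mult_left_mono) auto
      also have "\<dots> = ennreal c * emeasure ?L S + ennreal (c * d)"
        using c d(1) by (simp add: distrib_left ennreal_mult)
      also have "\<dots> \<le> ennreal c * emeasure ?L S + ennreal e"
        using d(2) by (intro add_left_mono ennreal_leI)
      finally show "emeasure \<nu> S \<le> ennreal c * emeasure ?L S + ennreal e" .
    qed
  qed
  have incB: "incseq (\<lambda>N. A \<inter> B N)"
    unfolding B_def by (intro incseq_SucI Int_mono PiE_mono) auto
  have AB: "(\<Union>N. A \<inter> B N) = A"
  proof (intro equalityI subsetI)
    fix x assume x: "x \<in> A"
    then have xc: "x \<in> coords m" using sets.sets_into_space[OF A] by (auto simp: space_PiM)
    obtain N :: nat where N: "real N > Max (insert 0 ((\<lambda>i. \<bar>x i\<bar>) ` {..<m}))" using reals_Archimedean2 by blast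
    then have "\<bar>x i\<bar> < real N" if "i < m" for i using that by auto
    then have "x i \<in> {- real N <..< real N}" if "i < m" for i using that by (force simp: abs_less_iff)
    then have "x \<in> B N" using xc by (simp add: B_def PiE_def Pi_def)
    then show "x \<in> (\<Union>N. A \<inter> B N)" using x by auto
  qed auto
  have "emeasure \<nu> A = (SUP N. emeasure \<nu> (A \<inter> B N))"
    using SUP_emeasure_incseq[of "\<lambda>N. A \<inter> B N" \<nu>] incB A \<nu> AB by (simp add: image_subset_iff sets.Int)
  also have "\<dots> \<le> ennreal c * emeasure ?L A"
  proof (rule SUP_least)
    fix N
    have "emeasure \<nu> (A \<inter> B N) \<le> ennreal c * emeasure ?L (A \<inter> B N)" using bdd[of "A \<inter> B N" N] A by auto
    also have "\<dots> \<le> ennreal c * emeasure ?L A" using A by (intro mult_left_mono emeasure_mono) auto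
    finally show "emeasure \<nu> (A \<inter> B N) \<le> ennreal c * emeasure ?L A" .
  qed
  finally show ?thesis .
qed

section \<open>Change of variables\<close>

definition sup_dist :: "nat \<Rightarrow> (nat \<Rightarrow> real) \<Rightarrow> (nat \<Rightarrow> real) \<Rightarrow> real" where
  "sup_dist m x y = Max (insert 0 ((\<lambda>i. \<bar>x i - y i\<bar>) ` {..<m}))"

lemma sup_dist_nonneg [simp]: "0 \<le> sup_dist m x y"
  by (simp add: sup_dist_def)

lemma coord_le_sup_dist: "i < m \<Longrightarrow> \<bar>x i - y i\<bar> \<le> sup_dist m x y"
  by (auto simp: sup_dist_def)

lemma sup_dist_le_iff: "0 \<le> r \<Longrightarrow> sup_dist m x y \<le> r \<longleftrightarrow> (\<forall>i<m. \<bar>x i - y i\<bar> \<le> r)"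
  by (auto simp: sup_dist_def)

lemma sup_dist_less_iff: "0 < r \<Longrightarrow> sup_dist m x y < r \<longleftrightarrow> (\<forall>i<m. \<bar>x i - y i\<bar> < r)"
  by (auto simp: sup_dist_def)

lemma sup_dist_eq_0D:
  assumes "sup_dist m x y = 0" "x \<in> coords m" "y \<in> coords m"
  shows "x = y"
proof (rule PiE_ext[OF assms(2,3)])
  fix i assume "i \<in> {..<m}"
  then show "x i = y i" using assms(1) coord_le_sup_dist[of i m x y] by simp
qed

lemma continuous_on_sup_dist [continuous_intros]: "continuous_on S (\<lambda>x. sup_dist m y x)"
proof (induction m)
  case (Suc m)
  have "sup_dist (Suc m) y x = max \<bar>y m - x m\<bar> (sup_dist m y x)" for x
    by (simp add: sup_dist_def lessThan_Suc insert_commute[of 0])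
  moreover have "continuous_on S (\<lambda>x. x m)"
    by (rule continuous_on_subset[OF continuous_on_product_coordinates]) simp
  ultimately show ?case using Suc by (auto intro!: continuous_intros)
qed (simp add: sup_dist_def)

lemma emeasure_lipschitz_image:
  assumes S: "S \<in> sets (lborel_n m)" and inj: "inj_on g S" and gS: "g ` S \<subseteq> coords m"
    and meas: "\<And>A. A \<in> sets (lborel_n m) \<Longrightarrow> A \<subseteq> S \<Longrightarrow> g ` A \<in> sets (lborel_n m)"
    and K: "K \<ge> 0" and lip: "\<And>x y. x \<in> S \<Longrightarrow> y \<in> S \<Longrightarrow> sup_dist m (g x) (g y) \<le> K * sup_dist m x y"
  shows "emeasure (lborel_n m) (g ` S) \<le> ennreal (K ^ m) * emeasure (lborel_n m) S"
proof -
  let ?L = "lborel_n m"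
  have gSs: "g ` S \<in> sets ?L" using meas[OF S] by simp
  have pre: "inv_into S g -` A \<inter> g ` S = g ` (A \<inter> S)" for A
    using inj by (auto simp: inv_into_f_f)
  have AS: "g ` (A \<inter> S) \<in> sets ?L" if "A \<in> sets ?L" for A
    using meas[of "A \<inter> S"] that S by auto
  define \<nu> where "\<nu> = distr (restrict_space ?L (g ` S)) ?L (inv_into S g)"
  have "inv_into S g \<in> measurable (restrict_space ?L (g ` S)) ?L"
  proof (rule measurableI)
    fix x assume "x \<in> space (restrict_space ?L (g ` S))"
    then have "x \<in> g ` S" using gSs by (simp add: space_restrict_space2)
    then show "inv_into S g x \<in> space ?L" using inv_into_into[of x g S] sets.sets_into_space[OF S] by blast
  next
    fix A assume "A \<in> sets ?L"
    then show "inv_into S g -` A \<inter> space (restrict_space ?L (g ` S)) \<in> sets (restrict_space ?L (g ` S))"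
      using gSs pre[of A] AS[of A] by (auto simp: space_restrict_space2 sets_restrict_space_iff)
  qed
  then have \<nu>: "emeasure \<nu> A = emeasure ?L (g ` (A \<inter> S))" if "A \<in> sets ?L" for A
    unfolding \<nu>_def using that gSs pre[of A]
    by (simp add: emeasure_distr emeasure_restrict_space space_restrict_space2 image_mono)
  have "emeasure \<nu> S \<le> ennreal (K ^ m) * emeasure ?L S"
  proof (rule emeasure_le_of_dyadic_cubes)
    fix n k
    let ?Q = "dyadic_cube m n k" and ?s = "1 / 2 ^ n :: real"
    have "emeasure ?L (g ` (?Q \<inter> S)) \<le> ennreal (K ^ m) * ennreal (?s ^ m)"
    proof (cases "?Q \<inter> S = {}")
      case False
      define a where "a i = (INF y\<in>g ` (?Q \<inter> S). y i)" for i
      have diam: "y i - K * ?s \<le> z i" if i: "i < m" and yz: "y \<in> g ` (?Q \<inter> S)" "z \<in> g ` (?Q \<inter> S)" for i y z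
      proof -
        obtain u v where uv: "u \<in> ?Q" "v \<in> ?Q" "u \<in> S" "v \<in> S" "y = g u" "z = g v" using yz by blast
        have "sup_dist m u v \<le> ?s"
        proof (subst sup_dist_le_iff; (intro allI impI)?)
          fix j assume "j < m"
          then have "\<lfloor>2 ^ n * u j\<rfloor> = \<lfloor>2 ^ n * v j\<rfloor>" using uv by (simp add: mem_dyadic_cube)
          then have "\<bar>2 ^ n * u j - 2 ^ n * v j\<bar> \<le> 1" by linarith
          moreover have "\<bar>2 ^ n * u j - 2 ^ n * v j\<bar> = 2 ^ n * \<bar>u j - v j\<bar>"
            by (simp add: abs_mult flip: right_diff_distrib)
          ultimately show "\<bar>u j - v j\<bar> \<le> ?s" by (simp add: field_simps)
        qed simp
        then have "sup_dist m (g u) (g v) \<le> K * ?s"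
          using lip[OF uv(3,4)] K by (meson mult_left_mono order_trans)
        then have "\<bar>y i - z i\<bar> \<le> K * ?s" using coord_le_sup_dist[OF i, of y z] uv(5,6) by simp
        then show ?thesis by linarith
      qed
      have sub: "g ` (?Q \<inter> S) \<subseteq> Pi\<^sub>E {..<m} (\<lambda>i. {a i .. a i + K * ?s})"
      proof
        fix y assume y: "y \<in> g ` (?Q \<inter> S)"
        have "a i \<le> y i \<and> y i \<le> a i + K * ?s" if i: "i < m" for i
        proof
          have "bdd_below ((\<lambda>y. y i) ` g ` (?Q \<inter> S))"
            using diam[OF i y] by (auto intro!: bdd_belowI2[of _ "y i - K * ?s"])
          then show "a i \<le> y i" unfolding a_def by (rule cINF_lower[OF _ y])
          have "y i - K * ?s \<le> a i"
            unfolding a_def by (rule cINF_greatest) (use False diam[OF i y] in auto)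
          then show "y i \<le> a i + K * ?s" by simp
        qed
        moreover have "y \<in> coords m" using y gS by blast
        ultimately show "y \<in> Pi\<^sub>E {..<m} (\<lambda>i. {a i .. a i + K * ?s})" by (simp add: PiE_def Pi_def)
      qed
      have "emeasure ?L (g ` (?Q \<inter> S)) \<le> emeasure ?L (Pi\<^sub>E {..<m} (\<lambda>i. {a i .. a i + K * ?s}))"
        by (rule emeasure_mono[OF sub]) (rule sets_PiM_I_finite, auto)
      also have "\<dots> = ennreal ((K * ?s) ^ m)"
        using K by (subst emeasure_box) auto
      also have "\<dots> = ennreal (K ^ m) * ennreal (?s ^ m)"
        using K by (simp add: power_mult_distrib power_divide flip: ennreal_mult)
      finally show ?thesis .
    qed simp
    then show "emeasure \<nu> ?Q \<le> ennreal (K ^ m) * emeasure ?L ?Q"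
      by (simp add: \<nu> emeasure_dyadic_cube)
  qed (use S K in \<open>auto simp: \<nu>_def\<close>)
  then show ?thesis using \<nu>[OF S] by simp
qed

lemma det_near_identity:
  fixes G :: "real mat"
  assumes G: "G \<in> carrier_mat m m" and e: "0 \<le> e" "e < 1"
    and row: "\<And>i. i < m \<Longrightarrow> (\<Sum>j<m. \<bar>G $$ (i, j) - (if i = j then 1 else 0)\<bar>) \<le> e"
  shows "Determinant.det G \<noteq> 0"
    and "\<bar>Determinant.det G\<bar> \<le> (1 + e) ^ m" and "(1 - e) ^ m \<le> \<bar>Determinant.det G\<bar>"
proof -
  let ?L = "lborel_n m"
  have near: "\<bar>(\<Sum>j<m. G $$ (i, j) * v j) - v i\<bar> \<le> e * r"
    if "i < m" "\<And>j. j < m \<Longrightarrow> \<bar>v j\<bar> \<le> r" for v r i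
  proof -
    have "(\<Sum>j<m. G $$ (i, j) * v j) - v i = (\<Sum>j<m. (G $$ (i, j) - (if i = j then 1 else 0)) * v j)"
    proof -
      have "(\<Sum>j<m. (if i = j then 1 else 0) * v j) = (\<Sum>j<m. if i = j then v j else 0)"
        by (rule sum.cong) auto
      then show ?thesis using that(1) by (simp add: left_diff_distrib sum_subtractf)
    qed
    also have "\<bar>\<dots>\<bar> \<le> (\<Sum>j<m. \<bar>G $$ (i, j) - (if i = j then 1 else 0)\<bar> * r)"
      by (rule order_trans[OF sum_abs]) (auto intro!: sum_mono mult_left_mono that simp: abs_mult)
    also have "\<dots> \<le> e * r"
      using row[OF that(1)] that(2)[OF that(1)] by (simp flip: sum_distrib_right add: mult_right_mono)
    finally show ?thesis .
  qed
  have diff: "mat_act m G x i - mat_act m G y i = (\<Sum>j<m. G $$ (i, j) * (x j - y j))" if "i < m" for x y i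
    using that by (simp add: mat_act_def right_diff_distrib sum_subtractf)
  have up: "sup_dist m (mat_act m G x) (mat_act m G y) \<le> (1 + e) * sup_dist m x y" for x y
  proof -
    have "\<bar>mat_act m G x i - mat_act m G y i\<bar> \<le> (1 + e) * sup_dist m x y" if i: "i < m" for i
      using near[OF i, of "\<lambda>j. x j - y j" "sup_dist m x y"] coord_le_sup_dist[OF i, of x y]
        coord_le_sup_dist[of _ m x y] diff[OF i, of x y] by (simp add: distrib_right)
    then show ?thesis using e by (subst sup_dist_le_iff) auto
  qed
  have low: "sup_dist m x y \<le> 1 / (1 - e) * sup_dist m (mat_act m G x) (mat_act m G y)" for x y
  proof -
    let ?d = "sup_dist m (mat_act m G x) (mat_act m G y)"
    have "sup_dist m x y \<le> e * sup_dist m x y + ?d"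
    proof (subst sup_dist_le_iff; (intro allI impI)?)
      fix i assume i: "i < m"
      show "\<bar>x i - y i\<bar> \<le> e * sup_dist m x y + ?d"
        using near[OF i, of "\<lambda>j. x j - y j" "sup_dist m x y"] coord_le_sup_dist[OF i, of "mat_act m G x" "mat_act m G y"]
          coord_le_sup_dist[of _ m x y] diff[OF i, of x y] by simp
    qed (use e in simp)
    then show ?thesis using e by (simp add: field_simps)
  qed
  show det: "Determinant.det G \<noteq> 0"
  proof
    assume "Determinant.det G = 0"
    then obtain v where v: "v \<in> carrier_vec m" "v \<noteq> 0\<^sub>v m" "G *\<^sub>v v = 0\<^sub>v m"
      using det_0_iff_vec_prod_zero[OF G] by auto
    define x where "x = (\<lambda>i\<in>{..<m}. vec_index v i)"
    define z where "z = (\<lambda>i\<in>{..<m}. 0 :: real)"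
    have act: "mat_act m G x = mat_act m G z"
    proof
      fix i
      have "(\<Sum>j<m. G $$ (i, j) * x j) = vec_index (G *\<^sub>v v) i" if "i < m"
        using that G v(1) by (auto simp: scalar_prod_def x_def lessThan_atLeast0 intro!: sum.cong)
      then show "mat_act m G x i = mat_act m G z i"
        using v(3) by (auto simp: mat_act_def z_def)
    qed
    have "sup_dist m x z = 0"
      using low[of x z] act sup_dist_le_iff[of 0 m "mat_act m G z" "mat_act m G z"] sup_dist_nonneg
      by (metis abs_zero diff_self mult_zero_right order_antisym order_refl)
    then have "x = z" by (rule sup_dist_eq_0D) (auto simp: x_def z_def)
    then have "vec_index v i = 0" if "i < m" for i
      using that by (metis lessThan_iff restrict_apply' x_def z_def)
    then have "v = 0\<^sub>v m" using v(1) by auto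
    with v(2) show False by simp
  qed
  define Q where "Q = Pi\<^sub>E {..<m} (\<lambda>_. {0..1::real})"
  have Qs: "Q \<in> sets ?L" unfolding Q_def by (rule sets_PiM_I_finite) auto
  have Q1: "emeasure ?L Q = 1" unfolding Q_def by (subst emeasure_box) auto
  have Qc: "Q \<subseteq> coords m" unfolding Q_def by (rule PiE_mono) auto
  have inj: "inj_on (mat_act m G) Q"
  proof (rule inj_onI)
    fix x y assume xy: "x \<in> Q" "y \<in> Q" "mat_act m G x = mat_act m G y"
    have "sup_dist m (mat_act m G x) (mat_act m G y) = 0"
      using sup_dist_le_iff[of 0 m "mat_act m G x" "mat_act m G y"] xy(3) by (simp add: order_antisym)
    then have "sup_dist m x y = 0" using low[of x y] by (simp add: order_antisym)
    then show "x = y" using xy Qc by (intro sup_dist_eq_0D[of m]) auto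
  qed
  note img = emeasure_mat_act_image[OF G det]
  have "ennreal \<bar>Determinant.det G\<bar> \<le> ennreal ((1 + e) ^ m)"
    using emeasure_lipschitz_image[OF Qs inj _ _ _ up] img Q1 Qs e by (simp add: image_subset_iff)
  then show "\<bar>Determinant.det G\<bar> \<le> (1 + e) ^ m" using e by (subst (asm) ennreal_le_iff) auto
  let ?h = "inv_into Q (mat_act m G)"
  obtain B where B: "B \<in> carrier_mat m m" "B * G = 1\<^sub>m m" "G * B = 1\<^sub>m m"
    using det_non_zero_imp_unit[OF G det] by (auto simp: Units_def ring_mat_def)
  have detB: "Determinant.det B \<noteq> 0"
    using det_mult[OF G B(1)] B(3) by auto
  have hB: "?h x = mat_act m B x" if "x \<in> mat_act m G ` Q" for x
  proof -
    obtain y where y: "y \<in> Q" "x = mat_act m G y" using \<open>x \<in> _\<close> by blast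
    have "?h x = y" using y inj by (simp add: inv_into_f_f)
    moreover have "mat_act m B x = y"
      using y Qc mat_act_mult[OF B(1) G, of y] B(2) mat_act_one[of y m] by (metis subsetD)
    ultimately show ?thesis by simp
  qed
  have "emeasure ?L (?h ` mat_act m G ` Q) \<le> ennreal ((1 / (1 - e)) ^ m) * emeasure ?L (mat_act m G ` Q)"
  proof (rule emeasure_lipschitz_image)
    show "mat_act m G ` Q \<in> sets ?L" using img Qs by blast
    show "inj_on ?h (mat_act m G ` Q)" by (rule inj_on_inv_into) simp
    show "?h ` mat_act m G ` Q \<subseteq> coords m" using inj Qc by auto
    show "?h ` A \<in> sets ?L" if "A \<in> sets ?L" "A \<subseteq> mat_act m G ` Q" for A
    proof -
      have "?h ` A = mat_act m B ` A" using hB that(2) by (intro image_cong) auto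
      then show ?thesis using emeasure_mat_act_image(1)[OF B(1) detB that(1)] by simp
    qed
    show "sup_dist m (?h x) (?h y) \<le> 1 / (1 - e) * sup_dist m x y"
      if "x \<in> mat_act m G ` Q" "y \<in> mat_act m G ` Q" for x y
      using low[of "?h x" "?h y"] that by (simp add: f_inv_into_f)
  qed (use e in auto)
  then have "ennreal 1 \<le> ennreal ((1 / (1 - e)) ^ m * \<bar>Determinant.det G\<bar>)"
    using img[OF Qs] Q1 inj e by (simp add: ennreal_mult)
  then have "1 \<le> (1 / (1 - e)) ^ m * \<bar>Determinant.det G\<bar>"
    using e by (subst (asm) ennreal_le_iff) auto
  then show "(1 - e) ^ m \<le> \<bar>Determinant.det G\<bar>"
    using e by (simp add: power_divide field_simps)
qed

lemma emeasure_le_of_countable_cover: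
  assumes sets: "sets M = sets N" and I: "countable I" and X: "\<And>i. i \<in> I \<Longrightarrow> X i \<in> sets M"
    and cover: "space M \<subseteq> (\<Union>i\<in>I. X i)"
    and le: "\<And>i A. i \<in> I \<Longrightarrow> A \<in> sets M \<Longrightarrow> A \<subseteq> X i \<Longrightarrow> emeasure M A \<le> c * emeasure N A"
    and A: "A \<in> sets M"
  shows "emeasure M A \<le> c * emeasure N A"
proof (cases "I = {}")
  case True
  then have "A = {}" using cover sets.sets_into_space[OF A] by auto
  then show ?thesis by simp
next
  case False
  define Y where "Y n = A \<inter> disjointed (\<lambda>n. X (from_nat_into I n)) n" for n
  have XI: "from_nat_into I n \<in> I" for n using False by (rule from_nat_into)
  have Xs: "range (\<lambda>n. X (from_nat_into I n)) \<subseteq> sets M" using X XI by auto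
  have Ys: "Y n \<in> sets M" for n
    using A sets.range_disjointed_sets[OF Xs] by (auto simp: Y_def)
  have Yd: "disjoint_family Y"
    using disjoint_family_disjointed[of "\<lambda>n. X (from_nat_into I n)"] by (auto simp: Y_def disjoint_family_on_def)
  have "(\<Union>n. X (from_nat_into I n)) = (\<Union>i\<in>I. X i)"
    using range_from_nat_into[OF False I] by (metis image_image)
  then have YA: "(\<Union>n. Y n) = A"
    using cover sets.sets_into_space[OF A] UN_disjointed_eq[of "\<lambda>n. X (from_nat_into I n)"]
    by (simp add: Y_def flip: Int_UN_distrib) auto
  have Yle: "emeasure M (Y n) \<le> c * emeasure N (Y n)" for n
    by (rule le[OF XI Ys]) (use disjointed_subset[of "\<lambda>n. X (from_nat_into I n)"] in \<open>auto simp: Y_def\<close>)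
  have "emeasure M A = (\<Sum>n. emeasure M (Y n))"
    using suminf_emeasure[of Y M] Ys Yd YA by (simp add: image_subset_iff)
  also have "\<dots> \<le> (\<Sum>n. c * emeasure N (Y n))" by (intro suminf_le Yle) auto
  also have "\<dots> = c * (\<Sum>n. emeasure N (Y n))" by simp
  also have "(\<Sum>n. emeasure N (Y n)) = emeasure N A"
    using suminf_emeasure[of Y N] Ys Yd YA sets by (simp add: image_subset_iff)
  finally show ?thesis .
qed

text \<open>
  The derivative need not be continuous. Its invertibility splits the space into countably many Borel
  pieces on each of which the map, followed by a suitable rational matrix \<open>B\<close>, distorts the sup
  distance by at most \<open>1 \<plusminus> e\<close>; on such a piece Lipschitz bounds in both directions compare the
  measure of the image with the integral of the Jacobian.
\<close>

locale coords_diffeo =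
  fixes m :: nat and \<psi> :: "(nat \<Rightarrow> real) \<Rightarrow> nat \<Rightarrow> real" and D :: "(nat \<Rightarrow> real) \<Rightarrow> real mat"
  assumes bij: "bij_betw \<psi> (coords m) (coords m)"
    and D_carrier: "\<And>x. x \<in> coords m \<Longrightarrow> D x \<in> carrier_mat m m"
    and det_D: "\<And>x. x \<in> coords m \<Longrightarrow> Determinant.det (D x) \<noteq> 0"
    and deriv: "\<And>x e. x \<in> coords m \<Longrightarrow> e > 0 \<Longrightarrow> \<exists>d>0. \<forall>y\<in>coords m. sup_dist m y x < d \<longrightarrow>
      (\<forall>i<m. \<bar>\<psi> y i - \<psi> x i - (\<Sum>j<m. D x $$ (i, j) * (y j - x j))\<bar> \<le> e * sup_dist m y x)"
    and det_meas: "(\<lambda>x. Determinant.det (D x)) \<in> borel_measurable (lborel_n m)"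
begin

abbreviation "L \<equiv> lborel_n m"

definition X :: "(nat \<Rightarrow> real) set" where "X = coords m"

lemma X_undefined: "x \<in> X \<Longrightarrow> \<not> i < m \<Longrightarrow> x i = undefined"
  by (auto simp: X_def PiE_def extensional_def)

lemmas bijX = bij[folded X_def]
lemmas derivX = deriv[folded X_def]
lemmas D_carrierX = D_carrier[folded X_def]
lemmas det_DX = det_D[folded X_def]

lemma space_L: "space L = X"
  by (simp add: X_def space_PiM)

lemma sets_L_subset: "A \<in> sets L \<Longrightarrow> A \<subseteq> X"
  using sets.sets_into_space[of A L] by (simp add: space_L)

lemma lborel_n_borel': "A \<in> sets borel \<Longrightarrow> A \<subseteq> X \<Longrightarrow> A \<in> sets L"
  using lborel_n_borel[of A m] by (simp add: X_def Int_absorb2)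

lemma closed_X: "closed X"
  by (simp add: X_def closed_coords)


definition \<theta> :: "(nat \<Rightarrow> real) \<Rightarrow> nat \<Rightarrow> real" where "\<theta> = inv_into X \<psi>"

lemma \<theta>_\<psi>: "x \<in> X \<Longrightarrow> \<theta> (\<psi> x) = x"
  using bijX by (simp add: \<theta>_def bij_betw_def inv_into_f_f)

lemma \<psi>_\<theta>: "x \<in> X \<Longrightarrow> \<psi> (\<theta> x) = x"
  using bijX by (simp add: \<theta>_def bij_betw_def f_inv_into_f)

lemma \<psi>_coords: "x \<in> X \<Longrightarrow> \<psi> x \<in> X"
  using bijX by (rule bij_betw_apply)

lemma \<theta>_coords: "x \<in> X \<Longrightarrow> \<theta> x \<in> X"
  unfolding \<theta>_def using bijX by (metis bij_betw_apply bij_betw_inv_into)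

lemma continuous_coord: "continuous_on (X) (\<lambda>x. \<psi> x i)"
proof (cases "i < m")
  case False
  have "continuous_on (X) (\<lambda>x. undefined :: real)" by (rule continuous_on_const)
  then show ?thesis
    by (rule continuous_on_eq) (use X_undefined[OF \<psi>_coords False] in simp)
next
  case i: True
  show ?thesis
  proof (rule continuous_on_sequentiallyI)
    fix u x assume u: "\<forall>n::nat. u n \<in> X" and x: "x \<in> X" and ux: "u \<longlonglongrightarrow> x"
    have "(\<lambda>n. sup_dist m x (u n)) \<longlonglongrightarrow> sup_dist m x x"
      by (rule continuous_on_tendsto_compose[OF continuous_on_sup_dist[of UNIV] ux]) auto
    moreover have "sup_dist m x x = 0" using sup_dist_le_iff[of 0 m x x] by (simp add: order_antisym)
    moreover have sym: "sup_dist m (u n) x = sup_dist m x (u n)" for n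
      by (simp add: sup_dist_def abs_minus_commute)
    ultimately have lim: "(\<lambda>n. sup_dist m (u n) x) \<longlonglongrightarrow> 0" by simp
    obtain d where d: "d > 0" "\<And>y. y \<in> X \<Longrightarrow> sup_dist m y x < d \<Longrightarrow>
      \<bar>\<psi> y i - \<psi> x i - (\<Sum>j<m. D x $$ (i, j) * (y j - x j))\<bar> \<le> 1 * sup_dist m y x"
      using derivX[OF x, of 1] i by fastforce
    define c where "c = (\<Sum>j<m. \<bar>D x $$ (i, j)\<bar>)"
    have "\<forall>\<^sub>F n in sequentially. norm (\<psi> (u n) i - \<psi> x i) \<le> (1 + c) * sup_dist m (u n) x"
      using order_tendstoD(2)[OF lim d(1)]
    proof eventually_elim
      case (elim n)
      have "\<bar>\<Sum>j<m. D x $$ (i, j) * (u n j - x j)\<bar> \<le> (\<Sum>j<m. \<bar>D x $$ (i, j)\<bar> * sup_dist m (u n) x)"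
        by (rule order_trans[OF sum_abs]) (auto intro!: sum_mono mult_left_mono coord_le_sup_dist simp: abs_mult)
      also have "\<dots> = c * sup_dist m (u n) x" by (simp add: c_def sum_distrib_right)
      finally show ?case using d(2)[of "u n"] u elim by (simp add: distrib_right)
    qed
    then have "(\<lambda>n. \<psi> (u n) i - \<psi> x i) \<longlonglongrightarrow> 0"
      by (rule Lim_null_comparison) (use tendsto_mult_right_zero[OF lim] in simp)
    then show "(\<lambda>n. \<psi> (u n) i) \<longlonglongrightarrow> \<psi> x i" by (simp add: LIM_zero_iff)
  qed
qed

lemma measurable_\<psi> [measurable]: "\<psi> \<in> measurable L L"
proof (rule measurable_into_lborel_n)
  show "\<psi> x i = undefined" if "x \<in> space L" "\<not> i < m" for x i
    using that \<psi>_coords[of x] X_undefined by (simp add: space_L)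
  fix i
  have "(\<lambda>x. \<psi> x i) \<in> borel_measurable (restrict_space borel (X))"
    by (rule borel_measurable_continuous_on_restrict[OF continuous_coord])
  moreover have "(\<lambda>x. x) \<in> measurable L (restrict_space borel (X))"
    by (rule measurable_restrict_space2[OF _ measurable_id_borel]) (simp add: space_L)
  ultimately show "(\<lambda>x. \<psi> x i) \<in> borel_measurable L" by (rule measurable_compose[rotated])
qed

lemma image_\<psi>: assumes "A \<in> sets L" shows "\<psi> ` A \<in> sets L"
proof -
  define K where "K N = Pi\<^sub>E UNIV (\<lambda>i. if i < m then {- real N .. real N} else {undefined})" for N
  have Kc: "compact (K N)" for N
  proof -
    have "compactin (product_topology (\<lambda>_. euclidean) UNIV) (K N)"
      unfolding K_def by (subst compactin_PiE) auto
    then show ?thesis by (metis compactin_euclidean_iff euclidean_product_topology)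
  qed
  have Ksub: "K N \<subseteq> X" for N
  proof (unfold K_def X_def, rule subsetI, rule PiE_I)
    fix x i assume x: "x \<in> Pi\<^sub>E UNIV (\<lambda>i. if i < m then {- real N .. real N} else {undefined})"
    show "x i = undefined" if "i \<notin> {..<m}" using PiE_mem[OF x, of i] that by simp
  qed simp
  have KU: "(\<Union>N. K N) = X"
  proof (intro equalityI subsetI)
    fix x assume x: "x \<in> X"
    obtain N :: nat where N: "real N > Max (insert 0 ((\<lambda>i. \<bar>x i\<bar>) ` {..<m}))" using reals_Archimedean2 by blast
    then have "\<bar>x i\<bar> < real N" if "i < m" for i using that by auto
    then have "- real N \<le> x i \<and> x i \<le> real N" if "i < m" for i using that by (metis abs_less_iff less_imp_le minus_less_iff)
    then have "x \<in> K N" unfolding K_def using X_undefined[OF x] by (intro PiE_I) auto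
    then show "x \<in> (\<Union>N. K N)" by auto
  qed (use Ksub in auto)
  have cont: "continuous_on (X) \<psi>"
    by (rule continuous_on_coordinatewise_then_product[OF continuous_coord])
  have sub: "A \<subseteq> X" using sets.sets_into_space[OF assms] by (simp add: space_L)
  have "\<psi> ` (A \<inter> (\<Union>N. K N)) \<in> sets borel"
  proof (rule borel_image_inj_sigma_compact[OF Kc])
    show "continuous_on (K N) \<psi>" for N by (rule continuous_on_subset[OF cont Ksub])
    show "inj_on \<psi> (\<Union>N. K N)" unfolding KU using bijX by (simp add: bij_betw_def)
  qed (rule borel_lborel_n[OF assms])
  then have "\<psi> ` A \<in> sets borel" using sub KU by (simp add: Int_absorb2)
  then show ?thesis by (rule lborel_n_borel') (use \<psi>_coords sub in auto)
qed

lemma \<theta>_vimage: "A \<subseteq> X \<Longrightarrow> \<theta> -` A \<inter> X = \<psi> ` A"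
  by (auto simp: subset_iff \<theta>_\<psi> \<psi>_coords) (metis \<psi>_\<theta> imageI)

lemma measurable_\<theta> [measurable]: "\<theta> \<in> measurable L L"
proof (rule measurableI)
  show "\<theta> x \<in> space L" if "x \<in> space L" for x
    using that \<theta>_coords by (simp only: space_L)
  show "\<theta> -` A \<inter> space L \<in> sets L" if A: "A \<in> sets L" for A
    using \<theta>_vimage[of A] image_\<psi>[OF A] sets.sets_into_space[OF A] by (simp only: space_L)
qed

definition N1 :: "(nat \<Rightarrow> real) measure" where "N1 = distr L L \<theta>"
definition N2 :: "(nat \<Rightarrow> real) measure" where "N2 = density L (\<lambda>x. ennreal \<bar>Determinant.det (D x)\<bar>)"

lemma emeasure_N1: "A \<in> sets L \<Longrightarrow> emeasure N1 A = emeasure L (\<psi> ` A)"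
  using \<theta>_vimage[of A] sets_L_subset[of A]
  unfolding N1_def by (simp add: emeasure_distr space_L)

lemma emeasure_N2: "A \<in> sets L \<Longrightarrow> emeasure N2 A = (\<integral>\<^sup>+x. ennreal \<bar>Determinant.det (D x)\<bar> * indicator A x \<partial>L)"
  unfolding N2_def using det_meas by (subst emeasure_density) auto

definition piece :: "real \<Rightarrow> nat \<Rightarrow> real mat \<Rightarrow> (nat \<Rightarrow> real) set" where
  "piece e n B = {x \<in> X. \<forall>y\<in>X. sup_dist m y x < 1 / real (Suc n) \<longrightarrow>
     (\<forall>i<m. \<bar>mat_act m B (\<psi> y) i - mat_act m B (\<psi> x) i - (y i - x i)\<bar> \<le> e * sup_dist m y x)}"

lemma sets_piece [measurable]: "piece e n B \<in> sets L"
proof -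
  have cpsi: "continuous_on (X) (\<lambda>x. mat_act m B (\<psi> x) i)" if "i < m" for i
    using that unfolding mat_act_def by (auto intro!: continuous_intros continuous_coord)
  have cid: "continuous_on (X) (\<lambda>x. x i)" for i
    by (rule continuous_on_subset[OF continuous_on_product_coordinates]) simp
  have csup: "continuous_on (X) (\<lambda>x. sup_dist m y x)" for y
    by (rule continuous_on_sup_dist)
  have "piece e n B = X \<inter> (\<Inter>y\<in>X. {x \<in> X. 1 / real (Suc n) \<le> sup_dist m y x} \<union>
    (X \<inter> (\<Inter>i\<in>{..<m}. {x \<in> X. \<bar>mat_act m B (\<psi> y) i - mat_act m B (\<psi> x) i - (y i - x i)\<bar> \<le> e * sup_dist m y x})))"
    unfolding piece_def by (auto simp: not_less simp del: PiE_iff) (meson not_less lessThan_iff)+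
  also have "closed \<dots>"
    by (intro closed_Int closed_INT closed_Un ballI continuous_on_closed_Collect_le closed_X)
      (auto intro!: continuous_intros cpsi cid csup closed_X)
  finally have "closed (piece e n B)" .
  from borel_closed[OF this] show ?thesis by (rule lborel_n_borel') (auto simp: piece_def)
qed

lemma expansion:
  assumes x: "x \<in> X" and B: "B \<in> carrier_mat m m" and i: "i < m"
  shows "(mat_act m B (\<psi> y) i - mat_act m B (\<psi> x) i) - (\<Sum>j<m. (B * D x) $$ (i, j) * (y j - x j))
      = (\<Sum>k<m. B $$ (i, k) * (\<psi> y k - \<psi> x k - (\<Sum>j<m. D x $$ (k, j) * (y j - x j))))"
proof -
  have "(\<Sum>j<m. (B * D x) $$ (i, j) * (y j - x j)) = (\<Sum>j<m. \<Sum>k<m. B $$ (i, k) * D x $$ (k, j) * (y j - x j))"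
    using B D_carrierX[OF x] i by (auto simp: scalar_prod_def sum_distrib_right lessThan_atLeast0 intro!: sum.cong)
  also have "\<dots> = (\<Sum>k<m. B $$ (i, k) * (\<Sum>j<m. D x $$ (k, j) * (y j - x j)))"
    by (subst sum.swap) (simp add: sum_distrib_left mult.assoc)
  finally show ?thesis
    using i by (simp add: mat_act_def right_diff_distrib sum_subtractf)
qed

lemma expansion_bound:
  assumes x: "x \<in> X" and B: "B \<in> carrier_mat m m" and e: "0 < e"
  shows "\<exists>d>0. \<forall>y\<in>X. \<forall>i<m. sup_dist m y x < d \<longrightarrow>
    \<bar>(mat_act m B (\<psi> y) i - mat_act m B (\<psi> x) i) - (\<Sum>j<m. (B * D x) $$ (i, j) * (y j - x j))\<bar> \<le> e * sup_dist m y x"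
proof -
  define c where "c = (\<Sum>i<m. \<Sum>k<m. \<bar>B $$ (i, k)\<bar>)"
  have c0: "c \<ge> 0" by (simp add: c_def sum_nonneg)
  obtain d where d: "d > 0" "\<And>y i. y \<in> X \<Longrightarrow> sup_dist m y x < d \<Longrightarrow> i < m \<Longrightarrow>
      \<bar>\<psi> y i - \<psi> x i - (\<Sum>j<m. D x $$ (i, j) * (y j - x j))\<bar> \<le> e / (c + 1) * sup_dist m y x"
    using derivX[OF x, of "e / (c + 1)"] e c0 by fastforce
  have "\<bar>(mat_act m B (\<psi> y) i - mat_act m B (\<psi> x) i) - (\<Sum>j<m. (B * D x) $$ (i, j) * (y j - x j))\<bar> \<le> e * sup_dist m y x"
    if y: "y \<in> X" "sup_dist m y x < d" and i: "i < m" for y i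
  proof -
    have ci: "(\<Sum>k<m. \<bar>B $$ (i, k)\<bar>) \<le> c"
      unfolding c_def using i by (intro member_le_sum) (auto intro: sum_nonneg)
    have "\<bar>\<Sum>k<m. B $$ (i, k) * (\<psi> y k - \<psi> x k - (\<Sum>j<m. D x $$ (k, j) * (y j - x j)))\<bar>
      \<le> (\<Sum>k<m. \<bar>B $$ (i, k)\<bar> * (e / (c + 1) * sup_dist m y x))"
      by (rule order_trans[OF sum_abs], rule sum_mono, unfold abs_mult, rule mult_left_mono) (use d(2)[OF y] in auto)
    also have "\<dots> = (\<Sum>k<m. \<bar>B $$ (i, k)\<bar>) / (c + 1) * (e * sup_dist m y x)"
      by (simp add: sum_distrib_right sum_divide_distrib)
    also have "\<dots> \<le> 1 * (e * sup_dist m y x)" using c0 ci e by (intro mult_right_mono) auto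
    finally show ?thesis unfolding expansion[OF x B i] by simp
  qed
  then show ?thesis using d(1) by blast
qed

lemma sum_minus_coord:
  fixes G :: "real mat"
  assumes "i < m"
  shows "(\<Sum>j<m. G $$ (i, j) * v j) - v i = (\<Sum>j<m. (G $$ (i, j) - (if i = j then 1 else 0)) * v j)"
proof -
  have "(\<Sum>j<m. (if i = j then 1 else 0) * v j) = (\<Sum>j<m. if i = j then v j else 0)"
    by (rule sum.cong) auto
  then show ?thesis using assms by (simp add: left_diff_distrib sum_subtractf)
qed

lemma row_sum_le:
  assumes x: "x \<in> piece e n B" and B: "B \<in> carrier_mat m m" and i: "i < m" and e: "0 \<le> e"
  shows "(\<Sum>j<m. \<bar>(B * D x) $$ (i, j) - (if i = j then 1 else 0)\<bar>) \<le> e"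
proof (rule field_le_epsilon)
  fix e' :: real assume e': "0 < e'"
  have xc: "x \<in> X" using x by (simp add: piece_def)
  let ?G = "B * D x"
  obtain d where d: "d > 0" "\<And>y. y \<in> X \<Longrightarrow> sup_dist m y x < d \<Longrightarrow>
    \<bar>(mat_act m B (\<psi> y) i - mat_act m B (\<psi> x) i) - (\<Sum>j<m. ?G $$ (i, j) * (y j - x j))\<bar> \<le> e' * sup_dist m y x"
    using expansion_bound[OF xc B e'] i by blast
  obtain t where "0 < t" "t < min d (1 / real (Suc n))"
    using dense[of 0 "min d (1 / real (Suc n))"] d(1) by auto
  then have t: "t > 0" "t < d" "t < 1 / real (Suc n)" by auto
  define y where "y = (\<lambda>j\<in>{..<m}. x j + t * sgn (?G $$ (i, j) - (if i = j then 1 else 0)))"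
  have yc: "y \<in> X" by (simp add: y_def X_def)
  have yx: "sup_dist m y x \<le> t" using t(1) by (subst sup_dist_le_iff) (auto simp: y_def abs_mult abs_sgn_eq)
  have "\<bar>(mat_act m B (\<psi> y) i - mat_act m B (\<psi> x) i) - (\<Sum>j<m. ?G $$ (i, j) * (y j - x j))\<bar> \<le> e' * sup_dist m y x"
    using d(2)[OF yc] yx t(2) by simp
  moreover have "\<bar>mat_act m B (\<psi> y) i - mat_act m B (\<psi> x) i - (y i - x i)\<bar> \<le> e * sup_dist m y x"
  proof -
    have "sup_dist m y x < 1 / real (Suc n)" using yx t(3) by linarith
    then show ?thesis using x yc i unfolding piece_def by blast
  qed
  ultimately have "(\<Sum>j<m. ?G $$ (i, j) * (y j - x j)) - (y i - x i) \<le> (e + e') * sup_dist m y x"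
    unfolding distrib_right by linarith
  also have "\<dots> \<le> (e + e') * t" using yx e e' by (intro mult_left_mono) auto
  also have "(\<Sum>j<m. ?G $$ (i, j) * (y j - x j)) - (y i - x i)
    = (\<Sum>j<m. (?G $$ (i, j) - (if i = j then 1 else 0)) * (y j - x j))"
    by (rule sum_minus_coord[OF i])
  also have "\<dots> = (\<Sum>j<m. \<bar>?G $$ (i, j) - (if i = j then 1 else 0)\<bar>) * t"
    unfolding sum_distrib_right
  proof (rule sum.cong)
    fix j assume "j \<in> {..<m}"
    then have "y j - x j = t * sgn (?G $$ (i, j) - (if i = j then 1 else 0))" by (simp add: y_def)
    then show "(?G $$ (i, j) - (if i = j then 1 else 0)) * (y j - x j)
      = \<bar>?G $$ (i, j) - (if i = j then 1 else 0)\<bar> * t"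
      by (simp only: abs_sgn mult_ac)
  qed simp
  finally show "(\<Sum>j<m. \<bar>?G $$ (i, j) - (if i = j then 1 else 0)\<bar>) \<le> e + e'"
    using t(1) by simp
qed

lemma piece_bounds:
  assumes B: "B \<in> carrier_mat m m" "Determinant.det B \<noteq> 0" and e: "0 < e" "e < 1"
    and A: "A \<in> sets L" "A \<subseteq> piece e n B" "A \<subseteq> dyadic_cube m n k"
  shows "emeasure N1 A \<le> ennreal (((1 + e) / (1 - e)) ^ m) * emeasure N2 A"
    and "emeasure N2 A \<le> ennreal (((1 + e) / (1 - e)) ^ m) * emeasure N1 A"
proof -
  define h where "h x = mat_act m B (\<psi> x)" for x
  define b where "b = \<bar>Determinant.det B\<bar>"
  have b: "b > 0" using B(2) by (simp add: b_def)
  have hm: "h \<in> measurable L L" unfolding h_def by measurable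
  have near: "\<bar>h y i - h x i - (y i - x i)\<bar> \<le> e * sup_dist m y x" if "x \<in> A" "y \<in> A" "i < m" for x y i
  proof -
    have "\<bar>y j - x j\<bar> < 1 / real (Suc n)" if "j < m" for j
    proof -
      have "\<lfloor>2 ^ n * y j\<rfloor> = \<lfloor>2 ^ n * x j\<rfloor>" using A(3) \<open>x \<in> A\<close> \<open>y \<in> A\<close> that
        by (metis mem_dyadic_cube subsetD)
      then have "\<bar>2 ^ n * y j - 2 ^ n * x j\<bar> < 1" by linarith
      moreover have "\<bar>2 ^ n * y j - 2 ^ n * x j\<bar> = 2 ^ n * \<bar>y j - x j\<bar>"
        by (simp add: abs_mult flip: right_diff_distrib)
      ultimately have 1: "\<bar>y j - x j\<bar> < 1 / 2 ^ n" by (simp add: field_simps)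
      have "real (Suc n) \<le> 2 ^ n" using of_nat_less_two_power[of n, where 'a = real]
        by (metis Suc_leI less_exp of_nat_le_iff of_nat_numeral of_nat_power)
      then have "1 / 2 ^ n \<le> 1 / real (Suc n)" by (intro divide_left_mono) auto
      with 1 show ?thesis by linarith
    qed
    then have "sup_dist m y x < 1 / real (Suc n)" by (subst sup_dist_less_iff) auto
    moreover have "y \<in> X" "x \<in> piece e n B" using that A(2) sets_L_subset[OF A(1)] by auto
    ultimately show ?thesis using that(3) unfolding piece_def h_def by blast
  qed
  have up: "sup_dist m (h x) (h y) \<le> (1 + e) * sup_dist m x y" if "x \<in> A" "y \<in> A" for x y
  proof (subst sup_dist_le_iff; (intro allI impI)?)
    fix i assume i: "i < m"
    then show "\<bar>h x i - h y i\<bar> \<le> (1 + e) * sup_dist m x y"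
      using near[OF that(2,1) i] coord_le_sup_dist[OF i, of x y] unfolding distrib_right by linarith
  qed (use e in simp)
  have low: "sup_dist m x y \<le> 1 / (1 - e) * sup_dist m (h x) (h y)" if "x \<in> A" "y \<in> A" for x y
  proof -
    have "sup_dist m x y \<le> e * sup_dist m x y + sup_dist m (h x) (h y)"
    proof (subst sup_dist_le_iff; (intro allI impI)?)
      fix i assume i: "i < m"
      then show "\<bar>x i - y i\<bar> \<le> e * sup_dist m x y + sup_dist m (h x) (h y)"
        using near[OF that(2,1) i] coord_le_sup_dist[OF i, of "h x" "h y"] by linarith
    qed (use e in simp)
    then show ?thesis using e by (simp add: field_simps)
  qed
  have AX: "A \<subseteq> X" by (rule sets_L_subset[OF A(1)])
  have inj: "inj_on h A"
  proof (rule inj_onI)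
    fix x y assume xy: "x \<in> A" "y \<in> A" "h x = h y"
    have "sup_dist m (h x) (h y) = 0"
      using sup_dist_le_iff[of 0 m "h x" "h y"] xy(3) by (simp add: order_antisym)
    then have "sup_dist m x y = 0" using low[OF xy(1,2)] by (simp add: order_antisym)
    then show "x = y" using xy AX by (intro sup_dist_eq_0D[of m]) (auto simp: X_def)
  qed
  have himg: "h ` S = mat_act m B ` \<psi> ` S" for S by (simp add: h_def image_image)
  have hs: "h ` S \<in> sets L" if "S \<in> sets L" for S
    unfolding himg by (rule emeasure_mat_act_image(1)[OF B image_\<psi>[OF that]])
  have hX: "h ` S \<subseteq> coords m" for S
  proof
    fix y assume "y \<in> h ` S"
    then obtain x where "y = mat_act m B (\<psi> x)" unfolding h_def by blast
    then show "y \<in> coords m" by (simp only: mat_act_coords)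
  qed
  have hA: "emeasure L (h ` A) = ennreal b * emeasure N1 A"
    unfolding himg emeasure_mat_act_image(2)[OF B image_\<psi>[OF A(1)]] emeasure_N1[OF A(1)] b_def ..
  have 1: "ennreal b * emeasure N1 A \<le> ennreal ((1 + e) ^ m) * emeasure L A"
    unfolding hA[symmetric] by (rule emeasure_lipschitz_image[OF A(1) inj hX hs _ up]) (use e in auto)
  let ?h' = "inv_into A h"
  have "emeasure L (?h' ` h ` A) \<le> ennreal ((1 / (1 - e)) ^ m) * emeasure L (h ` A)"
  proof (rule emeasure_lipschitz_image[OF hs[OF A(1)]])
    show "inj_on ?h' (h ` A)" by (rule inj_on_inv_into) simp
    show "?h' ` h ` A \<subseteq> coords m" using inj AX by (simp add: X_def)
    show "?h' ` S \<in> sets L" if "S \<in> sets L" "S \<subseteq> h ` A" for S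
    proof -
      have "?h' ` S = h -` S \<inter> space L \<inter> A"
      proof (intro equalityI subsetI)
        fix x assume "x \<in> ?h' ` S"
        then obtain s where "s \<in> S" "x = ?h' s" by blast
        then show "x \<in> h -` S \<inter> space L \<inter> A" using that(2) AX unfolding space_L
          by (metis (no_types, lifting) IntI f_inv_into_f inv_into_into subsetD vimageI)
      next
        fix x assume "x \<in> h -` S \<inter> space L \<inter> A"
        then show "x \<in> ?h' ` S" using inj by (metis IntE image_eqI inv_into_f_f vimageE)
      qed
      then show ?thesis using measurable_sets[OF hm that(1)] A(1) by auto
    qed
    show "sup_dist m (?h' x) (?h' y) \<le> 1 / (1 - e) * sup_dist m x y" if "x \<in> h ` A" "y \<in> h ` A" for x y
      using low[of "?h' x" "?h' y"] that by (simp add: f_inv_into_f inv_into_into)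
  qed (use e in auto)
  then have 2: "emeasure L A \<le> ennreal ((1 / (1 - e)) ^ m) * (ennreal b * emeasure N1 A)"
    using inj hA by simp
  have N2b: "ennreal b * emeasure N2 A = (\<integral>\<^sup>+x. ennreal (b * \<bar>Determinant.det (D x)\<bar>) * indicator A x \<partial>L)"
    unfolding emeasure_N2[OF A(1)] using det_meas A(1) b
    by (subst nn_integral_cmult[symmetric]) (auto simp: ennreal_mult mult.assoc)
  have db: "(1 - e) ^ m \<le> b * \<bar>Determinant.det (D x)\<bar> \<and> b * \<bar>Determinant.det (D x)\<bar> \<le> (1 + e) ^ m" if "x \<in> A" for x
  proof -
    have xp: "x \<in> piece e n B" and xX: "x \<in> X" using that A(2) AX by auto
    have G: "B * D x \<in> carrier_mat m m" using B(1) D_carrierX[OF xX] by simp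
    have "b * \<bar>Determinant.det (D x)\<bar> = \<bar>Determinant.det (B * D x)\<bar>"
      using det_mult[OF B(1) D_carrierX[OF xX]] by (simp add: b_def abs_mult)
    then show ?thesis
      using det_near_identity(2,3)[OF G, of e] row_sum_le[OF xp B(1)] e by simp
  qed
  have 3: "ennreal b * emeasure N2 A \<le> ennreal ((1 + e) ^ m) * emeasure L A"
  proof -
    have "ennreal b * emeasure N2 A \<le> (\<integral>\<^sup>+x. ennreal ((1 + e) ^ m) * indicator A x \<partial>L)"
      unfolding N2b by (rule nn_integral_mono) (use db in \<open>auto simp: indicator_def intro!: ennreal_leI\<close>)
    then show ?thesis using A(1) by (simp add: nn_integral_cmult)
  qed
  have 4: "ennreal ((1 - e) ^ m) * emeasure L A \<le> ennreal b * emeasure N2 A"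
  proof -
    have "(\<integral>\<^sup>+x. ennreal ((1 - e) ^ m) * indicator A x \<partial>L) \<le> ennreal b * emeasure N2 A"
      unfolding N2b by (rule nn_integral_mono) (use db in \<open>auto simp: indicator_def intro!: ennreal_leI\<close>)
    then show ?thesis using A(1) by (simp add: nn_integral_cmult)
  qed
  have c: "ennreal (((1 + e) / (1 - e)) ^ m) = ennreal ((1 + e) ^ m) * ennreal ((1 / (1 - e)) ^ m)"
    using e by (simp add: power_divide flip: ennreal_mult)
  have 5: "emeasure L A \<le> ennreal ((1 / (1 - e)) ^ m) * (ennreal b * emeasure N2 A)"
  proof -
    have "ennreal ((1 / (1 - e)) ^ m) * (ennreal ((1 - e) ^ m) * emeasure L A) = emeasure L A"
      using e by (simp add: mult.assoc[symmetric] power_divide flip: ennreal_mult)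
    then show ?thesis using mult_left_mono[OF 4, of "ennreal ((1 / (1 - e)) ^ m)"] by simp
  qed
  have cancel: "u \<le> v" if "ennreal b * u \<le> ennreal b * v" for u v
    using that b by (subst (asm) ennreal_mult_le_mult_iff) auto
  have "ennreal b * emeasure N1 A \<le> ennreal b * (ennreal (((1 + e) / (1 - e)) ^ m) * emeasure N2 A)"
    using order_trans[OF 1 mult_left_mono[OF 5]] by (simp add: c mult_ac)
  then show "emeasure N1 A \<le> ennreal (((1 + e) / (1 - e)) ^ m) * emeasure N2 A" by (rule cancel)
  have "ennreal b * emeasure N2 A \<le> ennreal b * (ennreal (((1 + e) / (1 - e)) ^ m) * emeasure N1 A)"
    using order_trans[OF 3 mult_left_mono[OF 2]] by (simp add: c mult_ac)
  then show "emeasure N2 A \<le> ennreal (((1 + e) / (1 - e)) ^ m) * emeasure N1 A" by (rule cancel)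
qed

definition rat_mat :: "(nat \<times> nat \<Rightarrow> rat) \<Rightarrow> real mat" where
  "rat_mat q = Matrix.mat m m (\<lambda>ij. of_rat (q ij))"

lemma rat_mat_carrier [simp]: "rat_mat q \<in> carrier_mat m m"
  by (simp add: rat_mat_def)

lemma pieces_cover:
  assumes x: "x \<in> X" and e: "0 < e" "e < 1"
  shows "\<exists>q \<in> Pi\<^sub>E ({..<m} \<times> {..<m}) (\<lambda>_. UNIV). Determinant.det (rat_mat q) \<noteq> 0 \<and> (\<exists>n. x \<in> piece e n (rat_mat q))"
proof -
  note Dx = D_carrierX[OF x]
  obtain B0 where B0: "B0 \<in> carrier_mat m m" "B0 * D x = 1\<^sub>m m"
    using det_non_zero_imp_unit[OF Dx det_DX[OF x]] by (auto simp: Units_def ring_mat_def)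
  define M where "M = 1 + (\<Sum>k<m. \<Sum>j<m. \<bar>D x $$ (k, j)\<bar>)"
  have M: "M \<ge> 1" by (simp add: M_def sum_nonneg)
  have "\<exists>r. \<bar>of_rat r - B0 $$ ij\<bar> < e / 2 / M" for ij
  proof -
    have "B0 $$ ij - e / 2 / M < B0 $$ ij + e / 2 / M" using e M by simp
    from of_rat_dense[OF this] obtain r where "B0 $$ ij - e / 2 / M < of_rat r" "of_rat r < B0 $$ ij + e / 2 / M" by blast
    then have "\<bar>of_rat r - B0 $$ ij\<bar> < e / 2 / M" by linarith
    then show ?thesis ..
  qed
  then obtain r where r: "\<And>ij. \<bar>of_rat (r ij) - B0 $$ ij\<bar> < e / 2 / M" by metis
  define q where "q = restrict r ({..<m} \<times> {..<m})"
  define B where "B = rat_mat q"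
  have B: "B \<in> carrier_mat m m" by (simp add: B_def)
  have Bq: "\<bar>B $$ (i, k) - B0 $$ (i, k)\<bar> \<le> e / 2 / M" if "i < m" "k < m" for i k
    using r[of "(i, k)"] that by (simp add: B_def rat_mat_def q_def)
  have row: "(\<Sum>j<m. \<bar>(B * D x) $$ (i, j) - (if i = j then 1 else 0)\<bar>) \<le> e / 2" if i: "i < m" for i
  proof -
    have "(\<Sum>j<m. \<bar>(B * D x) $$ (i, j) - (if i = j then 1 else 0)\<bar>)
        \<le> (\<Sum>j<m. \<Sum>k<m. e / 2 / M * \<bar>D x $$ (k, j)\<bar>)"
    proof (rule sum_mono)
      fix j assume "j \<in> {..<m}"
      then have j: "j < m" by simp
      have "(if i = j then 1 else 0) = (B0 * D x) $$ (i, j)" using B0 i j by simp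
      then have "(B * D x) $$ (i, j) - (if i = j then 1 else 0) = (\<Sum>k<m. (B $$ (i, k) - B0 $$ (i, k)) * D x $$ (k, j))"
        using B B0(1) Dx i j by (simp add: scalar_prod_def lessThan_atLeast0 left_diff_distrib sum_subtractf)
      also have "\<bar>\<dots>\<bar> \<le> (\<Sum>k<m. e / 2 / M * \<bar>D x $$ (k, j)\<bar>)"
        by (rule order_trans[OF sum_abs], rule sum_mono, unfold abs_mult, rule mult_right_mono) (use Bq i in auto)
      finally show "\<bar>(B * D x) $$ (i, j) - (if i = j then 1 else 0)\<bar> \<le> (\<Sum>k<m. e / 2 / M * \<bar>D x $$ (k, j)\<bar>)" .
    qed
    also have "\<dots> = e / 2 / M * (M - 1)"
      by (subst sum.swap) (simp add: M_def sum_distrib_left)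
    also have "\<dots> \<le> e / 2 / M * M" using e M by (intro mult_left_mono) auto
    finally show ?thesis using M by simp
  qed
  have "Determinant.det (B * D x) \<noteq> 0"
    by (rule det_near_identity(1)[of _ m "e / 2"]) (use B Dx e row in auto)
  then have detB: "Determinant.det B \<noteq> 0" using det_mult[OF B Dx] by auto
  obtain d where d: "d > 0" "\<And>y i. y \<in> X \<Longrightarrow> i < m \<Longrightarrow> sup_dist m y x < d \<Longrightarrow>
    \<bar>(mat_act m B (\<psi> y) i - mat_act m B (\<psi> x) i) - (\<Sum>j<m. (B * D x) $$ (i, j) * (y j - x j))\<bar> \<le> e / 2 * sup_dist m y x"
    using expansion_bound[OF x B, of "e / 2"] e by auto
  obtain n where n: "1 / real (Suc n) < d"
    using d(1) nat_approx_posE by blast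
  have "x \<in> piece e n B" unfolding piece_def
  proof (intro CollectI conjI ballI impI allI x)
    fix y i assume y: "y \<in> X" "sup_dist m y x < 1 / real (Suc n)" and i: "i < m"
    have "\<bar>\<Sum>j<m. ((B * D x) $$ (i, j) - (if i = j then 1 else 0)) * (y j - x j)\<bar>
       \<le> (\<Sum>j<m. \<bar>(B * D x) $$ (i, j) - (if i = j then 1 else 0)\<bar> * sup_dist m y x)"
      by (rule order_trans[OF sum_abs], rule sum_mono, unfold abs_mult, rule mult_left_mono) (auto intro: coord_le_sup_dist)
    also have "\<dots> \<le> e / 2 * sup_dist m y x"
      unfolding sum_distrib_right[symmetric] by (rule mult_right_mono[OF row[OF i]]) simp
    finally have "\<bar>(\<Sum>j<m. (B * D x) $$ (i, j) * (y j - x j)) - (y i - x i)\<bar> \<le> e / 2 * sup_dist m y x"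
      using sum_minus_coord[OF i, of "B * D x" "\<lambda>j. y j - x j"] by simp
    moreover have "sup_dist m y x < d" using y(2) n by linarith
    ultimately show "\<bar>mat_act m B (\<psi> y) i - mat_act m B (\<psi> x) i - (y i - x i)\<bar> \<le> e * sup_dist m y x"
      using d(2)[OF y(1) i] by linarith
  qed
  then show ?thesis using detB unfolding B_def by (intro bexI[of _ q]) (auto simp: q_def)
qed

lemma N1_eq_N2: "N1 = N2"
proof (rule measure_eqI)
  show sets12: "sets N1 = sets N2" by (simp add: N1_def N2_def)
  fix A assume "A \<in> sets N1"
  then have A: "A \<in> sets L" by (simp add: N1_def)
  have bound: "emeasure N1 A \<le> ennreal (((1 + e) / (1 - e)) ^ m) * emeasure N2 A
      \<and> emeasure N2 A \<le> ennreal (((1 + e) / (1 - e)) ^ m) * emeasure N1 A" if e: "0 < e" "e < 1" for e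
  proof -
    define I where "I = {q \<in> Pi\<^sub>E ({..<m} \<times> {..<m}) (\<lambda>_. UNIV). Determinant.det (rat_mat q) \<noteq> 0}
      \<times> (UNIV :: nat set) \<times> Pi\<^sub>E {..<m} (\<lambda>_. UNIV :: int set)"
    define Y where "Y = (\<lambda>(q, n, k). piece e n (rat_mat q) \<inter> dyadic_cube m n k)"
    have I: "countable I" unfolding I_def
      by (intro countable_SIGMA countable_subset[OF _ countable_PiE[of "{..<m} \<times> {..<m}" "\<lambda>_. UNIV :: rat set"]])
        (auto intro!: countable_PiE)
    have Ys: "Y i \<in> sets L" for i by (auto simp: Y_def split: prod.split)
    have cover: "X \<subseteq> (\<Union>i\<in>I. Y i)"
    proof
      fix x assume x: "x \<in> X"
      then obtain q n where q: "q \<in> Pi\<^sub>E ({..<m} \<times> {..<m}) (\<lambda>_. UNIV)" "Determinant.det (rat_mat q) \<noteq> 0" "x \<in> piece e n (rat_mat q)"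
        using pieces_cover[OF x e] by blast
      define k where "k = (\<lambda>i\<in>{..<m}. \<lfloor>2 ^ n * x i\<rfloor>)"
      have "x \<in> dyadic_cube m n k" using x by (simp add: mem_dyadic_cube k_def X_def)
      moreover have "(q, n, k) \<in> I" using q by (simp add: I_def k_def)
      ultimately show "x \<in> (\<Union>i\<in>I. Y i)" using q(3) by (intro UN_I[of "(q, n, k)"]) (auto simp: Y_def)
    qed
    have le: "emeasure N1 S \<le> ennreal (((1 + e) / (1 - e)) ^ m) * emeasure N2 S
      \<and> emeasure N2 S \<le> ennreal (((1 + e) / (1 - e)) ^ m) * emeasure N1 S"
      if i: "i \<in> I" and S: "S \<in> sets L" "S \<subseteq> Y i" for i S
    proof -
      obtain q n k where qnk: "i = (q, n, k)" by (cases i)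
      show ?thesis
        using piece_bounds[of "rat_mat q" e S n k] i S e by (auto simp: qnk I_def Y_def)
    qed
    have "emeasure N1 A \<le> ennreal (((1 + e) / (1 - e)) ^ m) * emeasure N2 A"
      by (rule emeasure_le_of_countable_cover[OF sets12 I, of Y])
        (use Ys cover le A in \<open>auto simp: N1_def N2_def space_L\<close>)
    moreover have "emeasure N2 A \<le> ennreal (((1 + e) / (1 - e)) ^ m) * emeasure N1 A"
      by (rule emeasure_le_of_countable_cover[OF sets12[symmetric] I, of Y])
        (use Ys cover le A in \<open>auto simp: N1_def N2_def space_L\<close>)
    ultimately show ?thesis ..
  qed
  define c where "c n = ((1 + 1 / real (Suc (Suc n))) / (1 - 1 / real (Suc (Suc n)))) ^ m" for n
  have clim: "(\<lambda>n. ennreal (c n)) \<longlonglongrightarrow> ennreal 1"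
  proof (rule tendsto_ennrealI)
    have "(\<lambda>n. 1 / real (Suc (Suc n))) \<longlonglongrightarrow> 0"
      using LIMSEQ_ignore_initial_segment[OF lim_1_over_n, of 2] by simp
    then have "c \<longlonglongrightarrow> ((1 + 0) / (1 - 0)) ^ m"
      unfolding c_def by (intro tendsto_intros) auto
    then show "c \<longlonglongrightarrow> 1" by simp
  qed
  have limit: "u \<le> v" if uv: "\<And>n. u \<le> ennreal (c n) * v" for u v :: ennreal
  proof (cases "v = \<infinity>")
    case False
    have "(\<lambda>n. v * ennreal (c n)) \<longlonglongrightarrow> v * ennreal 1"
      using False by (intro ennreal_tendsto_cmult clim) (simp add: less_top)
    then show ?thesis using uv by (intro LIMSEQ_le_const[of _ v u]) (auto simp: mult.commute)
  qed simp
  have "emeasure N1 A \<le> emeasure N2 A"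
    by (rule limit) (use bound[of "1 / real (Suc (Suc _))"] in \<open>simp add: c_def\<close>)
  moreover have "emeasure N2 A \<le> emeasure N1 A"
    by (rule limit) (use bound[of "1 / real (Suc (Suc _))"] in \<open>simp add: c_def\<close>)
  ultimately show "emeasure N1 A = emeasure N2 A" by (rule order_antisym)
qed

lemma change_of_variables:
  assumes [measurable]: "\<phi> \<in> borel_measurable L"
  shows "(\<integral>\<^sup>+x. ennreal \<bar>Determinant.det (D x)\<bar> * \<phi> (\<psi> x) \<partial>L) = (\<integral>\<^sup>+x. \<phi> x \<partial>L)"
proof -
  note det_meas [measurable]
  have "(\<integral>\<^sup>+x. ennreal \<bar>Determinant.det (D x)\<bar> * \<phi> (\<psi> x) \<partial>L) = (\<integral>\<^sup>+x. \<phi> (\<psi> x) \<partial>N2)"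
    unfolding N2_def by (subst nn_integral_density) auto
  also have "\<dots> = (\<integral>\<^sup>+x. \<phi> (\<psi> x) \<partial>N1)" by (simp add: N1_eq_N2)
  also have "\<dots> = (\<integral>\<^sup>+x. \<phi> (\<psi> (\<theta> x)) \<partial>L)" unfolding N1_def by (subst nn_integral_distr) auto
  also have "\<dots> = (\<integral>\<^sup>+x. \<phi> x \<partial>L)" by (rule nn_integral_cong) (simp add: space_L \<psi>_\<theta>)
  finally show ?thesis .
qed

end

section \<open>Square roots of nonnegative self-adjoint operators\<close>

lemma quadratic_nonneg_discriminant:
  fixes a b c :: real
  assumes "\<And>t. 0 \<le> a + 2 * t * b + t\<^sup>2 * c" and "0 \<le> c"
  shows "b\<^sup>2 \<le> a * c"
proof (cases "c = 0")
  case True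
  have "b = 0"
  proof (rule ccontr)
    assume "b \<noteq> 0"
    then show False using assms(1)[of "- (a + 1) / (2 * b)"] True by (simp add: field_simps)
  qed
  then show ?thesis using True by simp
next
  case False
  then have c: "0 < c" using assms(2) by simp
  have "0 \<le> a - b\<^sup>2 / c" using assms(1)[of "- b / c"] c by (simp add: power2_eq_square)
  then show ?thesis using c by (simp add: field_simps)
qed

lemma closed_subspace_projection:
  fixes W :: "'a::{real_inner, complete_space} set"
  assumes W: "subspace W" "closed W"
  shows "\<exists>p\<in>W. \<forall>w\<in>W. inner (x - p) w = 0"
proof -
  define d where "d = (INF w\<in>W. (norm (x - w))\<^sup>2)"
  have W0: "W \<noteq> {}" using W(1) subspace_0 by auto
  have bdd: "bdd_below ((\<lambda>w. (norm (x - w))\<^sup>2) ` W)" by (auto intro: bdd_belowI2[of _ 0])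
  have dle: "d \<le> (norm (x - w))\<^sup>2" if "w \<in> W" for w unfolding d_def by (rule cINF_lower[OF bdd that])
  have "\<exists>w\<in>W. (norm (x - w))\<^sup>2 < d + 1 / real (Suc n)" for n
  proof (rule ccontr)
    assume "\<not> ?thesis"
    then have "d + 1 / real (Suc n) \<le> d" unfolding d_def by (intro cINF_greatest W0) (auto simp: not_less)
    then show False by simp
  qed
  then obtain w where w: "\<And>n. w n \<in> W" "\<And>n. (norm (x - w n))\<^sup>2 < d + 1 / real (Suc n)" by metis
  have close: "(norm (w i - w j))\<^sup>2 \<le> 2 / real (Suc i) + 2 / real (Suc j)" for i j
  proof -
    have mid: "(1/2) *\<^sub>R (w i + w j) \<in> W" using W(1) w(1) by (intro subspace_scale subspace_add)
    have "(norm (w i - w j))\<^sup>2 + 4 * (norm (x - (1/2) *\<^sub>R (w i + w j)))\<^sup>2 = 2 * (norm (x - w i))\<^sup>2 + 2 * (norm (x - w j))\<^sup>2"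
      unfolding power2_norm_eq_inner by (simp add: inner_diff_left inner_diff_right inner_add_left inner_add_right inner_commute algebra_simps)
    then show ?thesis using dle[OF mid] w(2)[of i] w(2)[of j] by simp
  qed
  have "Cauchy w"
  proof (rule CauchyI)
    fix e :: real assume e: "0 < e"
    obtain M where M: "1 / real (Suc M) < e\<^sup>2 / 4" using nat_approx_posE[of "e\<^sup>2 / 4"] e by auto
    have "norm (w i - w j) < e" if "M \<le> i" "M \<le> j" for i j
    proof -
      have "1 / real (Suc i) \<le> 1 / real (Suc M)" "1 / real (Suc j) \<le> 1 / real (Suc M)"
        using that by (auto intro!: divide_left_mono)
      then have "(norm (w i - w j))\<^sup>2 < e\<^sup>2" using close[of i j] M by simp
      then show ?thesis using e by (simp add: power_less_imp_less_base)
    qed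
    then show "\<exists>M. \<forall>m\<ge>M. \<forall>n\<ge>M. norm (w m - w n) < e" by blast
  qed
  then obtain p where p: "w \<longlonglongrightarrow> p" using Cauchy_convergent convergent_def by blast
  have pW: "p \<in> W" using closed_sequentially[OF W(2) _ p] w(1) by blast
  have "(\<lambda>n. (norm (x - w n))\<^sup>2) \<longlonglongrightarrow> (norm (x - p))\<^sup>2" by (intro tendsto_intros p)
  moreover have "(\<lambda>n. d + 1 / real (Suc n)) \<longlonglongrightarrow> d + 0"
    by (intro tendsto_intros LIMSEQ_Suc[OF lim_1_over_n])
  ultimately have pd: "(norm (x - p))\<^sup>2 \<le> d + 0"
    by (rule LIMSEQ_le) (use w(2) less_imp_le in blast)
  have "inner (x - p) v = 0" if v: "v \<in> W" for v
  proof -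
    have "0 \<le> 0 + 2 * t * inner (x - p) v + t\<^sup>2 * (norm v)\<^sup>2" for t
    proof -
      have "d \<le> (norm (x - (p + (- t) *\<^sub>R v)))\<^sup>2"
        by (rule dle) (intro subspace_add subspace_scale W pW v)
      also have "\<dots> = (norm (x - p))\<^sup>2 + 2 * t * inner (x - p) v + t\<^sup>2 * (norm v)\<^sup>2"
        unfolding power2_norm_eq_inner by (simp add: inner_diff_left inner_diff_right inner_add_left inner_add_right inner_commute algebra_simps power2_eq_square)
      finally show ?thesis using pd by simp
    qed
    from quadratic_nonneg_discriminant[OF this] show ?thesis by simp
  qed
  then show ?thesis using pW by blast
qed

lemma nonneg_selfadjoint_Cauchy_Schwarz:
  assumes "nonneg_selfadjoint A"
  shows "(inner (A x) y)\<^sup>2 \<le> inner (A x) x * inner (A y) y"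
proof (rule quadratic_nonneg_discriminant)
  fix t
  have lin: "linear A" using assms by (simp add: nonneg_selfadjoint_def bounded_linear.linear)
  have "inner (A (x + t *\<^sub>R y)) (x + t *\<^sub>R y) = inner (A x) x + 2 * t * inner (A x) y + t\<^sup>2 * inner (A y) y"
  proof -
    have "inner (A y) x = inner (A x) y" using assms by (simp add: nonneg_selfadjoint_def inner_commute)
    then show ?thesis
      by (simp add: linear_add[OF lin] linear_scale[OF lin] inner_add_left inner_add_right power2_eq_square algebra_simps)
  qed
  then show "0 \<le> inner (A x) x + 2 * t * inner (A x) y + t\<^sup>2 * inner (A y) y"
    using assms by (metis nonneg_selfadjoint_def)
next
  show "0 \<le> inner (A y) y" using assms unfolding nonneg_selfadjoint_def by blast
qed

text \<open>
  With \<open>A = I - C / M\<close>, a contraction, \<open>S = sqrt M (I - R)\<close> where \<open>R = (A + R\<^sup>2) / 2\<close> is the limit of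
  the iteration \<open>R\<^sub>n\<^sub>+\<^sub>1 = (A + R\<^sub>n\<^sup>2) / 2\<close>. The \<open>R\<^sub>n\<close> are polynomials in \<open>A\<close> with nonnegative
  coefficients, so the same iteration for the number \<open>1\<close> in place of \<open>A\<close> majorises all increments.
\<close>

lemma ex_op_sqrt:
  fixes C :: "'a::{real_inner, complete_space} \<Rightarrow> 'a"
  assumes C: "nonneg_selfadjoint C"
  shows "\<exists>S. nonneg_selfadjoint S \<and> S \<circ> S = C"
proof -
  interpret C: bounded_linear C using C by (simp add: nonneg_selfadjoint_def)
  have Csa: "inner (C u) v = inner u (C v)" and Cpos: "0 \<le> inner (C u) u" for u v
    using C by (auto simp: nonneg_selfadjoint_def)
  obtain M where M: "M > 0" "\<And>x. norm (C x) \<le> norm x * M" using C.pos_bounded by blast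
  define A where "A x = x - (1 / M) *\<^sub>R C x" for x
  have linA: "linear A"
    by (rule linearI) (simp_all add: A_def C.add C.scaleR algebra_simps)
  have Asa: "inner (A u) v = inner u (A v)" for u v
    by (simp add: A_def inner_diff_left inner_diff_right Csa)
  have CM: "inner (C x) x \<le> M * inner x x" for x
  proof -
    have "inner (C x) x \<le> norm (C x) * norm x" by (rule norm_cauchy_schwarz)
    also have "\<dots> \<le> norm x * M * norm x" by (intro mult_right_mono M) simp
    finally show ?thesis by (simp add: power2_norm_eq_inner[symmetric] power2_eq_square mult_ac)
  qed
  have Apos: "0 \<le> inner (A x) x" and Ale: "inner (A x) x \<le> inner x x" for x
    using CM[of x] Cpos[of x] M(1) by (simp_all add: A_def inner_diff_left field_simps)
  have bA: "bounded_linear A"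
    unfolding A_def by (intro bounded_linear_sub bounded_linear_ident bounded_linear_const_scaleR C.bounded_linear_axioms)
  have nsA: "nonneg_selfadjoint A" using bA Asa Apos by (simp add: nonneg_selfadjoint_def)
  have nA: "norm (A x) \<le> norm x" for x
  proof (cases "A x = 0")
    case False
    have "(inner (A x) (A x))\<^sup>2 \<le> inner (A x) x * inner (A (A x)) (A x)"
      by (rule nonneg_selfadjoint_Cauchy_Schwarz[OF nsA])
    also have "\<dots> \<le> inner x x * inner (A x) (A x)"
      by (intro mult_mono Ale Apos) simp
    finally have "inner (A x) (A x) \<le> inner x x"
      using False by (simp add: power2_eq_square)
    then show ?thesis by (simp add: norm_le)
  qed simp
  define R where "R n = rec_nat (\<lambda>x. 0) (\<lambda>_ T x. (1/2) *\<^sub>R (A x + T (T x))) n" for n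
  have R0: "R 0 x = 0" and RS: "R (Suc n) x = (1/2) *\<^sub>R (A x + R n (R n x))" for n x
    by (simp_all add: R_def)
  define c where "c n = rec_nat (0::real) (\<lambda>_ t. (1 + t\<^sup>2) / 2) n" for n
  have c0: "c 0 = 0" and cS: "c (Suc n) = (1 + (c n)\<^sup>2) / 2" for n by (simp_all add: c_def)
  have c01: "0 \<le> c n \<and> c n \<le> 1" for n
  proof (induction n)
    case (Suc n)
    then have "(c n)\<^sup>2 \<le> 1" by (simp add: power_le_one)
    then show ?case by (simp add: cS)
  qed (simp add: c0)
  have cinc: "c n \<le> c (Suc n)" for n
  proof -
    have "0 \<le> (1 - c n)\<^sup>2" by simp
    then show ?thesis unfolding cS by (simp add: power2_eq_square algebra_simps)
  qed
  have linR: "linear (R n)" for n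
  proof (induction n)
    case (Suc n)
    show ?case
      by (rule linearI) (simp_all add: RS linear_add[OF linA] linear_add[OF Suc] linear_scale[OF linA] linear_scale[OF Suc] algebra_simps)
  qed (rule linearI; simp add: R0)
  have nR: "norm (R n x) \<le> c n * norm x" for n x
  proof (induction n arbitrary: x)
    case (Suc n)
    have "norm (R n (R n x)) \<le> c n * (c n * norm x)"
      using Suc[of "R n x"] mult_left_mono[OF Suc[of x], of "c n"] c01[of n] by simp
    then have "norm (A x + R n (R n x)) \<le> norm x + c n * (c n * norm x)"
      using nA[of x] norm_triangle_ineq[of "A x" "R n (R n x)"] by linarith
    moreover have "norm (R (Suc n) x) = norm (A x + R n (R n x)) / 2"
      by (simp only: RS norm_scaleR)
    ultimately show ?case by (simp add: cS power2_eq_square algebra_simps)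
  qed (simp add: R0 c0)
  have Rsa: "inner (R n x) y = inner x (R n y)" for n x y
    by (induction n arbitrary: x y) (simp_all add: R0 RS inner_add_left inner_add_right Asa)
  have comm: "B (R n x) = R n (B x)" if B: "linear B" "\<And>x. B (A x) = A (B x)" for B n x
    by (induction n arbitrary: x) (simp_all add: R0 RS linear_add[OF B(1)] linear_scale[OF B(1)] linear_0[OF B(1)] B(2))
  have RR: "R n (R k x) = R k (R n x)" for n k x
    by (rule comm[OF linR]) (rule comm[OF linA, symmetric], simp)
  have incr: "norm (R (Suc n) x - R n x) \<le> (c (Suc n) - c n) * norm x" for n x
  proof (induction n arbitrary: x)
    case 0
    then show ?case using nA[of x] by (simp add: RS R0 c0 cS)
  next
    case (Suc n)
    let ?d = "R (Suc n) x - R n x"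
    have "R (Suc (Suc n)) x - R (Suc n) x = (1/2) *\<^sub>R (R (Suc n) (R (Suc n) x) - R n (R n x))"
      by (simp only: RS[of "Suc n" x] RS[of n x]) (simp add: algebra_simps)
    also have "R (Suc n) (R (Suc n) x) - R n (R n x) = R (Suc n) ?d + R n ?d"
      using RR[of "Suc n" n x] by (simp add: linear_diff[OF linR])
    finally have "norm (R (Suc (Suc n)) x - R (Suc n) x) \<le> (norm (R (Suc n) ?d) + norm (R n ?d)) / 2"
      using norm_triangle_ineq[of "R (Suc n) ?d" "R n ?d"] by simp
    also have "\<dots> \<le> (c (Suc n) * norm ?d + c n * norm ?d) / 2"
      using nR[of "Suc n" ?d] nR[of n ?d] by simp
    also have "\<dots> = (c (Suc n) + c n) / 2 * norm ?d" by (simp add: algebra_simps)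
    also have "\<dots> \<le> (c (Suc n) + c n) / 2 * ((c (Suc n) - c n) * norm x)"
      by (intro mult_left_mono Suc) (use c01[of n] c01[of "Suc n"] in auto)
    also have "\<dots> = (c (Suc (Suc n)) - c (Suc n)) * norm x"
      unfolding cS[of "Suc n"] cS[of n] by (simp add: power2_eq_square field_simps)
    finally show ?case .
  qed
  have incr': "norm (R (n + k) x - R n x) \<le> (c (n + k) - c n) * norm x" for n k x
  proof (induction k)
    case (Suc k)
    have "norm (R (n + Suc k) x - R n x) \<le> norm (R (Suc (n + k)) x - R (n + k) x) + norm (R (n + k) x - R n x)"
      using norm_triangle_ineq[of "R (Suc (n + k)) x - R (n + k) x" "R (n + k) x - R n x"] by simp
    also have "\<dots> \<le> (c (Suc (n + k)) - c (n + k)) * norm x + (c (n + k) - c n) * norm x"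
      by (intro add_mono incr Suc)
    finally show ?case by (simp add: algebra_simps)
  qed simp
  have "convergent c"
    by (rule Bseq_monoseq_convergent) (use c01 cinc in \<open>auto intro!: BseqI'[of _ 1] monoI1 incseq_SucI simp: monoseq_Suc\<close>)
  then have Cc: "Cauchy c" by (rule convergent_Cauchy)
  have "Cauchy (\<lambda>n. R n x)" for x
  proof (rule CauchyI')
    fix e :: real assume e: "0 < e"
    then obtain N where N: "\<And>i j. i \<ge> N \<Longrightarrow> j \<ge> N \<Longrightarrow> norm (c i - c j) < e / (norm x + 1)"
      using CauchyD[OF Cc, of "e / (norm x + 1)"] by (auto simp: add_nonneg_pos)
    have "dist (R i x) (R j x) < e" if "N \<le> i" "i < j" for i j
    proof -
      have "dist (R i x) (R j x) \<le> (c j - c i) * norm x"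
        using incr'[of i "j - i" x] that by (simp add: dist_norm norm_minus_commute)
      also have "\<dots> \<le> e / (norm x + 1) * norm x"
        using N[of j i] that by (intro mult_right_mono) auto
      also have "\<dots> < e"
      proof -
        have "e * norm x < e * (norm x + 1)" using e by simp
        then show ?thesis by (simp add: pos_divide_less_eq add_nonneg_pos)
      qed
      finally show ?thesis .
    qed
    then show "\<exists>M. \<forall>m\<ge>M. \<forall>n>m. dist (R m x) (R n x) < e" by blast
  qed
  then have "\<exists>y. (\<lambda>n. R n x) \<longlonglongrightarrow> y" for x using Cauchy_convergent convergent_def by blast
  then obtain T where T: "\<And>x. (\<lambda>n. R n x) \<longlonglongrightarrow> T x" by metis
  have linT: "linear T"
  proof (rule linearI)
    fix x y and r :: real
    have "(\<lambda>n. R n (x + y)) \<longlonglongrightarrow> T x + T y"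
      using tendsto_add[OF T[of x] T[of y]] by (simp add: linear_add[OF linR])
    then show "T (x + y) = T x + T y" using T LIMSEQ_unique by blast
    have "(\<lambda>n. R n (r *\<^sub>R x)) \<longlonglongrightarrow> r *\<^sub>R T x"
      using tendsto_scaleR[OF tendsto_const T[of x]] by (simp add: linear_scale[OF linR])
    then show "T (r *\<^sub>R x) = r *\<^sub>R T x" using T LIMSEQ_unique by blast
  qed
  have nR1: "norm (R n x) \<le> norm x" for n x
    using order_trans[OF nR mult_right_mono[of "c n" 1 "norm x"]] c01[of n] by simp
  have nT: "norm (T x) \<le> norm x" for x
    by (rule LIMSEQ_le_const2[OF tendsto_norm[OF T[of x]]]) (use nR1 in auto)
  have Tsa: "inner (T x) y = inner x (T y)" for x y
    using LIMSEQ_unique[OF tendsto_inner[OF T[of x] tendsto_const[of y]]] tendsto_inner[OF tendsto_const[of x] T[of y]]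
    by (simp add: Rsa)
  have TT: "T x = (1/2) *\<^sub>R (A x + T (T x))" for x
  proof -
    have "(\<lambda>n. R n (R n x) - R n (T x)) \<longlonglongrightarrow> 0"
    proof (rule Lim_null_comparison)
      show "\<forall>\<^sub>F n in sequentially. norm (R n (R n x) - R n (T x)) \<le> norm (R n x - T x)"
        using nR1 by (simp flip: linear_diff[OF linR])
      show "(\<lambda>n. norm (R n x - T x)) \<longlonglongrightarrow> 0" using T[of x] by (simp add: LIM_zero tendsto_norm_zero)
    qed
    then have "(\<lambda>n. (R n (R n x) - R n (T x)) + R n (T x)) \<longlonglongrightarrow> 0 + T (T x)" by (intro tendsto_add T)
    then have "(\<lambda>n. R (Suc n) x) \<longlonglongrightarrow> (1/2) *\<^sub>R (A x + T (T x))"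
      unfolding RS by (intro tendsto_intros) simp
    then show ?thesis using LIMSEQ_Suc[OF T[of x]] LIMSEQ_unique by blast
  qed
  define S where "S x = sqrt M *\<^sub>R (x - T x)" for x
  have "bounded_linear S"
  proof (rule bounded_linear_intro)
    show "S (x + y) = S x + S y" for x y by (simp add: S_def linear_add[OF linT] algebra_simps)
    show "S (r *\<^sub>R x) = r *\<^sub>R S x" for r x by (simp add: S_def linear_scale[OF linT] algebra_simps)
    show "norm (S x) \<le> norm x * (2 * sqrt M)" for x
    proof -
      have "norm (x - T x) \<le> 2 * norm x" using norm_triangle_ineq4[of x "T x"] nT[of x] by linarith
      then have "sqrt M * norm (x - T x) \<le> sqrt M * (2 * norm x)" using M(1) by (intro mult_left_mono) auto
      then show ?thesis using M(1) by (simp add: S_def mult_ac)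
    qed
  qed
  moreover have "inner (S u) v = inner u (S v)" for u v
    by (simp add: S_def inner_diff_left inner_diff_right Tsa)
  moreover have "0 \<le> inner (S u) u" for u
  proof -
    have "inner (T u) u \<le> norm (T u) * norm u" by (rule norm_cauchy_schwarz)
    also have "\<dots> \<le> norm u * norm u" by (intro mult_right_mono nT) simp
    finally show ?thesis using M(1) by (simp add: S_def inner_diff_left power2_norm_eq_inner[symmetric] power2_eq_square)
  qed
  moreover have "S (S x) = C x" for x
  proof -
    have "T (T x) = 2 *\<^sub>R T x - A x" using TT[of x] by (simp add: algebra_simps flip: scaleR_2) (metis scaleR_half_double scaleR_2 diff_eq_eq add.commute scaleR_right_distrib)
    moreover have "S (S x) = M *\<^sub>R (x - 2 *\<^sub>R T x + T (T x))"
      using M(1) by (simp add: S_def linear_scale[OF linT] linear_diff[OF linT] algebra_simps scaleR_2)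
    ultimately show ?thesis using M(1) by (simp add: A_def)
  qed
  ultimately show ?thesis unfolding nonneg_selfadjoint_def by (intro exI[of _ S]) auto
qed

section \<open>The Cameron--Martin inner product\<close>

lemma subspace_closure_set:
  fixes W :: "'a::real_normed_vector set"
  assumes W: "subspace W"
  shows "subspace (closure W)"
proof (rule subspaceI)
  show "0 \<in> closure W" using subspace_0[OF W] closure_subset by blast
next
  fix x y assume "x \<in> closure W" "y \<in> closure W"
  then obtain u v where "\<forall>n. u n \<in> W" "u \<longlonglongrightarrow> x" "\<forall>n. v n \<in> W" "v \<longlonglongrightarrow> y"
    unfolding closure_sequential by blast
  then show "x + y \<in> closure W" unfolding closure_sequential
    by (intro exI[of _ "\<lambda>n. u n + v n"]) (auto intro: tendsto_add subspace_add[OF W])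
next
  fix c :: real and x assume "x \<in> closure W"
  then obtain u where "\<forall>n. u n \<in> W" "u \<longlonglongrightarrow> x" unfolding closure_sequential by blast
  then show "c *\<^sub>R x \<in> closure W" unfolding closure_sequential
    by (intro exI[of _ "\<lambda>n. c *\<^sub>R u n"]) (auto intro: tendsto_scaleR subspace_scale[OF W])
qed

locale cameron_martin_space =
  fixes C :: "'a::{real_inner, complete_space} \<Rightarrow> 'a"
  assumes nonneg_C: "nonneg_selfadjoint C"
begin

abbreviation "S \<equiv> op_sqrt C"
abbreviation "J \<equiv> op_inv_sqrt C"
abbreviation "H \<equiv> cameron_martin C"

lemma op_sqrt: "nonneg_selfadjoint S" "S (S x) = C x"
proof -
  have "nonneg_selfadjoint S \<and> S \<circ> S = C"
    unfolding op_sqrt_def by (rule someI_ex[OF ex_op_sqrt[OF nonneg_C]])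
  then show "nonneg_selfadjoint S" "S (S x) = C x" by (auto simp: fun_eq_iff)
qed

lemma bounded_linear_S: "bounded_linear S"
  using op_sqrt(1) by (simp add: nonneg_selfadjoint_def)

lemma linear_S: "linear S"
  by (rule bounded_linear.linear[OF bounded_linear_S])

lemma S_selfadjoint: "inner (S x) y = inner x (S y)"
  using op_sqrt(1) by (simp add: nonneg_selfadjoint_def)

lemma inner_C: "inner x (C y) = inner (S x) (S y)"
  by (simp add: S_selfadjoint op_sqrt(2))

definition ker_S :: "'a set" where "ker_S = {x. S x = 0}"

lemma subspace_ker_S: "subspace ker_S" "closed ker_S"
proof -
  show "subspace ker_S" by (simp add: ker_S_def linear_subspace_kernel linear_S)
  show "closed ker_S" unfolding ker_S_def
    by (rule closed_Collect_eq) (auto intro: continuous_on_const linear_continuous_on bounded_linear_S)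
qed

definition orth :: "'a \<Rightarrow> bool" where "orth x \<longleftrightarrow> (\<forall>y. S y = 0 \<longrightarrow> inner x y = 0)"

lemma orth_add: "orth x \<Longrightarrow> orth y \<Longrightarrow> orth (x + y)"
  by (simp add: orth_def inner_add_left)

lemma orth_scale: "orth x \<Longrightarrow> orth (r *\<^sub>R x)"
  by (simp add: orth_def)

lemma orth_inj: "orth x \<Longrightarrow> orth y \<Longrightarrow> S x = S y \<Longrightarrow> x = y"
proof -
  assume "orth x" "orth y" "S x = S y"
  then have "S (x - y) = 0" "orth (x - y)"
    using orth_add[of x "(-1) *\<^sub>R y"] orth_scale[of y "-1"] by (auto simp: linear_diff[OF linear_S])
  then have "inner (x - y) (x - y) = 0" by (simp add: orth_def)
  then show "x = y" by simp
qed

lemma J_eqI: "S x = u \<Longrightarrow> orth x \<Longrightarrow> J u = x"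
  unfolding op_inv_sqrt_def orth_def[symmetric] by (rule the_equality) (auto intro: orth_inj)

lemma J: assumes "u \<in> H" shows "S (J u) = u" "orth (J u)"
proof -
  obtain x where x: "u = S x" using assms by (auto simp: cameron_martin_def)
  obtain p where p: "p \<in> ker_S" "\<forall>w\<in>ker_S. inner (x - p) w = 0"
    using closed_subspace_projection[OF subspace_ker_S] by blast
  have 1: "S (x - p) = u" "orth (x - p)"
    using p x by (auto simp: orth_def ker_S_def linear_diff[OF linear_S])
  then show "S (J u) = u" "orth (J u)" using J_eqI[OF 1] by auto
qed

lemma S_in_H: "S x \<in> H"
  by (simp add: cameron_martin_def)

lemma J_S: "orth x \<Longrightarrow> J (S x) = x"
  by (rule J_eqI) auto

lemma subspace_H: "subspace H"
  unfolding cameron_martin_def by (rule linear_subspace_image[OF linear_S subspace_UNIV])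

lemma J_add: "u \<in> H \<Longrightarrow> v \<in> H \<Longrightarrow> J (u + v) = J u + J v"
  by (rule J_eqI) (auto simp: J linear_add[OF linear_S] intro: orth_add J)

lemma J_scale: "u \<in> H \<Longrightarrow> J (r *\<^sub>R u) = r *\<^sub>R J u"
  by (rule J_eqI) (auto simp: J linear_scale[OF linear_S] intro: orth_scale J)

lemma J_sum: "(\<And>i. i \<in> I \<Longrightarrow> u i \<in> H) \<Longrightarrow> J (\<Sum>i\<in>I. u i) = (\<Sum>i\<in>I. J (u i))"
proof (induction I rule: infinite_finite_induct)
  case (insert i I)
  then show ?case by (simp add: J_add subspace_sum[OF subspace_H])
qed (use J_scale[OF subspace_0[OF subspace_H], of 0] in auto)

lemma cm_inner_commute: "cm_inner C u v = cm_inner C v u"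
  by (simp add: cm_inner_def inner_commute)

lemma cm_inner_add: "u \<in> H \<Longrightarrow> v \<in> H \<Longrightarrow> cm_inner C (u + v) w = cm_inner C u w + cm_inner C v w"
  by (simp add: cm_inner_def J_add inner_add_left)

lemma cm_inner_scale: "u \<in> H \<Longrightarrow> cm_inner C (r *\<^sub>R u) w = r * cm_inner C u w"
  by (simp add: cm_inner_def J_scale)

lemma cm_inner_sum: "(\<And>i. i \<in> I \<Longrightarrow> u i \<in> H) \<Longrightarrow> cm_inner C (\<Sum>i\<in>I. u i) w = (\<Sum>i\<in>I. cm_inner C (u i) w)"
  by (simp add: cm_inner_def J_sum inner_sum_left)

lemma inner_S_J: "u \<in> H \<Longrightarrow> inner (S k) (J u) = inner k u"
  by (simp add: S_selfadjoint J)

lemma orth_approx: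
  assumes x: "orth x" and e: "0 < e"
  shows "\<exists>k. norm (S k - x) < e"
proof -
  have sub: "subspace (closure (range S))"
    by (rule subspace_closure_set, rule linear_subspace_image[OF linear_S subspace_UNIV])
  obtain p where p: "p \<in> closure (range S)" "\<forall>w\<in>closure (range S). inner (x - p) w = 0"
    using closed_subspace_projection[OF sub closed_closure] by blast
  have "inner (S (x - p)) (S (x - p)) = 0"
  proof -
    have "S (S (x - p)) \<in> closure (range S)" by (rule subsetD[OF closure_subset]) simp
    then show ?thesis using p(2) by (simp add: S_selfadjoint)
  qed
  then have Sxp: "S (x - p) = 0" by simp
  have "closed {v. inner v (x - p) = 0}" by (intro closed_Collect_eq continuous_intros)
  moreover have "range S \<subseteq> {v. inner v (x - p) = 0}" using Sxp by (auto simp: S_selfadjoint)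
  ultimately have "closure (range S) \<subseteq> {v. inner v (x - p) = 0}" by (rule closure_minimal[rotated])
  then have "inner p (x - p) = 0" using p(1) by blast
  moreover have "inner x (x - p) = 0" using x Sxp by (simp add: orth_def)
  ultimately have "inner (x - p) (x - p) = 0" by (simp add: inner_diff_left)
  then have "x \<in> closure (range S)" using p(1) by simp
  then show ?thesis using e unfolding closure_approachable dist_norm by blast
qed

lemma cm_orthonormal_J:
  "cm_orthonormal C E \<longleftrightarrow> finite E \<and> E \<subseteq> H \<and> (\<forall>e\<in>E. \<forall>e'\<in>E. inner (J e) (J e') = (if e = e' then 1 else 0))"
  by (simp add: cm_orthonormal_def cm_inner_def)

lemma span_subset_H: "E \<subseteq> H \<Longrightarrow> span E \<subseteq> H"
  by (rule span_minimal[OF _ subspace_H])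

lemma cm_expansion:
  assumes E: "cm_orthonormal C E" and v: "v \<in> span E"
  shows "v = (\<Sum>e\<in>E. cm_inner C v e *\<^sub>R e)"
proof -
  have fin: "finite E" and EH: "E \<subseteq> H" using E by (auto simp: cm_orthonormal_def)
  obtain a where a: "v = (\<Sum>e\<in>E. a e *\<^sub>R e)" using v span_finite[OF fin] by auto
  have "cm_inner C v e = a e" if e: "e \<in> E" for e
  proof -
    have "cm_inner C v e = (\<Sum>e'\<in>E. a e' * cm_inner C e' e)"
      unfolding a using EH by (subst cm_inner_sum) (auto intro!: subspace_scale[OF subspace_H] sum.cong cm_inner_scale)
    also have "\<dots> = (\<Sum>e'\<in>E. if e' = e then a e' else 0)"
      using E e by (intro sum.cong) (auto simp: cm_orthonormal_def)
    finally show ?thesis using fin e by simp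
  qed
  then show ?thesis using a by (metis (no_types, lifting) sum.cong)
qed

lemma cm_orthonormal_coeff:
  assumes E: "cm_orthonormal C E" and e: "e \<in> E"
  shows "cm_inner C (\<Sum>e\<in>E. a e *\<^sub>R e) e = a e"
proof -
  have fin: "finite E" and EH: "E \<subseteq> H" using E by (auto simp: cm_orthonormal_def)
  have "cm_inner C (\<Sum>e\<in>E. a e *\<^sub>R e) e = (\<Sum>e'\<in>E. a e' * cm_inner C e' e)"
    using EH by (subst cm_inner_sum) (auto intro!: subspace_scale[OF subspace_H] sum.cong cm_inner_scale)
  also have "\<dots> = (\<Sum>e'\<in>E. if e' = e then a e' else 0)"
    using E e by (intro sum.cong) (auto simp: cm_orthonormal_def)
  finally show ?thesis using fin e by simp
qed

lemma cm_orthonormal_independent: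
  assumes E: "cm_orthonormal C E"
  shows "independent E"
proof (rule independent_if_scalars_zero)
  show "finite E" using E by (simp add: cm_orthonormal_def)
  fix u e assume u: "(\<Sum>e\<in>E. u e *\<^sub>R e) = 0" and e: "e \<in> E"
  have "cm_inner C 0 e = 0" using cm_inner_scale[OF subspace_0[OF subspace_H], of 0 e] by simp
  then show "u e = 0" using cm_orthonormal_coeff[OF E e, of u] u by simp
qed

lemma cm_parseval:
  assumes E: "cm_orthonormal C E" and v: "v \<in> span E"
  shows "cm_inner C v v = (\<Sum>e\<in>E. (cm_inner C v e)\<^sup>2)"
proof -
  have EH: "E \<subseteq> H" using E by (auto simp: cm_orthonormal_def)
  have "cm_inner C v v = cm_inner C (\<Sum>e\<in>E. cm_inner C v e *\<^sub>R e) v"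
    using cm_expansion[OF E v] by simp
  also have "\<dots> = (\<Sum>e\<in>E. cm_inner C v e * cm_inner C e v)"
    using EH by (subst cm_inner_sum) (auto intro!: subspace_scale[OF subspace_H] sum.cong cm_inner_scale)
  also have "\<dots> = (\<Sum>e\<in>E. (cm_inner C v e)\<^sup>2)"
    by (intro sum.cong refl) (metis cm_inner_commute power2_eq_square)
  finally show ?thesis .
qed

lemma ex_cm_orthonormal:
  assumes B: "finite B" "B \<subseteq> H"
  shows "\<exists>E. cm_orthonormal C E \<and> B \<subseteq> span E"
proof -
  obtain D where D: "finite D" "span D = span (J ` B)" "pairwise real_inner_class.orthogonal D"
    using basis_orthogonal[of "J ` B"] B(1) by auto
  have orthD: "orth x" if "x \<in> span (J ` B)" for x
    using that
  proof (induction rule: span_induct_alt)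
    case base
    then show ?case by (simp add: orth_def)
  next
    case (step c x y)
    then show ?case using B(2) by (auto intro!: orth_add orth_scale J)
  qed
  define u where "u d = (1 / norm d) *\<^sub>R d" for d :: 'a
  define E where "E = (\<lambda>d. S (u d)) ` (D - {0})"
  have ou: "orth (u d)" if "d \<in> D" for d
    using orthD[of d] that D(2) span_superset[of D] by (auto simp: u_def intro: orth_scale)
  have Ju: "J (S (u d)) = u d" if "d \<in> D" for d by (rule J_S[OF ou[OF that]])
  have uu: "inner (u d) (u d') = (if d = d' then 1 else 0)" if "d \<in> D - {0}" "d' \<in> D - {0}" for d d'
    using D(3) that by (auto simp: u_def pairwise_def real_inner_class.orthogonal_def dot_square_norm power2_eq_square)
  have "cm_orthonormal C E"
    unfolding cm_orthonormal_J
  proof (intro conjI ballI)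
    show "finite E" using D(1) by (simp add: E_def)
    show "E \<subseteq> H" by (auto simp: E_def S_in_H)
    fix e e' assume "e \<in> E" "e' \<in> E"
    then obtain d d' where d: "d \<in> D - {0}" "e = S (u d)" "d' \<in> D - {0}" "e' = S (u d')" by (auto simp: E_def)
    have "e = e' \<longleftrightarrow> d = d'" using Ju uu d by (metis DiffD1 zero_neq_one)
    then show "inner (J e) (J e') = (if e = e' then 1 else 0)" using Ju uu d by auto
  qed
  moreover have "b \<in> span E" if b: "b \<in> B" for b
  proof -
    have "J b \<in> span D" using b D(2) by (simp add: span_base)
    then have "S (J b) \<in> span (S ` D)" using linear_span_image[OF linear_S, of D] by blast
    also have "span (S ` D) \<subseteq> span E"
    proof (rule span_minimal)
      show "S ` D \<subseteq> span E"
      proof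
        fix x assume "x \<in> S ` D"
        then obtain d where d: "d \<in> D" "x = S d" by blast
        show "x \<in> span E"
        proof (cases "d = 0")
          case True
          then show ?thesis using d linear_0[OF linear_S] span_zero by simp
        next
          case False
          then have "S (u d) \<in> span E" using d by (intro span_base) (auto simp: E_def)
          then have "norm d *\<^sub>R S (u d) \<in> span E" by (rule span_scale)
          moreover have "norm d *\<^sub>R S (u d) = x" using False d by (simp add: u_def linear_scale[OF linear_S])
          ultimately show ?thesis by simp
        qed
      qed
    qed simp
    finally show ?thesis using J(1) B(2) b by auto
  qed
  ultimately show ?thesis by blast
qed

lemma ex_dual_vector:
  assumes E: "cm_orthonormal C E" and e: "e \<in> E"
  shows "\<exists>a. \<forall>v\<in>span E. cm_inner C v e = inner a v"
proof -
  have fin: "finite E" and EH: "E \<subseteq> H" using E by (auto simp: cm_orthonormal_def)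
  obtain D where D: "finite D" "span D = span E" "pairwise real_inner_class.orthogonal D"
    using basis_orthogonal[OF fin] by auto
  define a where "a = (\<Sum>d\<in>D. (cm_inner C d e / inner d d) *\<^sub>R d)"
  have DH: "D \<subseteq> H" using D(2) span_superset[of D] span_subset_H[OF EH] by blast
  have ad: "inner a d = cm_inner C d e" if d: "d \<in> D" for d
  proof -
    have "inner a d = (\<Sum>d'\<in>D. if d' = d then cm_inner C d e / inner d d * inner d d else 0)"
      unfolding a_def inner_sum_left
      using D(3) d by (intro sum.cong) (auto simp: pairwise_def real_inner_class.orthogonal_def)
    also have "\<dots> = cm_inner C d e / inner d d * inner d d" using D(1) d by simp
    finally show ?thesis using cm_inner_scale[OF subspace_0[OF subspace_H], of 0 e] by (cases "d = 0") auto
  qed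
  have "cm_inner C v e = inner a v" if v: "v \<in> span E" for v
  proof -
    obtain b where b: "v = (\<Sum>d\<in>D. b d *\<^sub>R d)"
      using v span_finite[OF D(1)] unfolding D(2)[symmetric] by auto
    have "cm_inner C v e = (\<Sum>d\<in>D. b d * cm_inner C d e)"
      unfolding b using DH by (subst cm_inner_sum) (auto intro!: subspace_scale[OF subspace_H] sum.cong cm_inner_scale)
    also have "\<dots> = inner a v" by (simp add: b inner_sum_right ad)
    finally show ?thesis .
  qed
  then show ?thesis by blast
qed

end

section \<open>A measure is determined by its characteristic functional\<close>

lemma closed_ball_eq_half_spaces:
  fixes D :: "'a::real_inner set"
  assumes D: "closure D = UNIV" and r: "0 \<le> r"
  shows "cball c r = (\<Inter>h\<in>D. {u. inner h (u - c) \<le> r * norm h})"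
proof (intro equalityI subsetI)
  fix u assume "u \<in> cball c r"
  then have u: "norm (u - c) \<le> r" by (simp add: dist_norm norm_minus_commute)
  have "inner h (u - c) \<le> r * norm h" for h
  proof -
    have "inner h (u - c) \<le> norm h * norm (u - c)" by (rule norm_cauchy_schwarz)
    also have "\<dots> \<le> norm h * r" using u by (intro mult_left_mono) auto
    finally show ?thesis by (simp add: mult.commute)
  qed
  then show "u \<in> (\<Inter>h\<in>D. {u. inner h (u - c) \<le> r * norm h})" by simp
next
  fix u assume u: "u \<in> (\<Inter>h\<in>D. {u. inner h (u - c) \<le> r * norm h})"
  have "u - c \<in> closure D" using D by simp
  then obtain x where x: "\<And>n. x n \<in> D" "x \<longlonglongrightarrow> u - c" unfolding closure_sequential by blast
  have "inner (u - c) (u - c) \<le> r * norm (u - c)"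
  proof (rule LIMSEQ_le)
    show "(\<lambda>n. inner (x n) (u - c)) \<longlonglongrightarrow> inner (u - c) (u - c)" by (intro tendsto_intros x)
    show "(\<lambda>n. r * norm (x n)) \<longlonglongrightarrow> r * norm (u - c)" by (intro tendsto_intros x)
  qed (use u x(1) in auto)
  then have "norm (u - c) * norm (u - c) \<le> r * norm (u - c)"
    by (simp add: power2_norm_eq_inner[symmetric] power2_eq_square)
  then have "norm (u - c) \<le> r" using r by (cases "norm (u - c) = 0") auto
  then show "u \<in> cball c r" by (simp add: dist_norm norm_minus_commute)
qed

definition cylinders :: "'a::real_inner set set" where
  "cylinders = {{u. \<forall>i<n. inner (h i) u \<in> A i} | n h A. \<forall>i::nat. A i \<in> sets (borel :: real measure)}"

lemma Int_stable_cylinders: "Int_stable cylinders"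
proof (rule Int_stableI)
  fix P Q :: "'a set" assume "P \<in> cylinders" "Q \<in> cylinders"
  then obtain n h A n' h' A' where P: "P = {u. \<forall>i<n. inner (h i) u \<in> A i}" "\<forall>i::nat. A i \<in> sets (borel :: real measure)"
    and Q: "Q = {u. \<forall>i<n'. inner (h' i) u \<in> A' i}" "\<forall>i::nat. A' i \<in> sets (borel :: real measure)"
    unfolding cylinders_def by auto
  define k where "k i = (if i < n then h i else h' (i - n))" for i
  define B where "B i = (if i < n then A i else A' (i - n))" for i
  have "P \<inter> Q = {u. \<forall>i<n + n'. inner (k i) u \<in> B i}"
  proof (intro equalityI subsetI)
    fix u assume u: "u \<in> {u. \<forall>i<n + n'. inner (k i) u \<in> B i}"
    have "inner (h i) u \<in> A i" if "i < n" for i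
      using u that by (auto simp: k_def B_def dest: spec[of _ i])
    moreover have "inner (h' i) u \<in> A' i" if "i < n'" for i
      using u that by (auto simp: k_def B_def dest: spec[of _ "n + i"])
    ultimately show "u \<in> P \<inter> Q" by (simp add: P Q)
  qed (auto simp: P Q k_def B_def)
  moreover have "\<forall>i. B i \<in> sets borel" using P Q by (simp add: B_def)
  ultimately show "P \<inter> Q \<in> cylinders" unfolding cylinders_def by blast
qed

lemma borel_eq_cylinders:
  "sets (borel :: 'a::{real_inner, second_countable_topology} measure) = sigma_sets UNIV cylinders"
proof
  show "sigma_sets UNIV cylinders \<subseteq> sets (borel :: 'a measure)"
  proof (rule sets.sigma_sets_subset', rule subsetI)
    fix P :: "'a set" assume "P \<in> cylinders"
    then obtain n h A where P: "P = {u. \<forall>i<n. inner (h i) u \<in> A i}" and A: "\<forall>i::nat. A i \<in> sets (borel :: real measure)"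
      unfolding cylinders_def by auto
    have "P = (\<Inter>i<n. inner (h i) -` A i)" by (auto simp: P)
    moreover have "inner (h i) -` A i \<in> sets borel" for i
      using measurable_sets_borel[of "inner (h i)" borel "A i"] A by simp
    ultimately show "P \<in> sets borel"
      by (cases "n = 0") (auto intro!: sets.finite_INT)
  qed auto
  obtain D :: "'a set" where D: "countable D" "\<And>X. open X \<Longrightarrow> X \<noteq> {} \<Longrightarrow> \<exists>d\<in>D. d \<in> X"
    using countable_dense_setE by blast
  have Dx: "\<exists>d\<in>D. dist d x < e" if "e > 0" for x e
    using D(2)[of "ball x e"] that by (auto simp: dist_commute)
  have Dcl: "closure D = UNIV"
    using Dx by (auto simp: closure_approachable)
  define M :: "'a measure" where "M = sigma UNIV cylinders"
  have sM: "sets M = sigma_sets UNIV cylinders" by (simp add: M_def)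
  have half: "{u. inner h (u - c) \<le> t} \<in> sets M" for h c :: 'a and t
  proof -
    have "{u. inner h (u - c) \<le> t} = {u. \<forall>i<1::nat. inner ((\<lambda>_. h) i) u \<in> (\<lambda>_. {.. t + inner h c}) i}"
      by (auto simp: inner_diff_right)
    also have "\<dots> \<in> cylinders" unfolding cylinders_def by (rule CollectI, intro exI conjI, rule refl) auto
    finally show ?thesis unfolding sM by (rule sigma_sets.Basic)
  qed
  have D0: "D \<noteq> {}" using Dx[of 1 0] by auto
  have ball: "cball c r \<in> sets M" if "0 \<le> r" for c :: 'a and r
    unfolding closed_ball_eq_half_spaces[OF Dcl that]
    by (rule sets.countable_INT'[OF D(1) D0]) (use half in auto)
  have "U \<in> sets M" if U: "open U" for U
  proof -
    define K where "K = {(d, n). d \<in> D \<and> cball d (1 / real (Suc n)) \<subseteq> U}"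
    have "K \<subseteq> D \<times> UNIV" by (auto simp: K_def)
    then have K: "countable K" by (rule countable_subset) (intro countable_SIGMA D, simp)
    have "U = (\<Union>(d, n)\<in>K. cball d (1 / real (Suc n)))"
    proof (intro equalityI subsetI)
      fix x assume "x \<in> U"
      then obtain e where e: "e > 0" "ball x e \<subseteq> U" using U open_contains_ball by blast
      obtain n where n: "1 / real (Suc n) < e / 2" using nat_approx_posE[of "e / 2"] e by auto
      obtain d where d: "d \<in> D" "dist d x < 1 / real (Suc n)" using Dx[of "1 / real (Suc n)" x] by auto
      have "cball d (1 / real (Suc n)) \<subseteq> ball x e"
      proof
        fix y assume "y \<in> cball d (1 / real (Suc n))"
        then have "dist d y \<le> 1 / real (Suc n)" by simp
        then have "dist x y < e" using d(2) n dist_triangle3[of x y d] by linarith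
        then show "y \<in> ball x e" by simp
      qed
      then have "(d, n) \<in> K" using e(2) d(1) by (auto simp: K_def)
      then show "x \<in> (\<Union>(d, n)\<in>K. cball d (1 / real (Suc n)))" using d(2) by force
    qed (auto simp: K_def)
    also have "\<dots> \<in> sets M" by (rule sets.countable_UN'[OF K]) (auto intro: ball)
    finally show ?thesis .
  qed
  then have "{S :: 'a set. open S} \<subseteq> sigma_sets UNIV cylinders" unfolding sM by auto
  then have "sigma_sets UNIV {S :: 'a set. open S} \<subseteq> sigma_sets UNIV cylinders" by (rule sigma_sets_mono)
  then show "sets (borel :: 'a measure) \<subseteq> sigma_sets UNIV cylinders" by (simp add: borel_def)
qed

lemma (in finite_measure) integrable_scaleR_iexp:
  assumes [measurable]: "V \<in> borel_measurable M" "f \<in> borel_measurable M" and B: "\<And>u. \<bar>V u\<bar> \<le> B"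
  shows "integrable M (\<lambda>u. V u *\<^sub>R iexp (f u))"
  by (rule integrable_const_bound[of _ B]) (use B in \<open>auto simp: norm_mult\<close>)

lemma weighted_projection_law:
  fixes M N :: "'b measure" and f :: "'b \<Rightarrow> real" and V :: "'b \<Rightarrow> real"
  assumes M: "prob_space M" and N: "prob_space N" and MN: "sets M = sets N"
    and f: "f \<in> borel_measurable M" and V: "V \<in> borel_measurable M"
    and V0: "\<And>u. 0 \<le> V u" and VB: "\<And>u. V u \<le> B"
    and eq: "\<And>t. (CLINT u|M. V u *\<^sub>R iexp (t * f u)) = (CLINT u|N. V u *\<^sub>R iexp (t * f u))"
    and A: "A \<in> sets borel"
  shows "(LINT u|M. V u * indicator A (f u)) = (LINT u|N. V u * indicator A (f u))"
proof -
  interpret M: prob_space M by (rule M)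
  interpret N: prob_space N by (rule N)
  have sp: "space M = space N" by (rule sets_eq_imp_space_eq[OF MN])
  note meas_eq = measurable_cong_sets[OF MN refl]
  define c where "c = (LINT u|M. V u)"
  have iM: "integrable M V"
    by (rule M.integrable_const_bound[of _ B]) (use V0 VB V in auto)
  have iN: "integrable N V"
    by (rule N.integrable_const_bound[of _ B]) (use V0 VB V meas_eq in auto)
  have cN: "c = (LINT u|N. V u)"
  proof -
    have "complex_of_real (LINT u|M. V u) = complex_of_real (LINT u|N. V u)"
      using eq[of 0] by (simp add: scaleR_conv_of_real)
    then show ?thesis unfolding c_def of_real_eq_iff .
  qed
  have key: "\<exists>R. real_distribution R \<and> (\<forall>t. char R t = (CLINT u|Q. V u *\<^sub>R iexp (t * f u)) / c)
      \<and> (LINT x|R. indicator A x) = (LINT u|Q. V u * indicator A (f u)) / c"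
    if Q: "prob_space Q" "sets Q = sets M" "integrable Q V" "c = (LINT u|Q. V u)" and c: "c > 0" for Q
  proof -
    interpret Q: prob_space Q by (rule Q)
    have fQ [measurable]: "f \<in> borel_measurable Q" and VQ [measurable]: "V \<in> borel_measurable Q"
      using f V measurable_cong_sets[OF Q(2) refl, of borel] by auto
    let ?d = "density Q (\<lambda>u. ennreal (V u / c))"
    define R where "R = distr ?d borel f"
    have "emeasure ?d (space ?d) = (\<integral>\<^sup>+u. ennreal (V u / c) \<partial>Q)"
      by (subst emeasure_density) (auto intro!: nn_integral_cong)
    also have "\<dots> = ennreal (LINT u|Q. V u / c)"
      by (rule nn_integral_eq_integral) (use Q(3) V0 c in auto)
    also have "\<dots> = 1" using Q(4) c by simp
    finally have pd: "prob_space ?d" by (rule prob_spaceI)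
    have "real_distribution R" unfolding R_def
      by (rule prob_space.real_distribution_distr[OF pd]) simp
    moreover have "char R t = (CLINT u|Q. V u *\<^sub>R iexp (t * f u)) / c" for t
    proof -
      have "char R t = (CLINT u|?d. iexp (t * f u))"
        unfolding char_def R_def by (rule integral_distr) auto
      also have "\<dots> = (CLINT u|Q. (V u / c) *\<^sub>R iexp (t * f u))"
        by (rule integral_density) (use V0 c in auto)
      also have "\<dots> = (CLINT u|Q. (V u *\<^sub>R iexp (t * f u)) / c)"
        by (simp add: scaleR_conv_of_real)
      also have "\<dots> = (CLINT u|Q. V u *\<^sub>R iexp (t * f u)) / c" by simp
      finally show ?thesis .
    qed
    moreover have "(LINT x|R. indicator A x) = (LINT u|Q. V u * indicator A (f u)) / c"
    proof -
      have "(LINT x|R. indicator A x) = (LINT u|?d. indicator A (f u) :: real)"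
        unfolding R_def by (rule integral_distr) (use A in auto)
      also have "\<dots> = (LINT u|Q. (V u / c) *\<^sub>R indicator A (f u))"
        by (rule integral_density) (use V0 c A in auto)
      finally show ?thesis by (simp add: divide_inverse mult_ac)
    qed
    ultimately show ?thesis by blast
  qed
  show ?thesis
  proof (cases "c > 0")
    case True
    obtain R where R: "real_distribution R" "\<And>t. char R t = (CLINT u|M. V u *\<^sub>R iexp (t * f u)) / c"
      "(LINT x|R. indicator A x) = (LINT u|M. V u * indicator A (f u)) / c"
      using key[OF M refl iM c_def True] by blast
    obtain R' where R': "real_distribution R'" "\<And>t. char R' t = (CLINT u|N. V u *\<^sub>R iexp (t * f u)) / c"
      "(LINT x|R'. indicator A x) = (LINT u|N. V u * indicator A (f u)) / c"
      using key[OF N MN[symmetric] iN cN True] by blast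
    have "R = R'" by (rule Levy_uniqueness[OF R(1) R'(1)], rule ext) (simp only: R(2) R'(2) eq)
    then show ?thesis using R(3) R'(3) True by simp
  next
    case False
    moreover have "c \<ge> 0" unfolding c_def using V0 by (intro Bochner_Integration.integral_nonneg) auto
    ultimately have c0: "c = 0" by simp
    have "AE u in M. V u = 0" using integral_nonneg_eq_0_iff_AE[OF iM] V0 c0 c_def by auto
    moreover have "AE u in N. V u = 0" using integral_nonneg_eq_0_iff_AE[OF iN] V0 c0 cN by auto
    ultimately have "(LINT u|M. V u * indicator A (f u)) = 0" "(LINT u|N. V u * indicator A (f u)) = 0"
      by (auto intro!: integral_eq_zero_AE)
    then show ?thesis by simp
  qed
qed

text \<open>
  The exponentials are replaced by indicators of Borel sets one coordinate at a time. The
  one-dimensional uniqueness theorem applies to each coordinate because the weights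
  \<open>W\<close> and \<open>W (1 + cos (inner k u + \<alpha>))\<close> are nonnegative.
\<close>

theorem measure_eq_of_characteristic_functional:
  fixes M N :: "'a::{real_inner, second_countable_topology} measure"
  assumes M: "prob_space M" "sets M = sets borel" and N: "prob_space N" "sets N = sets borel"
    and char: "\<And>h. (CLINT u|M. iexp (inner h u)) = (CLINT u|N. iexp (inner h u))"
  shows "M = N"
proof -
  interpret M: prob_space M by (rule M)
  interpret N: prob_space N by (rule N)
  note [measurable_cong] = M(2) N(2)
  have step: "(CLINT u|M. (\<Prod>i<n. indicator (A i) (inner (h i) u)) *\<^sub>R iexp (inner k u))
      = (CLINT u|N. (\<Prod>i<n. indicator (A i) (inner (h i) u)) *\<^sub>R iexp (inner k u))"
    if A: "\<And>i. A i \<in> sets borel" for n :: nat and h :: "nat \<Rightarrow> 'a" and A :: "nat \<Rightarrow> real set" and k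
  proof (induction n arbitrary: k)
    case 0
    then show ?case using char by simp
  next
    case (Suc n)
    note A[measurable]
    define W where "W u = (\<Prod>i<n. indicator (A i) (inner (h i) u) :: real)" for u
    have W01: "0 \<le> W u \<and> W u \<le> 1" for u
      unfolding W_def by (auto intro!: prod_nonneg prod_le_1)
    have W[measurable]: "W \<in> borel_measurable borel" unfolding W_def by measurable
    have IH: "(CLINT u|M. W u *\<^sub>R iexp (inner k u)) = (CLINT u|N. W u *\<^sub>R iexp (inner k u))" for k
      using Suc.IH by (simp add: W_def)
    have intM: "integrable M (\<lambda>u. W u *\<^sub>R iexp (inner k u))" for k
      by (rule M.integrable_scaleR_iexp[of _ _ 1]) (use W01 in auto)
    have intN: "integrable N (\<lambda>u. W u *\<^sub>R iexp (inner k u))" for k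
      by (rule N.integrable_scaleR_iexp[of _ _ 1]) (use W01 in auto)
    have split: "(W u * (1 + cos (inner k u + \<alpha>))) *\<^sub>R iexp (t * inner (h n) u) =
      W u *\<^sub>R iexp (inner (t *\<^sub>R h n) u) + (iexp \<alpha> / 2) * (W u *\<^sub>R iexp (inner (t *\<^sub>R h n + k) u))
        + (iexp (- \<alpha>) / 2) * (W u *\<^sub>R iexp (inner (t *\<^sub>R h n - k) u))" for \<alpha> t u
    proof -
      have "complex_of_real (cos x) = (iexp x + iexp (- x)) / 2" for x
        by (simp add: cos_exp_eq flip: cos_of_real)
      then show ?thesis
        by (simp add: scaleR_conv_of_real inner_add_left inner_diff_left algebra_simps add_divide_distrib
            diff_divide_distrib flip: exp_add)
    qed
    have eq: "(CLINT u|M. (W u * (1 + cos (inner k u + \<alpha>))) *\<^sub>R iexp (t * inner (h n) u))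
      = (CLINT u|N. (W u * (1 + cos (inner k u + \<alpha>))) *\<^sub>R iexp (t * inner (h n) u))" for \<alpha> t
    proof -
      have sumI: "(CLINT u|Q. X u + p * Y u + q * Z u) = (CLINT u|Q. X u) + p * (CLINT u|Q. Y u) + q * (CLINT u|Q. Z u)"
        if "integrable Q X" "integrable Q Y" "integrable Q Z" for Q :: "'a measure" and X Y Z p q
        using that by simp
      show ?thesis by (simp only: split sumI[OF intM intM intM] sumI[OF intN intN intN] IH)
    qed
    have law: "(LINT u|M. (W u * (1 + cos (inner k u + \<alpha>))) * indicator (A n) (inner (h n) u))
      = (LINT u|N. (W u * (1 + cos (inner k u + \<alpha>))) * indicator (A n) (inner (h n) u))" for \<alpha>
    proof (rule weighted_projection_law[OF M(1) N(1), of _ _ 2])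
      fix u
      have "0 \<le> 1 + cos (inner k u + \<alpha>)" "1 + cos (inner k u + \<alpha>) \<le> 2"
        using cos_ge_minus_one[of "inner k u + \<alpha>"] cos_le_one[of "inner k u + \<alpha>"] by linarith+
      then show "0 \<le> W u * (1 + cos (inner k u + \<alpha>))" "W u * (1 + cos (inner k u + \<alpha>)) \<le> 2"
        using W01[of u] mult_mono[of "W u" 1 "1 + cos (inner k u + \<alpha>)" 2] by auto
    qed (use eq A M N in auto)
    have law0: "(LINT u|M. W u * indicator (A n) (inner (h n) u)) = (LINT u|N. W u * indicator (A n) (inner (h n) u))"
    proof (rule weighted_projection_law[OF M(1) N(1), of _ _ 1])
      show "(CLINT u|M. W u *\<^sub>R iexp (t * inner (h n) u)) = (CLINT u|N. W u *\<^sub>R iexp (t * inner (h n) u))" for t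
        using IH[of "t *\<^sub>R h n"] by simp
    qed (use W01 A M N in auto)
    define V where "V u = W u * indicator (A n) (inner (h n) u)" for u
    have V01: "\<bar>V u\<bar> \<le> 1" for u unfolding V_def using W01[of u] by (auto simp: indicator_def)
    have V[measurable]: "V \<in> borel_measurable borel" unfolding V_def by measurable
    have Vcos: "(LINT u|M. V u * cos (inner k u + \<alpha>)) = (LINT u|N. V u * cos (inner k u + \<alpha>))" for \<alpha>
    proof -
      have *: "(LINT u|Q. V u * cos (inner k u + \<alpha>))
        = (LINT u|Q. (W u * (1 + cos (inner k u + \<alpha>))) * indicator (A n) (inner (h n) u)) - (LINT u|Q. W u * indicator (A n) (inner (h n) u))"
        if Q: "prob_space Q" "sets Q = sets borel" for Q
      proof -
        interpret Q: prob_space Q by (rule Q)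
        note [measurable_cong] = Q(2)
        have 1: "integrable Q V" by (rule Q.integrable_const_bound[of _ 1]) (use V01 in auto)
        have 2: "integrable Q (\<lambda>u. V u * cos (inner k u + \<alpha>))"
          by (rule Q.integrable_const_bound[of _ 1]) (use V01 in \<open>auto simp: abs_mult intro!: mult_le_one abs_cos_le_one\<close>)
        have "(LINT u|Q. (W u * (1 + cos (inner k u + \<alpha>))) * indicator (A n) (inner (h n) u))
            = (LINT u|Q. V u + V u * cos (inner k u + \<alpha>))"
          by (rule Bochner_Integration.integral_cong) (auto simp: V_def algebra_simps)
        also have "\<dots> = (LINT u|Q. V u) + (LINT u|Q. V u * cos (inner k u + \<alpha>))"
          by (rule Bochner_Integration.integral_add[OF 1 2])
        finally show ?thesis by (simp add: V_def)
      qed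
      show ?thesis unfolding *[OF M] *[OF N] law law0 ..
    qed
    have *: "(CLINT u|Q. V u *\<^sub>R iexp (inner k u))
        = complex_of_real (LINT u|Q. V u * cos (inner k u + 0)) + \<i> * complex_of_real (LINT u|Q. V u * cos (inner k u + - (pi / 2)))"
      if Q: "prob_space Q" "sets Q = sets borel" for Q
    proof -
      interpret Q: prob_space Q by (rule Q)
      note [measurable_cong] = Q(2)
      have 1: "integrable Q (\<lambda>u. V u * cos (inner k u + \<alpha>))" for \<alpha>
        by (rule Q.integrable_const_bound[of _ 1]) (use V01 in \<open>auto simp: abs_mult intro!: mult_le_one abs_cos_le_one\<close>)
      have "(CLINT u|Q. V u *\<^sub>R iexp (inner k u))
          = (CLINT u|Q. complex_of_real (V u * cos (inner k u + 0)) + \<i> * complex_of_real (V u * cos (inner k u + - (pi / 2))))"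
        by (rule Bochner_Integration.integral_cong)
          (auto simp: exp_Euler scaleR_conv_of_real cos_of_real sin_of_real cos_diff algebra_simps)
      also have "\<dots> = (CLINT u|Q. complex_of_real (V u * cos (inner k u + 0))) + (CLINT u|Q. \<i> * complex_of_real (V u * cos (inner k u + - (pi / 2))))"
        by (rule Bochner_Integration.integral_add; (rule integrable_mult_right)?; rule integrable_of_real[OF 1])
      finally show ?thesis by (simp del: of_real_mult)
    qed
    have "(\<Prod>i<Suc n. indicator (A i) (inner (h i) u)) = V u" for u
      by (simp add: V_def W_def mult.commute)
    then show ?case by (simp only: *[OF M] *[OF N] Vcos)
  qed
  show ?thesis
  proof (rule measure_eqI_generator_eq[OF Int_stable_cylinders, of UNIV])
    show "sets M = sigma_sets UNIV cylinders" "sets N = sigma_sets UNIV cylinders"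
      using M N borel_eq_cylinders by auto
    show "range (\<lambda>i::nat. UNIV) \<subseteq> (cylinders :: 'a set set)"
      unfolding cylinders_def by (auto intro!: exI[of _ "0::nat"])
    show "emeasure M UNIV \<noteq> \<infinity>" by simp
    fix P :: "'a set" assume "P \<in> cylinders"
    then obtain n h A where P: "P = {u. \<forall>i<n. inner (h i) u \<in> A i}" and A: "\<And>i::nat. A i \<in> sets (borel :: real measure)"
      unfolding cylinders_def by auto
    have Ps: "P \<in> sets borel" using \<open>P \<in> cylinders\<close> by (simp add: borel_eq_cylinders sigma_sets.Basic)
    have ind: "(\<Prod>i<n. indicator (A i) (inner (h i) u)) = (indicator P u :: real)" for u
    proof (cases "u \<in> P")
      case False
      then show ?thesis by (auto simp: P indicator_def)
    qed (auto simp: P)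
    have m: "(CLINT u|Q. (\<Prod>i<n. indicator (A i) (inner (h i) u)) *\<^sub>R iexp (inner 0 u)) = complex_of_real (measure Q P)"
      if "prob_space Q" "sets Q = sets borel" for Q
      using that Ps unfolding ind by (simp add: scaleR_conv_of_real sets_eq_imp_space_eq[OF that(2)])
    have "(CLINT u|M. (\<Prod>i<n. indicator (A i) (inner (h i) u)) *\<^sub>R iexp (inner 0 u))
      = (CLINT u|N. (\<Prod>i<n. indicator (A i) (inner (h i) u)) *\<^sub>R iexp (inner 0 u))"
      by (rule step) (rule A)
    then have "complex_of_real (measure M P) = complex_of_real (measure N P)"
      by (simp only: m[OF M] m[OF N])
    then show "emeasure M P = emeasure N P"
      by (simp add: M.emeasure_eq_measure N.emeasure_eq_measure)
  qed auto
qed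

section \<open>Gaussian measures and measurable linear functionals\<close>

lemma char_centered_normal:
  assumes "0 < \<sigma>"
  shows "(CLINT x|density lborel (\<lambda>x. ennreal (normal_density 0 \<sigma> x)). iexp x) = complex_of_real (exp (- \<sigma>\<^sup>2 / 2))"
proof -
  have nd: "\<sigma> * normal_density 0 \<sigma> (\<sigma> * x) = std_normal_density x" for x
    using assms by (simp add: normal_density_def real_sqrt_mult power_mult_distrib)
  have "(CLINT x|density lborel (\<lambda>x. ennreal (normal_density 0 \<sigma> x)). iexp x) = (CLINT x|lborel. normal_density 0 \<sigma> x *\<^sub>R iexp x)"
    by (subst integral_density) auto
  also have "\<dots> = \<bar>\<sigma>\<bar> *\<^sub>R (CLINT x|lborel. normal_density 0 \<sigma> (0 + \<sigma> * x) *\<^sub>R iexp (0 + \<sigma> * x))"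
    by (rule lborel_integral_real_affine) (use assms in simp)
  also have "\<dots> = (CLINT x|lborel. \<sigma> *\<^sub>R (normal_density 0 \<sigma> (\<sigma> * x) *\<^sub>R iexp (\<sigma> * x)))"
    unfolding integral_scaleR_right using assms by simp
  also have "\<dots> = (CLINT x|lborel. std_normal_density x *\<^sub>R iexp (\<sigma> * x))"
    unfolding scaleR_scaleR nd ..
  also have "\<dots> = char std_normal_distribution \<sigma>"
    unfolding char_def by (subst integral_density) auto
  finally show ?thesis by (simp add: char_std_normal_distribution)
qed

lemma (in finite_measure) integrable_mult_of_squares:
  fixes f g :: "'a \<Rightarrow> real"
  assumes [measurable]: "f \<in> borel_measurable M" "g \<in> borel_measurable M"
    and "integrable M (\<lambda>x. (f x)\<^sup>2)" "integrable M (\<lambda>x. (g x)\<^sup>2)"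
  shows "integrable M (\<lambda>x. f x * g x)"
proof (rule Bochner_Integration.integrable_bound[of M "\<lambda>x. (f x)\<^sup>2 + (g x)\<^sup>2"])
  have "\<bar>a * b\<bar> \<le> a\<^sup>2 + b\<^sup>2" for a b :: real
  proof -
    have "2 * (\<bar>a\<bar> * \<bar>b\<bar>) \<le> \<bar>a\<bar>\<^sup>2 + \<bar>b\<bar>\<^sup>2" using zero_le_power2[of "\<bar>a\<bar> - \<bar>b\<bar>"] unfolding power2_diff by linarith
    moreover have "0 \<le> \<bar>a\<bar> * \<bar>b\<bar>" by simp
    ultimately show ?thesis unfolding abs_mult power2_abs by linarith
  qed
  then show "AE x in M. norm (f x * g x) \<le> norm ((f x)\<^sup>2 + (g x)\<^sup>2)" by simp
qed (use assms in auto)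

locale gaussian_measure = cameron_martin_space C for C :: "'a::{real_inner, polish_space} \<Rightarrow> 'a" +
  fixes M :: "'a measure"
  assumes gaussian: "centered_gaussian M C"
begin

lemma sets_M [simp, measurable_cong]: "sets M = sets borel"
  using gaussian by (simp add: centered_gaussian_def)

lemma space_M [simp]: "space M = UNIV"
  using sets_eq_imp_space_eq[OF sets_M] by simp

lemma law: "distr M borel (inner h) = (if norm (S h) = 0 then return borel 0
    else density lborel (\<lambda>x. ennreal (normal_density 0 (norm (S h)) x)))"
proof -
  have "inner h (C h) = (norm (S h))\<^sup>2" by (simp add: inner_C power2_norm_eq_inner)
  then show ?thesis using gaussian by (simp add: centered_gaussian_def)
qed

sublocale prob_space M
proof
  have "emeasure M (space M) = emeasure (distr M borel (inner 0)) (space borel)"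
    by (subst emeasure_distr) auto
  also have "\<dots> = 1"
    unfolding law linear_0[OF linear_S] by (simp add: emeasure_return)
  finally show "emeasure M (space M) = 1" .
qed

lemma char_M: "(CLINT u|M. iexp (inner h u)) = complex_of_real (exp (- (norm (S h))\<^sup>2 / 2))"
proof -
  have "(CLINT u|M. iexp (inner h u)) = (CLINT x|distr M borel (inner h). iexp x)"
    by (subst integral_distr) auto
  also have "\<dots> = complex_of_real (exp (- (norm (S h))\<^sup>2 / 2))"
  proof (cases "norm (S h) = 0")
    case True
    then show ?thesis unfolding law by (simp add: integral_return)
  next
    case False
    then show ?thesis unfolding law using char_centered_normal[of "norm (S h)"] by simp
  qed
  finally show ?thesis .
qed

lemma second_moment: "has_bochner_integral M (\<lambda>u. (inner h u)\<^sup>2) ((norm (S h))\<^sup>2)"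
proof -
  have "has_bochner_integral (distr M borel (inner h)) (\<lambda>x. x\<^sup>2) ((norm (S h))\<^sup>2)"
  proof (cases "norm (S h) = 0")
    case True
    have "integrable (return borel (0::real)) (\<lambda>x. x\<^sup>2)"
      by (rule integrableI_bounded) (auto simp: nn_integral_return)
    then show ?thesis unfolding law using True by (simp add: has_bochner_integral_iff integral_return)
  next
    case False
    have "has_bochner_integral lborel (\<lambda>x. normal_density 0 (norm (S h)) x * (x - 0) ^ (2 * 1))
      (fact (2 * 1) / ((2 / (norm (S h))\<^sup>2) ^ 1 * fact 1))" by (rule normal_moment_even) (use False in simp)
    then have "has_bochner_integral lborel (\<lambda>x. normal_density 0 (norm (S h)) x *\<^sub>R x\<^sup>2) ((norm (S h))\<^sup>2)"
      by (simp add: power2_eq_square)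
    then show ?thesis unfolding law using False by (simp add: has_bochner_integral_density)
  qed
  then show ?thesis by (simp add: has_bochner_integral_iff integrable_distr_eq integral_distr)
qed

lemma integrable_inner_sq: "integrable M (\<lambda>u. (inner h u)\<^sup>2)"
  using second_moment by (simp add: has_bochner_integral_iff)

lemma covariance: "(LINT u|M. inner h u * inner k u) = inner (S h) (S k)"
proof -
  have i: "integrable M (\<lambda>u. inner h u * inner k u)"
    by (rule integrable_mult_of_squares) (auto intro: integrable_inner_sq)
  have "(LINT u|M. (inner (h + k) u)\<^sup>2) = (LINT u|M. (inner h u)\<^sup>2 + (inner k u)\<^sup>2 + 2 * (inner h u * inner k u))"
    by (rule Bochner_Integration.integral_cong) (auto simp: inner_add_left power2_eq_square algebra_simps)
  also have "\<dots> = (norm (S h))\<^sup>2 + (norm (S k))\<^sup>2 + 2 * (LINT u|M. inner h u * inner k u)"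
    using i integrable_inner_sq second_moment[of h] second_moment[of k] by (simp add: has_bochner_integral_iff)
  also have "(LINT u|M. (inner (h + k) u)\<^sup>2) = (norm (S h + S k))\<^sup>2"
    using second_moment[of "h + k"] by (simp add: has_bochner_integral_iff linear_add[OF linear_S])
  finally show ?thesis by (simp add: power2_norm_eq_inner inner_add_left inner_add_right inner_commute)
qed

lemma nn_second_moment: "(\<integral>\<^sup>+u. ennreal ((inner h u)\<^sup>2) \<partial>M) = ennreal ((norm (S h))\<^sup>2)"
  using second_moment[of h] by (subst nn_integral_eq_integral) (auto simp: has_bochner_integral_iff)

lemma second_moment_limit:
  assumes [measurable]: "Y \<in> borel_measurable M" and ae: "AE u in M. (\<lambda>j. inner (q j) u) \<longlonglongrightarrow> Y u"
    and lim: "(\<lambda>j. S (q j)) \<longlonglongrightarrow> z"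
  shows "(\<integral>\<^sup>+u. ennreal ((Y u)\<^sup>2) \<partial>M) \<le> ennreal ((norm z)\<^sup>2)"
proof -
  have "(\<integral>\<^sup>+u. ennreal ((Y u)\<^sup>2) \<partial>M) = (\<integral>\<^sup>+u. liminf (\<lambda>j. ennreal ((inner (q j) u)\<^sup>2)) \<partial>M)"
  proof (rule nn_integral_cong_AE, use ae in eventually_elim)
    fix u assume "(\<lambda>j. inner (q j) u) \<longlonglongrightarrow> Y u"
    then have "(\<lambda>j. ennreal ((inner (q j) u)\<^sup>2)) \<longlonglongrightarrow> ennreal ((Y u)\<^sup>2)" by (intro tendsto_intros tendsto_ennrealI)
    then show "ennreal ((Y u)\<^sup>2) = liminf (\<lambda>j. ennreal ((inner (q j) u)\<^sup>2))"
      by (rule lim_imp_Liminf[OF sequentially_bot, symmetric])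
  qed
  also have "\<dots> \<le> liminf (\<lambda>j. \<integral>\<^sup>+u. ennreal ((inner (q j) u)\<^sup>2) \<partial>M)"
    by (rule nn_integral_liminf) auto
  also have "\<dots> = ennreal ((norm z)\<^sup>2)"
    unfolding nn_second_moment by (rule lim_imp_Liminf) (auto intro!: tendsto_intros tendsto_ennrealI lim)
  finally show ?thesis .
qed

lemma char_limit:
  assumes [measurable]: "Y \<in> borel_measurable M" and ae: "AE u in M. (\<lambda>j. inner (q j) u) \<longlonglongrightarrow> Y u"
    and lim: "(\<lambda>j. S (q j)) \<longlonglongrightarrow> z"
  shows "(CLINT u|M. iexp (Y u)) = complex_of_real (exp (- (norm z)\<^sup>2 / 2))"
proof -
  have "(\<lambda>j. CLINT u|M. iexp (inner (q j) u)) \<longlonglongrightarrow> (CLINT u|M. iexp (Y u))"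
  proof (rule integral_dominated_convergence[where w = "\<lambda>_. 1"])
    show "AE u in M. (\<lambda>j. iexp (inner (q j) u)) \<longlonglongrightarrow> iexp (Y u)"
      using ae by eventually_elim (auto intro!: tendsto_intros)
  qed auto
  moreover have "(\<lambda>j. CLINT u|M. iexp (inner (q j) u)) \<longlonglongrightarrow> complex_of_real (exp (- (norm z)\<^sup>2 / 2))"
    unfolding char_M by (intro tendsto_intros lim) simp
  ultimately show ?thesis by (rule LIMSEQ_unique)
qed

lemma integral_limit:
  assumes [measurable]: "X \<in> borel_measurable M"
    and k: "\<And>j. (\<integral>\<^sup>+u. ennreal ((X u - inner (k j) u)\<^sup>2) \<partial>M) \<le> ennreal ((1/4) ^ j)"
  shows "(\<lambda>j. LINT u|M. inner h u * inner (k j) u) \<longlonglongrightarrow> (LINT u|M. inner h u * X u)"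
proof -
  have sq: "integrable M (\<lambda>u. (X u - inner (k j) u)\<^sup>2)" for j
    by (rule integrableI_bounded) (use order_le_less_trans[OF k[of j]] in auto)
  have le: "(LINT u|M. (X u - inner (k j) u)\<^sup>2) \<le> (1/4) ^ j" for j
  proof -
    have "ennreal (LINT u|M. (X u - inner (k j) u)\<^sup>2) = (\<integral>\<^sup>+u. ennreal ((X u - inner (k j) u)\<^sup>2) \<partial>M)"
      by (rule nn_integral_eq_integral[symmetric]) (use sq in auto)
    then have "ennreal (LINT u|M. (X u - inner (k j) u)\<^sup>2) \<le> ennreal ((1/4) ^ j)" using k[of j] by simp
    then show ?thesis by (subst (asm) ennreal_le_iff) auto
  qed
  have i1: "integrable M (\<lambda>u. inner h u * (X u - inner (k j) u))" for j
    by (rule integrable_mult_of_squares) (use sq integrable_inner_sq in auto)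
  have i2: "integrable M (\<lambda>u. inner h u * inner (k j) u)" for j
    by (rule integrable_mult_of_squares) (use integrable_inner_sq in auto)
  have split: "(LINT u|M. inner h u * X u) = (LINT u|M. inner h u * inner (k j) u) + (LINT u|M. inner h u * (X u - inner (k j) u))" for j
    using Bochner_Integration.integral_add[OF i2[of j] i1[of j]] by (simp add: right_diff_distrib)
  define c where "c = (norm (S h))\<^sup>2"
  have bound: "\<bar>LINT u|M. inner h u * (X u - inner (k j) u)\<bar> \<le> (1/2) ^ j * (c + 1)" for j
  proof -
    define t :: real where "t = (1/2) ^ j"
    have t: "t > 0" "t * t = (1/4) ^ j" by (auto simp: t_def simp flip: power_mult_distrib)
    have ab: "\<bar>a * b\<bar> \<le> t * a\<^sup>2 + (1 / t) * b\<^sup>2" for a b :: real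
    proof -
      have "2 * (t * \<bar>a\<bar> * \<bar>b\<bar>) \<le> (t * \<bar>a\<bar>)\<^sup>2 + \<bar>b\<bar>\<^sup>2" using zero_le_power2[of "t * \<bar>a\<bar> - \<bar>b\<bar>"] unfolding power2_diff by linarith
      moreover have "0 \<le> t * \<bar>a\<bar> * \<bar>b\<bar>" using t(1) by simp
      moreover have "t * (t * a\<^sup>2 + (1 / t) * b\<^sup>2) = (t * \<bar>a\<bar>)\<^sup>2 + \<bar>b\<bar>\<^sup>2"
        using t(1) by (simp add: power_mult_distrib distrib_left power2_eq_square)
      moreover have "t * \<bar>a * b\<bar> = t * \<bar>a\<bar> * \<bar>b\<bar>" by (simp add: abs_mult)
      ultimately have "t * \<bar>a * b\<bar> \<le> t * (t * a\<^sup>2 + (1 / t) * b\<^sup>2)" by linarith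
      then show ?thesis using t(1) by simp
    qed
    have "\<bar>LINT u|M. inner h u * (X u - inner (k j) u)\<bar> \<le> (LINT u|M. \<bar>inner h u * (X u - inner (k j) u)\<bar>)"
      by (rule integral_abs_bound)
    also have "\<dots> \<le> (LINT u|M. t * (inner h u)\<^sup>2 + (1 / t) * (X u - inner (k j) u)\<^sup>2)"
      by (rule integral_mono) (use i1 sq integrable_inner_sq ab in auto)
    also have "\<dots> = t * c + (1 / t) * (LINT u|M. (X u - inner (k j) u)\<^sup>2)"
      using sq integrable_inner_sq second_moment[of h] by (simp add: has_bochner_integral_iff c_def)
    also have "\<dots> \<le> t * c + (1 / t) * (t * t)"
      using le[of j] t by (intro add_left_mono mult_left_mono) auto
    also have "\<dots> = t * (c + 1)" using t(1) by (simp add: algebra_simps)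
    finally show ?thesis by (simp add: t_def)
  qed
  have "(\<lambda>j. LINT u|M. inner h u * (X u - inner (k j) u)) \<longlonglongrightarrow> 0"
  proof (rule Lim_null_comparison)
    show "\<forall>\<^sub>F j in sequentially. norm (LINT u|M. inner h u * (X u - inner (k j) u)) \<le> (1/2) ^ j * (c + 1)"
      using bound by simp
    show "(\<lambda>j. (1/2) ^ j * (c + 1)) \<longlonglongrightarrow> 0"
      by (intro tendsto_mult_left_zero LIMSEQ_power_zero) simp
  qed
  then have "(\<lambda>j. (LINT u|M. inner h u * X u) - (LINT u|M. inner h u * (X u - inner (k j) u))) \<longlonglongrightarrow> (LINT u|M. inner h u * X u) - 0"
    by (intro tendsto_intros)
  moreover have "(LINT u|M. inner h u * X u) - (LINT u|M. inner h u * (X u - inner (k j) u)) = (LINT u|M. inner h u * inner (k j) u)" for j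
    using split[of j] by simp
  ultimately show ?thesis by simp
qed

lemma AE_limit_of_fast:
  assumes [measurable]: "\<And>j. f j \<in> borel_measurable M"
    and b: "\<And>j. (\<integral>\<^sup>+u. ennreal ((f j u)\<^sup>2) \<partial>M) \<le> ennreal ((1/4) ^ j)"
  shows "AE u in M. summable (\<lambda>j. (2 ^ j) * (f j u)\<^sup>2)"
proof -
  have "(\<integral>\<^sup>+u. (\<Sum>j. ennreal (2 ^ j * (f j u)\<^sup>2)) \<partial>M) = (\<Sum>j. \<integral>\<^sup>+u. ennreal (2 ^ j * (f j u)\<^sup>2) \<partial>M)"
    by (rule nn_integral_suminf) auto
  also have "\<dots> \<le> (\<Sum>j. ennreal ((1/2) ^ j))"
  proof (rule suminf_le)
    fix j
    have "(\<integral>\<^sup>+u. ennreal (2 ^ j * (f j u)\<^sup>2) \<partial>M) = ennreal (2 ^ j) * (\<integral>\<^sup>+u. ennreal ((f j u)\<^sup>2) \<partial>M)"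
      by (subst nn_integral_cmult[symmetric]) (auto simp: ennreal_mult)
    also have "\<dots> \<le> ennreal (2 ^ j) * ennreal ((1/4) ^ j)" by (intro mult_left_mono b) simp
    also have "\<dots> = ennreal ((1/2) ^ j)"
      by (simp flip: ennreal_mult power_mult_distrib)
    finally show "(\<integral>\<^sup>+u. ennreal (2 ^ j * (f j u)\<^sup>2) \<partial>M) \<le> ennreal ((1/2) ^ j)" .
  qed auto
  also have "\<dots> = ennreal (\<Sum>j. (1/2) ^ j)" by (rule suminf_ennreal_eq) (auto intro: summable_sums summable_geometric)
  also have "\<dots> < \<infinity>" by simp
  finally have "(\<integral>\<^sup>+u. (\<Sum>j. ennreal (2 ^ j * (f j u)\<^sup>2)) \<partial>M) \<noteq> \<infinity>" by simp
  then have "AE u in M. (\<Sum>j. ennreal (2 ^ j * (f j u)\<^sup>2)) \<noteq> \<infinity>"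
    by (intro nn_integral_noteq_infinite) auto
  then show ?thesis by eventually_elim (auto intro!: summable_suminf_not_top)
qed

lemma cm_sequence:
  assumes X[measurable]: "X \<in> borel_measurable M"
    and approx: "\<forall>\<epsilon>>0. \<exists>k. (\<integral>\<^sup>+u. ennreal ((X u - inner k u)\<^sup>2) \<partial>M) < ennreal \<epsilon>"
    and cov: "\<forall>k. (LINT u|M. inner k u * X u) = inner k e"
  shows "\<exists>k. (\<lambda>j. S (k j)) \<longlonglongrightarrow> J e \<and> (AE u in M. (\<lambda>j. inner (k j) u) \<longlonglongrightarrow> X u)"
proof -
  have "\<exists>k. (\<integral>\<^sup>+u. ennreal ((X u - inner k u)\<^sup>2) \<partial>M) \<le> ennreal ((1/4) ^ j)" for j
    using approx[rule_format, of "(1/4) ^ j"] by (auto intro: less_imp_le)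
  then obtain k where k: "\<And>j. (\<integral>\<^sup>+u. ennreal ((X u - inner (k j) u)\<^sup>2) \<partial>M) \<le> ennreal ((1/4) ^ j)" by metis
  have "AE u in M. summable (\<lambda>j. 2 ^ j * (X u - inner (k j) u)\<^sup>2)"
    by (rule AE_limit_of_fast) (use k in auto)
  then have ae: "AE u in M. (\<lambda>j. inner (k j) u) \<longlonglongrightarrow> X u"
  proof eventually_elim
    case (elim u)
    then have "(\<lambda>j. 2 ^ j * (X u - inner (k j) u)\<^sup>2) \<longlonglongrightarrow> 0" by (rule summable_LIMSEQ_zero)
    then have "(\<lambda>j. (X u - inner (k j) u)\<^sup>2) \<longlonglongrightarrow> 0"
    proof (rule Lim_null_comparison[rotated])
      have "1 * (X u - inner (k j) u)\<^sup>2 \<le> 2 ^ j * (X u - inner (k j) u)\<^sup>2" for j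
        by (rule mult_right_mono) auto
      then show "\<forall>\<^sub>F j in sequentially. norm ((X u - inner (k j) u)\<^sup>2) \<le> 2 ^ j * (X u - inner (k j) u)\<^sup>2" by simp
    qed
    then have "(\<lambda>j. X u - (X u - inner (k j) u)) \<longlonglongrightarrow> X u - 0" by (intro tendsto_intros) simp
    then show ?case by simp
  qed
  have diff: "(norm (S (k i) - S (k j)))\<^sup>2 \<le> 2 * (1/4) ^ i + 2 * (1/4) ^ j" for i j
  proof -
    have "ennreal ((norm (S (k i) - S (k j)))\<^sup>2) = (\<integral>\<^sup>+u. ennreal ((inner (k i - k j) u)\<^sup>2) \<partial>M)"
      by (simp add: nn_second_moment linear_diff[OF linear_S])
    also have "\<dots> \<le> (\<integral>\<^sup>+u. 2 * ennreal ((X u - inner (k i) u)\<^sup>2) + 2 * ennreal ((X u - inner (k j) u)\<^sup>2) \<partial>M)"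
    proof (rule nn_integral_mono)
      fix u
      have "(b - a)\<^sup>2 \<le> 2 * (x - a)\<^sup>2 + 2 * (x - b)\<^sup>2" for a b x :: real
        using zero_le_power2[of "2 * x - a - b"] by (simp add: power2_eq_square algebra_simps)
      from this[of "inner (k i) u" "inner (k j) u" "X u"]
      have "(inner (k i - k j) u)\<^sup>2 \<le> 2 * (X u - inner (k i) u)\<^sup>2 + 2 * (X u - inner (k j) u)\<^sup>2"
        by (simp add: inner_diff_left power2_commute[of "inner (k j) u"] )
      then have "ennreal ((inner (k i - k j) u)\<^sup>2) \<le> ennreal (2 * (X u - inner (k i) u)\<^sup>2 + 2 * (X u - inner (k j) u)\<^sup>2)"
        by (rule ennreal_leI)
      then show "ennreal ((inner (k i - k j) u)\<^sup>2) \<le> 2 * ennreal ((X u - inner (k i) u)\<^sup>2) + 2 * ennreal ((X u - inner (k j) u)\<^sup>2)"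
        by (simp add: ennreal_plus ennreal_mult)
    qed
    also have "\<dots> = 2 * (\<integral>\<^sup>+u. ennreal ((X u - inner (k i) u)\<^sup>2) \<partial>M) + 2 * (\<integral>\<^sup>+u. ennreal ((X u - inner (k j) u)\<^sup>2) \<partial>M)"
      by (subst nn_integral_add) (auto simp: nn_integral_cmult)
    also have "\<dots> \<le> 2 * ennreal ((1/4) ^ i) + 2 * ennreal ((1/4) ^ j)"
      by (intro add_mono mult_left_mono k) auto
    also have "\<dots> = ennreal (2 * (1/4) ^ i + 2 * (1/4) ^ j)" by (simp add: ennreal_plus ennreal_mult)
    finally show ?thesis by (subst (asm) ennreal_le_iff) auto
  qed
  have "Cauchy (\<lambda>j. S (k j))"
  proof (rule CauchyI)
    fix e :: real assume e: "0 < e"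
    have "(\<lambda>j. (1/4) ^ j) \<longlonglongrightarrow> (0::real)" by (rule LIMSEQ_power_zero) simp
    from order_tendstoD(2)[OF this, of "e\<^sup>2 / 4"] e
    obtain N where N: "\<And>j. j \<ge> N \<Longrightarrow> (1/4) ^ j < e\<^sup>2 / 4" by (auto simp: eventually_sequentially)
    have "norm (S (k i) - S (k j)) < e" if "N \<le> i" "N \<le> j" for i j
    proof -
      have "(norm (S (k i) - S (k j)))\<^sup>2 < e\<^sup>2" using diff[of i j] N[OF that(1)] N[OF that(2)] by linarith
      then show ?thesis using e by (simp add: power_less_imp_less_base)
    qed
    then show "\<exists>M. \<forall>m\<ge>M. \<forall>n\<ge>M. norm (S (k m) - S (k n)) < e" by blast
  qed
  then obtain z where z: "(\<lambda>j. S (k j)) \<longlonglongrightarrow> z" using Cauchy_convergent convergent_def by blast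
  have "orth z" unfolding orth_def
  proof (intro allI impI)
    fix y assume "S y = 0"
    then have "inner (S (k j)) y = 0" for j by (simp add: S_selfadjoint)
    then show "inner z y = 0"
      using LIMSEQ_unique[OF tendsto_inner[OF z tendsto_const[of y]]] by simp
  qed
  moreover have "S z = e"
  proof -
    have "inner h (S z) = inner h e" for h
    proof -
      have "(\<lambda>j. inner (S h) (S (k j))) \<longlonglongrightarrow> inner (S h) z" by (intro tendsto_intros z)
      moreover have "(\<lambda>j. inner (S h) (S (k j))) \<longlonglongrightarrow> inner h e"
        using integral_limit[OF X k, of h] cov by (simp add: covariance)
      ultimately show ?thesis using LIMSEQ_unique by (simp add: S_selfadjoint) blast
    qed
    then have "inner (S z - e) (S z - e) = 0" by (simp add: inner_diff_right)
    then show ?thesis by simp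
  qed
  ultimately have "J e = z" by (intro J_eqI)
  then show ?thesis using z ae by blast
qed

lemma ex_cm_functional:
  assumes e: "e \<in> H"
  shows "\<exists>X. X \<in> borel_measurable M \<and>
     (\<forall>\<epsilon>>0. \<exists>k. (\<integral>\<^sup>+u. ennreal ((X u - inner k u)\<^sup>2) \<partial>M) < ennreal \<epsilon>) \<and>
     (\<forall>k. (LINT u|M. inner k u * X u) = inner k e)"
proof -
  have "\<exists>k. norm (S k - J e) < (1/2) ^ j / 2" for j :: nat
    by (rule orth_approx[OF J(2)[OF e]]) simp
  then obtain k where k: "\<And>j. norm (S (k j) - J e) < (1/2) ^ j / 2" by metis
  have Slim: "(\<lambda>j. S (k j)) \<longlonglongrightarrow> J e"
  proof (rule LIM_zero_cancel, rule Lim_null_comparison)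
    show "\<forall>\<^sub>F j in sequentially. norm (S (k j) - J e) \<le> (1/2) ^ j / 2"
      by (intro always_eventually allI less_imp_le k)
    show "(\<lambda>j. (1/2) ^ j / 2 :: real) \<longlonglongrightarrow> 0"
      using tendsto_divide[OF LIMSEQ_power_zero[of "1/2::real"] tendsto_const[of 2]] by simp
  qed
  define f where "f j u = inner (k (Suc j) - k j) u" for j u
  have fm [measurable]: "f j \<in> borel_measurable M" for j unfolding f_def by measurable
  have "(\<integral>\<^sup>+u. ennreal ((f j u)\<^sup>2) \<partial>M) \<le> ennreal ((1/4) ^ j)" for j
  proof -
    have "norm (S (k (Suc j) - k j)) \<le> norm (S (k (Suc j)) - J e) + norm (S (k j) - J e)"
      using norm_triangle_ineq4[of "S (k (Suc j)) - J e" "S (k j) - J e"] by (simp add: linear_diff[OF linear_S])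
    also have "\<dots> \<le> (1/2) ^ j" using k[of j] k[of "Suc j"] norm_ge_zero[of "S (k j) - J e"] unfolding power_Suc by linarith
    finally have "(norm (S (k (Suc j) - k j)))\<^sup>2 \<le> ((1/2) ^ j)\<^sup>2" by (intro power_mono) auto
    also have "\<dots> = (1/4) ^ j" by (simp add: power2_eq_square flip: power_mult_distrib)
    finally show ?thesis unfolding f_def nn_second_moment by (rule ennreal_leI)
  qed
  then have "AE u in M. summable (\<lambda>j. 2 ^ j * (f j u)\<^sup>2)" by (intro AE_limit_of_fast fm)
  then have conv: "AE u in M. convergent (\<lambda>j. inner (k j) u)"
  proof eventually_elim
    case (elim u)
    have "summable (\<lambda>j. f j u)"
    proof (rule summable_comparison_test')
      show "summable (\<lambda>j. 2 ^ j * (f j u)\<^sup>2 + (1/2) ^ j)" by (intro summable_add elim summable_geometric) simp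
      fix j
      define t :: real where "t = 2 ^ j"
      have t: "t > 0" by (simp add: t_def)
      have "2 * (t * \<bar>f j u\<bar>) \<le> (t * \<bar>f j u\<bar>)\<^sup>2 + 1" using zero_le_power2[of "t * \<bar>f j u\<bar> - 1"] unfolding power2_diff by simp
      moreover have "0 \<le> t * \<bar>f j u\<bar>" using t by simp
      moreover have "(t * \<bar>f j u\<bar>)\<^sup>2 + 1 = t * (t * (f j u)\<^sup>2 + 1 / t)"
        using t by (simp add: power_mult_distrib distrib_left power2_eq_square)
      ultimately have "t * \<bar>f j u\<bar> \<le> t * (t * (f j u)\<^sup>2 + 1 / t)" by linarith
      then have "\<bar>f j u\<bar> \<le> t * (f j u)\<^sup>2 + 1 / t" using t by simp
      then show "norm (f j u) \<le> 2 ^ j * (f j u)\<^sup>2 + (1/2) ^ j" by (simp add: t_def power_one_over)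
    qed
    then have "convergent (\<lambda>n. \<Sum>j<n. f j u)" by (simp add: summable_iff_convergent)
    then have "convergent (\<lambda>n. inner (k 0) u + (\<Sum>j<n. f j u))" by (intro convergent_add convergent_const)
    moreover have "inner (k 0) u + (\<Sum>j<n. f j u) = inner (k n) u" for n
      by (induction n) (simp_all add: f_def inner_diff_left)
    ultimately show ?case by simp
  qed
  define X where "X u = lim (\<lambda>j. inner (k j) u)" for u
  have X [measurable]: "X \<in> borel_measurable M" unfolding X_def by measurable
  have ae: "AE u in M. (\<lambda>j. inner (k j) u) \<longlonglongrightarrow> X u"
    using conv by eventually_elim (simp add: X_def convergent_LIMSEQ_iff)
  have dist: "(\<integral>\<^sup>+u. ennreal ((X u - inner (k j) u)\<^sup>2) \<partial>M) \<le> ennreal ((1/4) ^ j)" for j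
  proof -
    have "(\<integral>\<^sup>+u. ennreal ((X u - inner (k j) u)\<^sup>2) \<partial>M) \<le> ennreal ((norm (J e - S (k j)))\<^sup>2)"
    proof (rule second_moment_limit[where q = "\<lambda>i. k i - k j"])
      show "AE u in M. (\<lambda>i. inner (k i - k j) u) \<longlonglongrightarrow> X u - inner (k j) u"
        using ae by eventually_elim (auto simp: inner_diff_left intro: tendsto_intros)
      show "(\<lambda>i. S (k i - k j)) \<longlonglongrightarrow> J e - S (k j)"
        unfolding linear_diff[OF linear_S] by (intro tendsto_intros Slim)
    qed auto
    also have "\<dots> \<le> ennreal ((1/4) ^ j)"
    proof (rule ennreal_leI)
      have "norm (J e - S (k j)) \<le> (1/2) ^ j / 2" using k[of j] by (simp add: norm_minus_commute)
      also have "\<dots> \<le> (1/2) ^ j" by simp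
      finally have "(norm (J e - S (k j)))\<^sup>2 \<le> ((1/2) ^ j)\<^sup>2" by (intro power_mono) auto
      also have "\<dots> = (1/4) ^ j" by (simp add: power2_eq_square flip: power_mult_distrib)
      finally show "(norm (J e - S (k j)))\<^sup>2 \<le> (1/4) ^ j" .
    qed
    finally show ?thesis .
  qed
  show ?thesis
  proof (intro exI[of _ X] conjI allI impI X)
    fix \<epsilon> :: real assume \<epsilon>: "0 < \<epsilon>"
    have "(\<lambda>j. (1/4) ^ j) \<longlonglongrightarrow> (0::real)" by (rule LIMSEQ_power_zero) simp
    from order_tendstoD(2)[OF this \<epsilon>] obtain j where "(1/4) ^ j < \<epsilon>" by (auto simp: eventually_sequentially)
    then have "(\<integral>\<^sup>+u. ennreal ((X u - inner (k j) u)\<^sup>2) \<partial>M) < ennreal \<epsilon>"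
      by (intro order_le_less_trans[OF dist[of j]]) (simp add: ennreal_lessI \<epsilon>)
    then show "\<exists>k. (\<integral>\<^sup>+u. ennreal ((X u - inner k u)\<^sup>2) \<partial>M) < ennreal \<epsilon>" ..
  next
    fix h
    have "(\<lambda>j. inner (S h) (S (k j))) \<longlonglongrightarrow> inner (S h) (J e)" by (intro tendsto_intros Slim)
    moreover have "(\<lambda>j. inner (S h) (S (k j))) \<longlonglongrightarrow> (LINT u|M. inner h u * X u)"
      using integral_limit[OF X dist, of h] by (simp add: covariance)
    ultimately show "(LINT u|M. inner h u * X u) = inner h e"
      using LIMSEQ_unique inner_S_J[OF e] by metis
  qed
qed

lemma cm_functional:
  assumes "e \<in> H"
  shows "cm_functional M e \<in> borel_measurable M"
    and "\<exists>k. (\<lambda>j. S (k j)) \<longlonglongrightarrow> J e \<and> (AE u in M. (\<lambda>j. inner (k j) u) \<longlonglongrightarrow> cm_functional M e u)"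
proof -
  note * = someI_ex[OF ex_cm_functional[OF assms], folded cm_functional_def]
  show "cm_functional M e \<in> borel_measurable M" using * by blast
  show "\<exists>k. (\<lambda>j. S (k j)) \<longlonglongrightarrow> J e \<and> (AE u in M. (\<lambda>j. inner (k j) u) \<longlonglongrightarrow> cm_functional M e u)"
    using * by (intro cm_sequence) blast+
qed

lemma cm_functional_sum:
  assumes E: "finite E" "E \<subseteq> H" and v: "v = (\<Sum>e\<in>E. a e *\<^sub>R e)"
  shows "AE u in M. (\<Sum>e\<in>E. a e * cm_functional M e u) = cm_functional M v u"
proof -
  have vH: "v \<in> H" unfolding v using E(2) by (auto intro!: subspace_sum[OF subspace_H] subspace_scale[OF subspace_H])
  obtain k where k: "\<And>e. e \<in> H \<Longrightarrow> (\<lambda>j. S (k e j)) \<longlonglongrightarrow> J e"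
    "\<And>e. e \<in> H \<Longrightarrow> AE u in M. (\<lambda>j. inner (k e j) u) \<longlonglongrightarrow> cm_functional M e u"
    using cm_functional(2) by metis
  define Y where "Y u = (\<Sum>e\<in>E. a e * cm_functional M e u) - cm_functional M v u" for u
  have [measurable]: "cm_functional M e \<in> borel_measurable M" if "e \<in> H" for e by (rule cm_functional(1)[OF that])
  have Y [measurable]: "Y \<in> borel_measurable M"
    unfolding Y_def using E vH by (intro borel_measurable_diff borel_measurable_sum borel_measurable_times) auto
  define q where "q j = (\<Sum>e\<in>E. a e *\<^sub>R k e j) - k v j" for j
  have "(\<integral>\<^sup>+u. ennreal ((Y u)\<^sup>2) \<partial>M) \<le> ennreal ((norm (0::'a))\<^sup>2)"
  proof (rule second_moment_limit[OF Y, of q])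
    have "AE u in M. \<forall>e\<in>E. (\<lambda>j. inner (k e j) u) \<longlonglongrightarrow> cm_functional M e u"
      using E k(2) by (intro AE_finite_allI) auto
    then show "AE u in M. (\<lambda>j. inner (q j) u) \<longlonglongrightarrow> Y u"
      using k(2)[OF vH]
    proof eventually_elim
      case (elim u)
      then show ?case unfolding Y_def q_def inner_diff_left inner_sum_left inner_scaleR_left
        by (intro tendsto_intros) auto
    qed
    have "(\<lambda>j. S (q j)) \<longlonglongrightarrow> (\<Sum>e\<in>E. a e *\<^sub>R J e) - J v"
      unfolding q_def linear_diff[OF linear_S] linear_sum[OF linear_S] linear_scale[OF linear_S]
      using E k(1) vH by (intro tendsto_intros) auto
    moreover have "J v = (\<Sum>e\<in>E. a e *\<^sub>R J e)"
    proof -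
      have "J v = (\<Sum>e\<in>E. J (a e *\<^sub>R e))" unfolding v
        by (rule J_sum) (use E(2) in \<open>auto intro: subspace_scale[OF subspace_H]\<close>)
      also have "\<dots> = (\<Sum>e\<in>E. a e *\<^sub>R J e)" by (rule sum.cong) (use E(2) in \<open>auto intro: J_scale\<close>)
      finally show ?thesis .
    qed
    ultimately show "(\<lambda>j. S (q j)) \<longlonglongrightarrow> 0" by simp
  qed
  then have "(\<integral>\<^sup>+u. ennreal ((Y u)\<^sup>2) \<partial>M) = 0" by simp
  then have "AE u in M. ennreal ((Y u)\<^sup>2) = 0" by (subst (asm) nn_integral_0_iff_AE) auto
  then show ?thesis by eventually_elim (simp add: Y_def)
qed

end

section \<open>Splitting off finitely many Gaussian coordinates\<close>

definition gauss_n :: "nat \<Rightarrow> (nat \<Rightarrow> real) measure" where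
  "gauss_n m = density (lborel_n m) (\<lambda>x. ennreal (\<Prod>i<m. std_normal_density (x i)))"

lemma sets_gauss_n [simp, measurable_cong]: "sets (gauss_n m) = sets (lborel_n m)"
  by (simp add: gauss_n_def)

lemma measurable_std_normal_prod:
  "(\<lambda>x. \<Prod>i<m. std_normal_density (x i)) \<in> borel_measurable (lborel_n m)"
  by (rule borel_measurable_prod) (auto intro!: measurable_compose[OF measurable_coord])

lemma prob_space_gauss_n: "prob_space (gauss_n m)"
proof (rule prob_spaceI)
  have "emeasure (gauss_n m) (space (gauss_n m)) = (\<integral>\<^sup>+x. ennreal (\<Prod>i<m. std_normal_density (x i)) \<partial>lborel_n m)"
    unfolding gauss_n_def using measurable_std_normal_prod
    by (subst emeasure_density) (auto intro!: nn_integral_cong)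
  also have "\<dots> = (\<integral>\<^sup>+x. (\<Prod>i<m. ennreal (std_normal_density (x i))) \<partial>lborel_n m)"
    by (simp add: prod_ennreal)
  also have "\<dots> = (\<Prod>i<m. \<integral>\<^sup>+y. ennreal (std_normal_density y) \<partial>lborel)"
    by (rule lborel_product.product_nn_integral_prod) auto
  also have "(\<integral>\<^sup>+y. ennreal (std_normal_density y) \<partial>lborel) = 1"
    using prob_space.emeasure_space_1[OF prob_space_normal_density[of 1 0]] by (simp add: emeasure_density)
  finally show "emeasure (gauss_n m) (space (gauss_n m)) = 1" by simp
qed

lemma char_gauss_n:
  "(CLINT x|gauss_n m. iexp (\<Sum>i<m. a i * x i)) = complex_of_real (exp (- (\<Sum>i<m. (a i)\<^sup>2) / 2))"
proof -
  have m[measurable]: "(\<lambda>x. \<Sum>i<m. a i * x i) \<in> borel_measurable (lborel_n m)"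
    by (intro borel_measurable_sum borel_measurable_times borel_measurable_const measurable_coord) auto
  have int: "integrable lborel (\<lambda>y. std_normal_density y *\<^sub>R iexp (c * y))" for c
  proof -
    interpret N: prob_space std_normal_distribution by (rule prob_space_normal_density) simp
    have "integrable std_normal_distribution (\<lambda>y. iexp (c * y))"
      by (rule N.integrable_const_bound[of _ 1]) auto
    then show ?thesis by (subst (asm) integrable_density) auto
  qed
  have one: "(CLINT y|lborel. std_normal_density y *\<^sub>R iexp (c * y)) = complex_of_real (exp (- c\<^sup>2 / 2))" for c
  proof -
    have "char std_normal_distribution c = (CLINT y|lborel. std_normal_density y *\<^sub>R iexp (c * y))"
      unfolding char_def by (rule integral_density) auto
    then show ?thesis by (simp add: char_std_normal_distribution)
  qed
  have "(CLINT x|gauss_n m. iexp (\<Sum>i<m. a i * x i))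
      = (CLINT x|lborel_n m. (\<Prod>i<m. std_normal_density (x i)) *\<^sub>R iexp (\<Sum>i<m. a i * x i))"
    unfolding gauss_n_def by (rule integral_density) (use measurable_std_normal_prod in \<open>auto intro!: prod_nonneg AE_I2\<close>)
  also have "\<dots> = (CLINT x|lborel_n m. (\<Prod>i<m. std_normal_density (x i) *\<^sub>R iexp (a i * x i)))"
    by (rule Bochner_Integration.integral_cong) (auto simp: scaleR_conv_of_real prod.distrib exp_sum sum_distrib_left)
  also have "\<dots> = (\<Prod>i<m. CLINT y|lborel. std_normal_density y *\<^sub>R iexp (a i * y))"
    by (rule lborel_product.product_integral_prod) (use int in auto)
  also have "\<dots> = complex_of_real (\<Prod>i<m. exp (- (a i)\<^sup>2 / 2))"
    unfolding one by simp
  also have "(\<Prod>i<m. exp (- (a i)\<^sup>2 / 2)) = exp (- (\<Sum>i<m. (a i)\<^sup>2) / 2)"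
    by (simp add: exp_sum[symmetric] sum_negf sum_divide_distrib)
  finally show ?thesis .
qed

context gaussian_measure
begin

definition approx_seq :: "'a \<Rightarrow> nat \<Rightarrow> 'a" where
  "approx_seq e = (SOME k. (\<lambda>j. S (k j)) \<longlonglongrightarrow> J e \<and> (AE u in M. (\<lambda>j. inner (k j) u) \<longlonglongrightarrow> cm_functional M e u))"

lemma approx_seq:
  assumes "e \<in> H"
  shows "(\<lambda>j. S (approx_seq e j)) \<longlonglongrightarrow> J e"
    and "AE u in M. (\<lambda>j. inner (approx_seq e j) u) \<longlonglongrightarrow> cm_functional M e u"
  using someI_ex[OF cm_functional(2)[OF assms], folded approx_seq_def] by auto

text \<open>
  A version of \<open>cm_functional M e\<close> that is exactly additive on the linear set \<open>good E\<close> of full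
  measure, which contains the Cameron--Martin space.
\<close>

definition coord :: "'a \<Rightarrow> 'a \<Rightarrow> real" where
  "coord e u = lim (\<lambda>j. inner (approx_seq e j) u)"

definition good :: "'a set \<Rightarrow> 'a set" where
  "good E = {u. \<forall>e\<in>E. convergent (\<lambda>j. inner (approx_seq e j) u)}"

lemma measurable_coord' [measurable]: "coord e \<in> borel_measurable borel"
  unfolding coord_def by measurable

lemma coord_lim: "u \<in> good E \<Longrightarrow> e \<in> E \<Longrightarrow> (\<lambda>j. inner (approx_seq e j) u) \<longlonglongrightarrow> coord e u"
  by (simp add: good_def coord_def convergent_LIMSEQ_iff)

lemma AE_coord:
  assumes E: "finite E" "E \<subseteq> H"
  shows "AE u in M. u \<in> good E \<and> (\<forall>e\<in>E. cm_functional M e u = coord e u)"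
proof -
  have "AE u in M. \<forall>e\<in>E. (\<lambda>j. inner (approx_seq e j) u) \<longlonglongrightarrow> cm_functional M e u"
    using E approx_seq(2) by (intro AE_finite_allI) auto
  then show ?thesis
  proof eventually_elim
    case (elim u)
    then show ?case by (auto simp: good_def coord_def convergent_def limI)
  qed
qed

lemma good_add:
  assumes E: "E \<subseteq> H" and u: "u \<in> good E" and h: "h \<in> H"
  shows "u + h \<in> good E" and "e \<in> E \<Longrightarrow> coord e (u + h) = coord e u + cm_inner C h e"
proof -
  have lim: "(\<lambda>j. inner (approx_seq e j) (u + h)) \<longlonglongrightarrow> coord e u + cm_inner C h e" if "e \<in> E" for e
  proof -
    have "(\<lambda>j. inner (S (approx_seq e j)) (J h)) \<longlonglongrightarrow> inner (J e) (J h)"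
      using that E by (intro tendsto_intros approx_seq) auto
    then have "(\<lambda>j. inner (approx_seq e j) h) \<longlonglongrightarrow> cm_inner C h e"
      unfolding inner_S_J[OF h] cm_inner_def by (simp add: inner_commute)
    then show ?thesis unfolding inner_add_right by (intro tendsto_add coord_lim[OF u that])
  qed
  then show "u + h \<in> good E" by (auto simp: good_def convergent_def)
  show "e \<in> E \<Longrightarrow> coord e (u + h) = coord e u + cm_inner C h e"
    unfolding coord_def[of e "u + h"] by (rule limI[OF lim])
qed

end

locale gaussian_frame = gaussian_measure C M for C :: "'a::{real_inner, polish_space} \<Rightarrow> 'a" and M +
  fixes E :: "'a set" and m :: nat and e :: "nat \<Rightarrow> 'a"
  assumes orthonormal: "cm_orthonormal C E" and enum: "bij_betw e {..<m} E"
begin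

lemma finite_E: "finite E" and E_H: "E \<subseteq> H"
  using orthonormal by (auto simp: cm_orthonormal_def)

lemma e_E: "i < m \<Longrightarrow> e i \<in> E"
  using enum by (auto simp: bij_betw_def)

lemma e_H: "i < m \<Longrightarrow> e i \<in> H"
  using e_E E_H by auto

lemma sum_E: "(\<Sum>x\<in>E. g x) = (\<Sum>i<m. g (e i))"
  by (rule sum.reindex_bij_betw[OF enum, symmetric])

lemma e_inner: "i < m \<Longrightarrow> j < m \<Longrightarrow> cm_inner C (e i) (e j) = (if i = j then 1 else 0)"
  using orthonormal e_E enum by (auto simp: cm_orthonormal_def bij_betw_def inj_on_def)

definition embed :: "(nat \<Rightarrow> real) \<Rightarrow> 'a" where
  "embed x = (\<Sum>i<m. x i *\<^sub>R e i)"

definition proj :: "'a \<Rightarrow> 'a" where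
  "proj u = u - embed (\<lambda>i. coord (e i) u)"

lemma embed_H: "embed x \<in> H"
  unfolding embed_def by (intro subspace_sum[OF subspace_H] subspace_scale[OF subspace_H]) (simp add: e_H)

lemma embed_span: "embed x \<in> span E"
  unfolding embed_def by (intro span_sum span_scale span_base) (simp add: e_E)

lemma cm_inner_embed: "i < m \<Longrightarrow> cm_inner C (embed x) (e i) = x i"
proof -
  assume i: "i < m"
  have "cm_inner C (embed x) (e i) = (\<Sum>j<m. x j * cm_inner C (e j) (e i))"
    unfolding embed_def
    by (subst cm_inner_sum) (auto intro!: sum.cong cm_inner_scale subspace_scale[OF subspace_H] e_H)
  also have "\<dots> = (\<Sum>j<m. if j = i then x j else 0)"
    by (rule sum.cong) (use e_inner i in auto)
  finally show ?thesis using i by simp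
qed

lemma measurable_embed [measurable]: "embed \<in> borel_measurable (lborel_n m)"
  unfolding embed_def by (intro borel_measurable_sum borel_measurable_scaleR borel_measurable_const measurable_coord) auto

lemma measurable_proj [measurable]: "proj \<in> borel_measurable borel"
  unfolding proj_def embed_def by measurable

lemma char_proj:
  "(CLINT u|M. iexp (inner h (proj u))) = complex_of_real (exp (- ((norm (S h))\<^sup>2 - (\<Sum>i<m. (inner h (e i))\<^sup>2)) / 2))"
proof -
  define q where "q j = h - (\<Sum>i<m. inner h (e i) *\<^sub>R approx_seq (e i) j)" for j
  define z where "z = S h - (\<Sum>i<m. inner h (e i) *\<^sub>R J (e i))"
  have "(CLINT u|M. iexp (inner h (proj u))) = complex_of_real (exp (- (norm z)\<^sup>2 / 2))"
  proof (rule char_limit[of _ q])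
    show "AE u in M. (\<lambda>j. inner (q j) u) \<longlonglongrightarrow> inner h (proj u)"
      using AE_coord[OF finite_E E_H]
    proof eventually_elim
      case (elim u)
      then have "(\<lambda>j. inner (q j) u) \<longlonglongrightarrow> inner h u - (\<Sum>i<m. inner h (e i) * coord (e i) u)"
        unfolding q_def inner_diff_left inner_sum_left inner_scaleR_left
        by (intro tendsto_intros coord_lim[of u E]) (auto simp: e_E)
      then show ?case
        by (simp add: proj_def embed_def inner_diff_right inner_sum_right mult.commute)
    qed
    show "(\<lambda>j. S (q j)) \<longlonglongrightarrow> z"
      unfolding q_def z_def linear_diff[OF linear_S] linear_sum[OF linear_S] linear_scale[OF linear_S]
      by (intro tendsto_intros approx_seq) (simp add: e_H)
  qed measurable
  also have "(norm z)\<^sup>2 = (norm (S h))\<^sup>2 - (\<Sum>i<m. (inner h (e i))\<^sup>2)"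
  proof -
    let ?b = "\<Sum>i<m. inner h (e i) *\<^sub>R J (e i)"
    have "inner ?b ?b = (\<Sum>i<m. inner h (e i) * (\<Sum>j<m. inner h (e j) * inner (J (e i)) (J (e j))))"
      by (auto simp: inner_sum_left inner_sum_right sum_distrib_left inner_commute intro!: sum.cong)
    also have "\<dots> = (\<Sum>i<m. inner h (e i) * (\<Sum>j<m. if i = j then inner h (e i) else 0))"
      by (intro sum.cong refl arg_cong2[where f = "(*)"]) (auto simp: e_inner[unfolded cm_inner_def])
    finally have bb: "inner ?b ?b = (\<Sum>i<m. (inner h (e i))\<^sup>2)" by (simp add: power2_eq_square)
    have "inner (S h) ?b = (\<Sum>i<m. (inner h (e i))\<^sup>2)"
      by (simp add: inner_sum_right power2_eq_square inner_S_J e_H)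
    then show ?thesis
      unfolding z_def power2_norm_eq_inner using bb by (simp add: inner_diff_left inner_diff_right inner_commute)
  qed
  finally show ?thesis .
qed

theorem gaussian_decomposition:
  "distr (M \<Otimes>\<^sub>M gauss_n m) borel (\<lambda>(u, x). proj u + embed x) = M"
proof -
  interpret G: prob_space "gauss_n m" by (rule prob_space_gauss_n)
  interpret P: pair_prob_space M "gauss_n m" ..
  have [measurable]: "(\<lambda>p. embed (snd p)) \<in> borel_measurable (M \<Otimes>\<^sub>M gauss_n m)"
    by (rule measurable_compose[OF measurable_snd]) measurable
  have map[measurable]: "(\<lambda>(u, x). proj u + embed x) \<in> borel_measurable (M \<Otimes>\<^sub>M gauss_n m)"
    unfolding split_def by measurable
  show ?thesis
  proof (rule measure_eq_of_characteristic_functional)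
    show "prob_space (distr (M \<Otimes>\<^sub>M gauss_n m) borel (\<lambda>(u, x). proj u + embed x))"
      by (rule P.prob_space_distr[OF map])
    show "prob_space M" by (rule prob_space_axioms)
    fix h
    have emb: "inner h (embed x) = (\<Sum>i<m. inner h (e i) * x i)" for x
      by (simp add: embed_def inner_sum_right mult.commute)
    have "(CLINT v|distr (M \<Otimes>\<^sub>M gauss_n m) borel (\<lambda>(u, x). proj u + embed x). iexp (inner h v))
        = (CLINT p|M \<Otimes>\<^sub>M gauss_n m. iexp (inner h (proj (fst p))) * iexp (inner h (embed (snd p))))"
      by (subst integral_distr[OF map]) (auto simp: split_def inner_add_right exp_add ring_distribs)
    also have "\<dots> = (CLINT u|M. CLINT x|gauss_n m. iexp (inner h (proj u)) * iexp (inner h (embed x)))"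
    proof -
      have "integrable (M \<Otimes>\<^sub>M gauss_n m) (\<lambda>p. iexp (inner h (proj (fst p))) * iexp (inner h (embed (snd p))))"
        by (rule P.integrable_const_bound[of _ 1]) (auto simp: norm_mult)
      from P.integral_fst'[OF this] show ?thesis by simp
    qed
    also have "\<dots> = (CLINT u|M. iexp (inner h (proj u))) * (CLINT x|gauss_n m. iexp (inner h (embed x)))"
      by simp
    also have "\<dots> = complex_of_real (exp (- ((norm (S h))\<^sup>2 - (\<Sum>i<m. (inner h (e i))\<^sup>2)) / 2) * exp (- (\<Sum>i<m. (inner h (e i))\<^sup>2) / 2))"
      unfolding char_proj emb char_gauss_n by simp
    also have "\<dots> = complex_of_real (exp (- (norm (S h))\<^sup>2 / 2))"
      by (simp add: exp_add[symmetric] diff_divide_distrib)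
    finally show "(CLINT v|distr (M \<Otimes>\<^sub>M gauss_n m) borel (\<lambda>(u, x). proj u + embed x). iexp (inner h v))
        = (CLINT u|M. iexp (inner h u))" unfolding char_M .
  qed auto
qed

lemma nn_integral_decomposition:
  assumes [measurable]: "\<phi> \<in> borel_measurable borel"
  shows "(\<integral>\<^sup>+u. \<phi> u \<partial>M) = (\<integral>\<^sup>+u. (\<integral>\<^sup>+x. \<phi> (proj u + embed x) \<partial>gauss_n m) \<partial>M)"
proof -
  interpret G: prob_space "gauss_n m" by (rule prob_space_gauss_n)
  have [measurable]: "(\<lambda>p. embed (snd p)) \<in> borel_measurable (M \<Otimes>\<^sub>M gauss_n m)"
    by (rule measurable_compose[OF measurable_snd]) measurable
  have map[measurable]: "(\<lambda>(u, x). proj u + embed x) \<in> borel_measurable (M \<Otimes>\<^sub>M gauss_n m)"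
    unfolding split_def by measurable
  have "(\<integral>\<^sup>+u. \<phi> u \<partial>M) = (\<integral>\<^sup>+v. \<phi> v \<partial>distr (M \<Otimes>\<^sub>M gauss_n m) borel (\<lambda>(u, x). proj u + embed x))"
    unfolding gaussian_decomposition ..
  also have "\<dots> = (\<integral>\<^sup>+p. \<phi> (proj (fst p) + embed (snd p)) \<partial>(M \<Otimes>\<^sub>M gauss_n m))"
    by (subst nn_integral_distr[OF map]) (auto simp: split_def)
  also have "\<dots> = (\<integral>\<^sup>+u. (\<integral>\<^sup>+x. \<phi> (proj u + embed x) \<partial>gauss_n m) \<partial>M)"
    by (subst G.nn_integral_fst[symmetric]) auto
  finally show ?thesis .
qed

end

section \<open>Determinants on finite-dimensional subspaces\<close>

definition list_mat :: "'a::real_vector list \<Rightarrow> ('a \<Rightarrow> 'a) \<Rightarrow> real mat" where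
  "list_mat b A = Matrix.mat (length b) (length b) (\<lambda>(i, j). representation (set b) (A (b ! j)) (b ! i))"

lemma list_mat_carrier [simp]: "list_mat b A \<in> carrier_mat (length b) (length b)"
  by (simp add: list_mat_def)

lemma sum_list_representation:
  fixes b :: "'a::real_vector list"
  assumes "distinct b" "independent (set b)" "v \<in> span (set b)"
  shows "(\<Sum>k<length b. representation (set b) v (b ! k) *\<^sub>R b ! k) = v"
proof -
  have "(\<Sum>k<length b. representation (set b) v (b ! k) *\<^sub>R b ! k) = (\<Sum>x\<in>set b. representation (set b) v x *\<^sub>R x)"
    by (rule sum.reindex_bij_betw[OF bij_betw_nth]) (use assms in auto)
  also have "\<dots> = v"
    by (rule real_vector.sum_representation_eq) (use assms in auto)
  finally show ?thesis .
qed

lemma representation_sum_scale: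
  fixes B :: "'a::real_vector set"
  assumes B: "independent B" and w: "\<And>k. k \<in> I \<Longrightarrow> w k \<in> span B"
  shows "representation B (\<Sum>k\<in>I. c k *\<^sub>R w k) x = (\<Sum>k\<in>I. c k * representation B (w k) x)"
proof -
  have "representation B (\<Sum>k\<in>I. c k *\<^sub>R w k) = (\<lambda>x. \<Sum>k\<in>I. representation B (c k *\<^sub>R w k) x)"
    by (rule real_vector.representation_sum[OF B]) (simp add: span_scale w)
  moreover have "representation B (c k *\<^sub>R w k) x = c k * representation B (w k) x" if "k \<in> I" for k
    using real_vector.representation_scale[OF B w[OF that], of "c k"] by (simp add: fun_eq_iff)
  ultimately show ?thesis by (auto intro!: sum.cong)
qed

lemma det_list_mat_basis_change:
  fixes b b' :: "'a::real_vector list"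
  assumes b: "distinct b" "independent (set b)" and b': "distinct b'" "independent (set b')"
    and sp: "span (set b) = span (set b')" and A: "linear A" and inv: "A ` span (set b) \<subseteq> span (set b)"
  shows "Determinant.det (list_mat b A) = Determinant.det (list_mat b' A)"
proof -
  obtain f where "bij_betw f (set b) (set b')"
    using bij_if_span_eq_span_bases[OF b(2) b'(2) sp] by blast
  then have n: "length b' = length b"
    using b(1) b'(1) by (metis bij_betw_same_card distinct_card)
  define n where "n = length b"
  have len: "length b = n" "length b' = n" using n by (auto simp: n_def)
  have sb: "b ! i \<in> span (set b)" if "i < n" for i using that len by (intro span_base) simp
  have sb': "b' ! i \<in> span (set b)" if "i < n" for i unfolding sp using that len by (intro span_base) simp
  define Q where "Q = Matrix.mat n n (\<lambda>(i, j). representation (set b) (b' ! j) (b ! i))"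
  define Q' where "Q' = Matrix.mat n n (\<lambda>(i, j). representation (set b') (b ! j) (b' ! i))"
  let ?M = "list_mat b A" and ?M' = "list_mat b' A"
  have car: "Q \<in> carrier_mat n n" "Q' \<in> carrier_mat n n" "?M \<in> carrier_mat n n" "?M' \<in> carrier_mat n n"
    using list_mat_carrier[of b A] list_mat_carrier[of b' A] len by (auto simp: Q_def Q'_def)
  have QQ': "Q * Q' = 1\<^sub>m n"
  proof (rule eq_matI)
    fix i j assume "i < dim_row (1\<^sub>m n :: real mat)" "j < dim_col (1\<^sub>m n :: real mat)"
    then have ij: "i < n" "j < n" by auto
    have "(Q * Q') $$ (i, j) = (\<Sum>k<n. representation (set b') (b ! j) (b' ! k) * representation (set b) (b' ! k) (b ! i))"
      using ij by (simp add: Q_def Q'_def scalar_prod_def lessThan_atLeast0 mult.commute)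
    also have "\<dots> = representation (set b) (\<Sum>k<n. representation (set b') (b ! j) (b' ! k) *\<^sub>R b' ! k) (b ! i)"
      by (rule representation_sum_scale[OF b(2), symmetric]) (simp add: sb')
    also have "(\<Sum>k<n. representation (set b') (b ! j) (b' ! k) *\<^sub>R b' ! k) = b ! j"
      using sum_list_representation[OF b', of "b ! j"] sb[OF ij(2)] sp len by simp
    also have "representation (set b) (b ! j) (b ! i) = 1\<^sub>m n $$ (i, j)"
      using ij len b by (simp add: real_vector.representation_basis nth_eq_iff_index_eq)
    finally show "(Q * Q') $$ (i, j) = 1\<^sub>m n $$ (i, j)" .
  qed (use car in auto)
  have MQ: "?M * Q = Q * ?M'"
  proof (rule eq_matI)
    fix i j assume "i < dim_row (Q * ?M')" "j < dim_col (Q * ?M')"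
    then have ij: "i < n" "j < n" using car by auto
    have Ab: "A v \<in> span (set b)" if "v \<in> span (set b)" for v using inv that by auto
    have "(?M * Q) $$ (i, j) = (\<Sum>k<n. representation (set b) (b' ! j) (b ! k) * representation (set b) (A (b ! k)) (b ! i))"
      using ij len by (simp add: list_mat_def Q_def scalar_prod_def lessThan_atLeast0 mult.commute)
    also have "\<dots> = representation (set b) (\<Sum>k<n. representation (set b) (b' ! j) (b ! k) *\<^sub>R A (b ! k)) (b ! i)"
      by (rule representation_sum_scale[OF b(2), symmetric]) (simp add: sb Ab)
    also have "(\<Sum>k<n. representation (set b) (b' ! j) (b ! k) *\<^sub>R A (b ! k)) = A (\<Sum>k<n. representation (set b) (b' ! j) (b ! k) *\<^sub>R b ! k)"
      by (simp add: linear_sum[OF A] linear_scale[OF A])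
    also have "(\<Sum>k<n. representation (set b) (b' ! j) (b ! k) *\<^sub>R b ! k) = b' ! j"
      using sum_list_representation[OF b, of "b' ! j"] sb'[OF ij(2)] len by simp
    finally have 1: "(?M * Q) $$ (i, j) = representation (set b) (A (b' ! j)) (b ! i)" .
    have "(Q * ?M') $$ (i, j) = (\<Sum>k<n. representation (set b') (A (b' ! j)) (b' ! k) * representation (set b) (b' ! k) (b ! i))"
      using ij len by (simp add: list_mat_def Q_def scalar_prod_def lessThan_atLeast0 mult.commute)
    also have "\<dots> = representation (set b) (\<Sum>k<n. representation (set b') (A (b' ! j)) (b' ! k) *\<^sub>R b' ! k) (b ! i)"
      by (rule representation_sum_scale[OF b(2), symmetric]) (simp add: sb')
    also have "(\<Sum>k<n. representation (set b') (A (b' ! j)) (b' ! k) *\<^sub>R b' ! k) = A (b' ! j)"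
      using sum_list_representation[OF b', of "A (b' ! j)"] Ab[OF sb'[OF ij(2)]] sp len by simp
    finally show "(?M * Q) $$ (i, j) = (Q * ?M') $$ (i, j)" using 1 by simp
  qed (use car in auto)
  have "Determinant.det Q * Determinant.det Q' = 1"
    using det_mult[OF car(1,2)] QQ' by simp
  then have "Determinant.det Q \<noteq> 0" by auto
  moreover have "Determinant.det ?M * Determinant.det Q = Determinant.det Q * Determinant.det ?M'"
    using det_mult[OF car(3,1)] det_mult[OF car(1,4)] MQ by metis
  ultimately show ?thesis by simp
qed

lemma det_on_eq:
  assumes b: "distinct b" "independent (set b)" "span (set b) = V" and A: "linear A" "A ` V \<subseteq> V"
  shows "det_on V A = Determinant.det (list_mat b A)"
proof -
  define c where "c = (SOME b. distinct b \<and> independent (set b) \<and> span (set b) = V)"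
  have c: "distinct c \<and> independent (set c) \<and> span (set c) = V"
    unfolding c_def by (rule someI_ex) (use b in blast)
  have "det_on V A = Determinant.det (list_mat c A)"
    by (simp add: det_on_def Let_def list_mat_def c_def)
  also have "\<dots> = Determinant.det (list_mat b A)"
    by (rule det_list_mat_basis_change) (use b c A in auto)
  finally show ?thesis .
qed

text \<open>In a basis adapted to \<open>range K \<subseteq> V\<close> the matrix of \<open>I + K\<close> on \<open>V\<close> is block triangular with an identity block.\<close>

lemma fredholm_det1_eq:
  fixes K :: "'a::real_vector \<Rightarrow> 'a"
  assumes K: "linear K" and b: "distinct b" "independent (set b)" and rng: "range K \<subseteq> span (set b)"
  shows "fredholm_det1 (\<lambda>v. v + K v) = Determinant.det (list_mat b (\<lambda>v. v + K v))"
proof -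
  let ?A = "\<lambda>v. v + K v"
  have A: "linear ?A" by (intro linear_compose_add linear_ident K)
  have subR: "subspace (range K)" by (rule linear_subspace_image[OF K subspace_UNIV])
  obtain B1 where B1: "B1 \<subseteq> range K" "independent B1" "range K \<subseteq> span B1"
    using maximal_independent_subset by blast
  then have spB1: "span B1 = range K" using span_minimal[OF B1(1) subR] by auto
  obtain B2 where B2: "B1 \<subseteq> B2" "B2 \<subseteq> span (set b)" "independent B2" "span (set b) \<subseteq> span B2"
    using maximal_independent_subset_extend[of B1 "span (set b)"] B1 rng by blast
  have spB2: "span B2 = span (set b)" using span_minimal[OF B2(2)] B2(4) by auto
  have fin2: "finite B2"
    using independent_span_bound[OF finite_set B2(3), of b] B2(2) by blast
  obtain b1 where b1: "set b1 = B1" "distinct b1" using finite_distinct_list[OF finite_subset[OF B2(1) fin2]] by blast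
  obtain b2 where b2: "set b2 = B2 - B1" "distinct b2" using finite_distinct_list[of "B2 - B1"] fin2 by blast
  let ?c = "b1 @ b2"
  have c: "distinct ?c" "set ?c = B2" using b1 b2 B2(1) by auto
  have inR: "K v \<in> span (set b1)" for v using spB1 b1 by auto
  have Ainv: "?A ` span (set b) \<subseteq> span (set b)" using rng by (auto intro: span_add)
  have "fredholm_det1 ?A = det_on (range K) ?A" by (simp add: fredholm_det1_def)
  also have "\<dots> = Determinant.det (list_mat b1 ?A)"
  proof (rule det_on_eq)
    show "?A ` range K \<subseteq> range K" using subspace_add[OF subR] by auto
  qed (use b1 B1 spB1 A in auto)
  also have "\<dots> = Determinant.det (list_mat ?c ?A)"
  proof -
    let ?p = "length b1" and ?q = "length b2"
    define U where "U = Matrix.mat ?p ?q (\<lambda>(i, j). representation B2 (?A (b2 ! j)) (b1 ! i))"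
    have ind1: "independent (set b1)" using b1 B1 by simp
    have rep1: "representation B2 v = representation (set b1) v" if "v \<in> span (set b1)" for v
      by (rule real_vector.representation_extend) (use B2 b1 that in auto)
    have out: "representation (set b1) v x = 0" if "x \<notin> set b1" for v x
      using real_vector.representation_ne_zero[of "set b1" v x] that by blast
    have "list_mat ?c ?A = four_block_mat (list_mat b1 ?A) U (0\<^sub>m ?q ?p) (1\<^sub>m ?q)"
    proof (rule eq_matI)
      fix i j assume "i < dim_row (four_block_mat (list_mat b1 ?A) U (0\<^sub>m ?q ?p) (1\<^sub>m ?q))"
        "j < dim_col (four_block_mat (list_mat b1 ?A) U (0\<^sub>m ?q ?p) (1\<^sub>m ?q))"
      then have ij: "i < ?p + ?q" "j < ?p + ?q" by (auto simp: list_mat_def)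
      have l: "list_mat ?c ?A $$ (i, j) = representation B2 (?A (?c ! j)) (?c ! i)"
        using ij c(2) by (simp add: list_mat_def)
      show "list_mat ?c ?A $$ (i, j) = four_block_mat (list_mat b1 ?A) U (0\<^sub>m ?q ?p) (1\<^sub>m ?q) $$ (i, j)"
      proof (cases "j < ?p")
        case j: True
        then have "b1 ! j \<in> span (set b1)" by (intro span_base) simp
        then have "?A (b1 ! j) \<in> span (set b1)" by (intro span_add inR)
        then have r: "representation B2 (?A (b1 ! j)) = representation (set b1) (?A (b1 ! j))" by (rule rep1)
        show ?thesis
        proof (cases "i < ?p")
          case True
          then show ?thesis using j ij unfolding l by (simp add: nth_append r list_mat_def)
        next
          case False
          then have "b2 ! (i - ?p) \<in> set b2" using ij by (intro nth_mem) auto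
          then have "b2 ! (i - ?p) \<notin> set b1" using b1 b2 by auto
          then show ?thesis using False j ij out unfolding l by (simp add: nth_append r list_mat_def)
        qed
      next
        case j: False
        then have mem: "b2 ! (j - ?p) \<in> B2" using ij b2 nth_mem[of "j - ?p" b2] by auto
        have r: "representation B2 (?A (b2 ! (j - ?p))) x
            = representation B2 (b2 ! (j - ?p)) x + representation (set b1) (K (b2 ! (j - ?p))) x" for x
        proof -
          have "K (b2 ! (j - ?p)) \<in> span B2" using rng spB2 by auto
          then show ?thesis
            using real_vector.representation_add[OF B2(3) _ span_base[OF mem]] rep1[OF inR]
            by (metis add.commute)
        qed
        show ?thesis
        proof (cases "i < ?p")
          case True
          then show ?thesis using j ij unfolding l by (simp add: nth_append U_def list_mat_def)
        next
          case False
          then have "b2 ! (i - ?p) \<in> set b2" using ij by (intro nth_mem) auto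
          then have "b2 ! (i - ?p) \<notin> set b1" using b1 b2 by auto
          then show ?thesis using False j ij out b2 unfolding l
            by (simp add: nth_append r list_mat_def real_vector.representation_basis[OF B2(3) mem] nth_eq_iff_index_eq)
        qed
      qed
    qed (auto simp: list_mat_def)
    moreover have "Determinant.det (four_block_mat (list_mat b1 ?A) U (0\<^sub>m ?q ?p) (1\<^sub>m ?q)) = Determinant.det (list_mat b1 ?A) * Determinant.det (1\<^sub>m ?q :: real mat)"
      by (rule det_four_block_mat_lower_left_zero[of _ ?p _ ?q]) (auto simp: U_def)
    ultimately show ?thesis by simp
  qed
  also have "\<dots> = Determinant.det (list_mat b ?A)"
    by (rule det_list_mat_basis_change) (use b c B2 spB2 A Ainv in auto)
  finally show ?thesis .
qed

section \<open>A single layer\<close>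

lemma has_derivative_sequential:
  fixes F :: "'a::real_normed_vector \<Rightarrow> 'b::real_normed_vector"
  assumes "(F has_derivative D) (at u)"
  shows "(\<lambda>n. real (Suc n) *\<^sub>R (F (u + (1 / real (Suc n)) *\<^sub>R v) - F u)) \<longlonglongrightarrow> D v"
proof (cases "v = 0")
  case True
  have "linear D" using assms by (simp add: has_derivative_linear)
  then show ?thesis using True by (simp add: linear_0)
next
  case False
  have lin: "linear D" using assms by (simp add: has_derivative_linear)
  define h where "h n = (1 / real (Suc n)) *\<^sub>R v" for n
  have h: "h \<longlonglongrightarrow> 0"
    using tendsto_scaleR[OF LIMSEQ_Suc[OF lim_1_over_n] tendsto_const[of v]] by (simp add: h_def[abs_def])
  have h0: "h n \<noteq> 0" for n using False by (simp add: h_def)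
  have "((\<lambda>k. norm (F (u + k) - F u - D k) / norm k) \<longlongrightarrow> 0) (at 0)"
    using assms by (simp add: has_derivative_at)
  moreover have "filterlim h (at 0) sequentially"
    using h h0 by (simp add: filterlim_at)
  ultimately have lim: "(\<lambda>n. norm (F (u + h n) - F u - D (h n)) / norm (h n)) \<longlonglongrightarrow> 0"
    by (rule filterlim_compose)
  have "norm (real (Suc n) *\<^sub>R (F (u + h n) - F u) - D v) = norm (F (u + h n) - F u - D (h n)) / norm (h n) * norm v" for n
  proof -
    have "D v = real (Suc n) *\<^sub>R D (h n)"
      by (simp add: h_def linear_scale[OF lin])
    then have "norm (real (Suc n) *\<^sub>R (F (u + h n) - F u) - D v) = real (Suc n) * norm (F (u + h n) - F u - D (h n))"
      by (simp flip: scaleR_diff_right)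
    then show ?thesis using False by (simp add: h_def)
  qed
  then have "(\<lambda>n. norm (real (Suc n) *\<^sub>R (F (u + h n) - F u) - D v)) \<longlonglongrightarrow> 0"
    using tendsto_mult_left_zero[OF lim, of "norm v"] by simp
  then have "(\<lambda>n. real (Suc n) *\<^sub>R (F (u + h n) - F u) - D v) \<longlonglongrightarrow> 0"
    by (rule tendsto_norm_zero_cancel)
  then show ?thesis unfolding h_def by (rule LIM_zero_cancel)
qed

locale gaussian_layer = gaussian_frame C M E m e
  for C :: "'a::{real_inner, polish_space} \<Rightarrow> 'a" and M E m e +
  fixes F :: "'a \<Rightarrow> 'a"
  assumes differentiable: "\<And>u. F differentiable (at u)"
    and F_span: "\<And>u. F u \<in> span E"
    and bij: "bij (\<lambda>u. u + F u)"
    and spectrum: "\<And>u v. frechet_derivative F (at u) v = - v \<Longrightarrow> v = 0"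
begin

abbreviation "DF u \<equiv> frechet_derivative F (at u)"

lemma DF: "(F has_derivative DF u) (at u)"
  using differentiable by (simp add: frechet_derivative_works)

lemma linear_DF: "linear (DF u)"
  using DF by (rule has_derivative_linear)

lemma continuous_F: "continuous_on UNIV F"
  using differentiable differentiable_imp_continuous_within continuous_at_imp_continuous_on by blast

lemma measurable_F [measurable]: "F \<in> borel_measurable borel"
  by (rule borel_measurable_continuous_onI[OF continuous_F])

definition dual :: "nat \<Rightarrow> 'a" where
  "dual i = (SOME a. \<forall>v\<in>span E. cm_inner C v (e i) = inner a v)"

lemma dual: "i < m \<Longrightarrow> v \<in> span E \<Longrightarrow> cm_inner C v (e i) = inner (dual i) v"
  using someI_ex[OF ex_dual_vector[OF orthonormal e_E], folded dual_def] by blast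

lemma span_expansion: "v \<in> span E \<Longrightarrow> v = (\<Sum>i<m. inner (dual i) v *\<^sub>R e i)"
proof -
  assume v: "v \<in> span E"
  have "v = (\<Sum>i<m. cm_inner C v (e i) *\<^sub>R e i)"
    using cm_expansion[OF orthonormal v] by (simp only: sum_E[of "\<lambda>x. cm_inner C v x *\<^sub>R x"])
  also have "\<dots> = (\<Sum>i<m. inner (dual i) v *\<^sub>R e i)" by (rule sum.cong) (use dual v in auto)
  finally show ?thesis .
qed

lemma closed_span_E: "closed (span E)"
proof -
  have "span E = {v. v = (\<Sum>i<m. inner (dual i) v *\<^sub>R e i)}"
  proof (intro equalityI subsetI)
    fix v assume "v \<in> {v. v = (\<Sum>i<m. inner (dual i) v *\<^sub>R e i)}"
    then have "v = embed (\<lambda>i. inner (dual i) v)" by (simp add: embed_def)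
    then show "v \<in> span E" using embed_span by metis
  qed (use span_expansion in blast)
  also have "closed \<dots>" by (intro closed_Collect_eq continuous_intros)
  finally show ?thesis .
qed

lemma DF_span: "DF u v \<in> span E"
  by (rule closed_sequentially[OF closed_span_E _ has_derivative_sequential[OF DF]])
    (intro span_scale span_diff F_span)

definition jacobian :: "'a \<Rightarrow> real mat" where
  "jacobian u = Matrix.mat m m (\<lambda>(i, j). (if i = j then 1 else 0) + inner (dual i) (DF u (e j)))"

lemma jacobian_carrier [simp]: "jacobian u \<in> carrier_mat m m"
  by (simp add: jacobian_def)

lemma measurable_det_jacobian [measurable]: "(\<lambda>u. Determinant.det (jacobian u)) \<in> borel_measurable borel"
proof -
  have DFm: "(\<lambda>u. inner (dual i) (DF u v)) \<in> borel_measurable borel" for i v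
  proof (rule borel_measurable_LIMSEQ_metric)
    show "(\<lambda>u. inner (dual i) (real (Suc n) *\<^sub>R (F (u + (1 / real (Suc n)) *\<^sub>R v) - F u))) \<in> borel_measurable borel" for n
      by measurable
    show "(\<lambda>n. inner (dual i) (real (Suc n) *\<^sub>R (F (u + (1 / real (Suc n)) *\<^sub>R v) - F u))) \<longlonglongrightarrow> inner (dual i) (DF u v)" for u
      by (intro tendsto_inner tendsto_const has_derivative_sequential DF)
  qed
  have "Determinant.det (jacobian u) = (\<Sum>p\<in>{p. p permutes {0..<m}}. signof p *
      (\<Prod>i = 0..<m. (if i = p i then 1 else 0) + inner (dual i) (DF u (e (p i)))))" for u
  proof -
    have "(\<Prod>i = 0..<m. jacobian u $$ (i, p i)) = (\<Prod>i = 0..<m. (if i = p i then 1 else 0) + inner (dual i) (DF u (e (p i))))"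
      if "p permutes {0..<m}" for p
    proof (rule prod.cong)
      fix i assume i: "i \<in> {0..<m}"
      then have "p i < m" using permutes_in_image[OF that, of i] by simp
      then show "jacobian u $$ (i, p i) = (if i = p i then 1 else 0) + inner (dual i) (DF u (e (p i)))"
        using i by (simp add: jacobian_def)
    qed simp
    then show ?thesis by (simp add: Determinant.det_def jacobian_def)
  qed
  then show ?thesis
    by (simp only:) (intro borel_measurable_sum borel_measurable_times borel_measurable_const
      borel_measurable_prod borel_measurable_add DFm)
qed

lemma det_jacobian: "Determinant.det (jacobian u) \<noteq> 0"
proof
  assume "Determinant.det (jacobian u) = 0"
  then obtain v where v: "v \<in> carrier_vec m" "v \<noteq> 0\<^sub>v m" "jacobian u *\<^sub>v v = 0\<^sub>v m"
    using det_0_iff_vec_prod_zero[OF jacobian_carrier] by auto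
  define w where "w = embed (\<lambda>i. vec_index v i)"
  have "inner (dual i) (DF u w) = - vec_index v i" if i: "i < m" for i
  proof -
    have "inner (dual i) (DF u w) = (\<Sum>j<m. vec_index v j * inner (dual i) (DF u (e j)))"
      by (simp add: w_def embed_def linear_sum[OF linear_DF] linear_scale[OF linear_DF] inner_sum_right)
    moreover have "0 = (\<Sum>j<m. jacobian u $$ (i, j) * vec_index v j)"
      using v(1,3) i by (auto simp: scalar_prod_def lessThan_atLeast0 jacobian_def dest!: arg_cong[where f = "\<lambda>w. vec_index w i"])
    moreover have "(\<Sum>j<m. jacobian u $$ (i, j) * vec_index v j)
        = (\<Sum>j<m. if i = j then vec_index v j else 0) + (\<Sum>j<m. vec_index v j * inner (dual i) (DF u (e j)))"
      unfolding sum.distrib[symmetric] using i by (intro sum.cong) (auto simp: jacobian_def algebra_simps)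
    ultimately show ?thesis using i by simp
  qed
  then have "DF u w = (\<Sum>i<m. (- vec_index v i) *\<^sub>R e i)"
    using span_expansion[OF DF_span, of u w] by simp
  then have "DF u w = - w" by (simp add: w_def embed_def sum_negf)
  then have "w = 0" by (rule spectrum)
  then have "vec_index v i = 0" if "i < m" for i
    using cm_inner_embed[OF that, of "\<lambda>i. vec_index v i"] cm_inner_scale[OF subspace_0[OF subspace_H], of 0 "e i"]
    by (simp add: w_def)
  then have "v = 0\<^sub>v m" using v(1) by auto
  with v(2) show False by simp
qed

lemma fredholm_det1_layer:
  "fredholm_det1 (frechet_derivative (\<lambda>u. u + F u) (at u)) = Determinant.det (jacobian u)"
proof -
  let ?b = "map e [0..<m]"
  have inj: "inj_on e {..<m}" and im: "e ` {..<m} = E" using enum by (auto simp: bij_betw_def)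
  have set: "set ?b = E" using im by (auto simp: lessThan_atLeast0)
  have dist: "distinct ?b" using inj by (simp add: distinct_map lessThan_atLeast0)
  have "((\<lambda>u. u + F u) has_derivative (\<lambda>v. v + DF u v)) (at u)"
    by (intro has_derivative_add has_derivative_ident DF)
  then have "frechet_derivative (\<lambda>u. u + F u) (at u) = (\<lambda>v. v + DF u v)"
    by (rule frechet_derivative_at[symmetric])
  then have "fredholm_det1 (frechet_derivative (\<lambda>u. u + F u) (at u)) = fredholm_det1 (\<lambda>v. v + DF u v)"
    by simp
  also have "fredholm_det1 (\<lambda>v. v + DF u v) = Determinant.det (list_mat ?b (\<lambda>v. v + DF u v))"
    by (rule fredholm_det1_eq[OF linear_DF dist]) (use set cm_orthonormal_independent[OF orthonormal] DF_span in auto)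
  also have "list_mat ?b (\<lambda>v. v + DF u v) = jacobian u"
  proof (rule eq_matI)
    fix i j assume "i < dim_row (jacobian u)" "j < dim_col (jacobian u)"
    then have ij: "i < m" "j < m" by (auto simp: jacobian_def)
    have v: "e j + DF u (e j) \<in> span E" by (intro span_add span_base e_E ij DF_span)
    have ind: "independent E" by (rule cm_orthonormal_independent[OF orthonormal])
    have "e j + DF u (e j) = (\<Sum>x\<in>E. representation E (e j + DF u (e j)) x *\<^sub>R x)"
      by (rule real_vector.sum_representation_eq[OF ind v finite_E subset_refl, symmetric])
    then have "representation E (e j + DF u (e j)) (e i) = cm_inner C (e j + DF u (e j)) (e i)"
      using cm_orthonormal_coeff[OF orthonormal e_E[OF ij(1)]] by metis
    also have "\<dots> = cm_inner C (e j) (e i) + cm_inner C (DF u (e j)) (e i)"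
      by (rule cm_inner_add) (use e_H ij DF_span span_subset_H[OF E_H] in auto)
    also have "\<dots> = jacobian u $$ (i, j)"
      using ij e_inner[OF ij(2,1)] dual[OF ij(1) DF_span] by (simp add: jacobian_def)
    finally show "list_mat ?b (\<lambda>v. v + DF u v) $$ (i, j) = jacobian u $$ (i, j)"
      unfolding list_mat_def using ij set by simp
  qed (auto simp: list_mat_def jacobian_def)
  finally show ?thesis .
qed

definition slice :: "'a \<Rightarrow> (nat \<Rightarrow> real) \<Rightarrow> nat \<Rightarrow> real" where
  "slice p x = (\<lambda>i\<in>{..<m}. x i + inner (dual i) (F (p + embed x)))"

lemma embed_slice: "embed (slice p x) = embed x + F (p + embed x)"
proof -
  have "embed (slice p x) = (\<Sum>i<m. x i *\<^sub>R e i + inner (dual i) (F (p + embed x)) *\<^sub>R e i)"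
    unfolding embed_def by (rule sum.cong) (auto simp: slice_def embed_def scaleR_add_left)
  then show ?thesis using span_expansion[OF F_span[of "p + embed x"]] by (simp add: sum.distrib embed_def)
qed

lemma embed_inj:
  assumes "x \<in> coords m" "y \<in> coords m" "embed x = embed y" shows "x = y"
proof (rule PiE_ext[OF assms(1,2)])
  fix i assume "i \<in> {..<m}"
  then show "x i = y i" using cm_inner_embed[of i x] cm_inner_embed[of i y] assms(3) by simp
qed

lemma slice_coords: "slice p x \<in> coords m"
  by (simp add: slice_def)

lemma bij_slice: "bij_betw (slice p) (coords m) (coords m)"
proof (rule bij_betw_imageI)
  show "inj_on (slice p) (coords m)"
  proof (rule inj_onI)
    fix x y assume xy: "x \<in> coords m" "y \<in> coords m" "slice p x = slice p y"
    then have "embed x + F (p + embed x) = embed y + F (p + embed y)" by (simp flip: embed_slice)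
    then have "(p + embed x) + F (p + embed x) = (p + embed y) + F (p + embed y)"
      by (simp only: add.assoc)
    then have "p + embed x = p + embed y" by (rule injD[OF bij_is_inj[OF bij]])
    then have "embed x = embed y" by simp
    then show "x = y" by (rule embed_inj[OF xy(1,2)])
  qed
  show "slice p ` coords m = coords m"
  proof (intro equalityI subsetI)
    fix y assume y: "y \<in> coords m"
    obtain u where "p + embed y = u + F u" using surjD[OF bij_is_surj[OF bij], of "p + embed y"] by blast
    then have u: "u + F u = p + embed y" by simp
    define x where "x = (\<lambda>i\<in>{..<m}. y i - inner (dual i) (F u))"
    have "embed x = (\<Sum>i<m. y i *\<^sub>R e i - inner (dual i) (F u) *\<^sub>R e i)"
      unfolding embed_def by (rule sum.cong) (auto simp: x_def scaleR_diff_left)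
    then have ex: "embed x = embed y - F u"
      using span_expansion[OF F_span[of u]] by (simp add: sum_subtractf embed_def)
    have "p + embed x = (p + embed y) - F u" unfolding ex by (rule add_diff_eq)
    then have pu: "p + embed x = u" using u[symmetric] by simp
    have "slice p x = y"
    proof (rule embed_inj[OF slice_coords y])
      show "embed (slice p x) = embed y" unfolding embed_slice pu using ex by simp
    qed
    moreover have "x \<in> coords m" by (simp add: x_def)
    ultimately show "y \<in> slice p ` coords m" by blast
  next
    fix y assume "y \<in> slice p ` coords m"
    then obtain x where "y = slice p x" by blast
    then show "y \<in> coords m" by (simp only: slice_coords)
  qed
qed

lemma embed_diff: "embed y - embed x = embed (\<lambda>j. y j - x j)"
  by (simp add: embed_def scaleR_diff_left sum_subtractf)

lemma norm_embed_le: "norm (embed y - embed x) \<le> (\<Sum>i<m. norm (e i)) * sup_dist m y x"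
proof -
  have "norm (embed y - embed x) \<le> (\<Sum>i<m. norm ((y i - x i) *\<^sub>R e i))"
    unfolding embed_diff unfolding embed_def by (rule norm_sum)
  also have "\<dots> \<le> (\<Sum>i<m. norm (e i) * sup_dist m y x)"
    by (rule sum_mono) (auto simp: mult.commute intro!: mult_left_mono coord_le_sup_dist)
  finally show ?thesis by (simp add: sum_distrib_right)
qed

lemma coords_diffeo_slice: "coords_diffeo m (slice p) (\<lambda>x. jacobian (p + embed x))"
proof
  show "bij_betw (slice p) (coords m) (coords m)" by (rule bij_slice)
  show "jacobian (p + embed x) \<in> carrier_mat m m" for x by simp
  show "Determinant.det (jacobian (p + embed x)) \<noteq> 0" for x by (rule det_jacobian)
  show "(\<lambda>x. Determinant.det (jacobian (p + embed x))) \<in> borel_measurable (lborel_n m)" by measurable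
  fix x and \<epsilon> :: real assume \<epsilon>: "0 < \<epsilon>"
  let ?u = "p + embed x"
  define c where "c = (\<Sum>i<m. norm (e i))"
  define A where "A = (\<Sum>i<m. norm (dual i))"
  have c: "c \<ge> 0" and A: "A \<ge> 0" by (auto simp: c_def A_def intro: sum_nonneg)
  define \<delta> where "\<delta> = \<epsilon> / ((c + 1) * (A + 1))"
  have \<delta>: "\<delta> > 0" using \<epsilon> c A by (simp add: \<delta>_def)
  obtain d where d: "d > 0" "\<And>y. norm (y - ?u) < d \<Longrightarrow> norm (F y - F ?u - DF ?u (y - ?u)) \<le> \<delta> * norm (y - ?u)"
    using DF[of ?u] \<delta> unfolding has_derivative_at_alt by blast
  show "\<exists>d>0. \<forall>y\<in>coords m. sup_dist m y x < d \<longrightarrow> (\<forall>i<m. \<bar>slice p y i - slice p x i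
      - (\<Sum>j<m. jacobian ?u $$ (i, j) * (y j - x j))\<bar> \<le> \<epsilon> * sup_dist m y x)"
  proof (intro exI[of _ "d / (c + 1)"] conjI ballI impI allI)
    show "d / (c + 1) > 0" using d(1) c by simp
    fix y i assume y: "sup_dist m y x < d / (c + 1)" and i: "i < m"
    let ?w = "embed y - embed x" and ?s = "sup_dist m y x"
    have w: "norm ?w \<le> c * ?s" using norm_embed_le by (simp add: c_def)
    have "c * ?s \<le> (c + 1) * ?s" by (simp add: distrib_right)
    also have "\<dots> < d" using y c by (simp add: field_simps)
    finally have "norm (p + embed y - ?u) < d" using w by simp
    from d(2)[OF this] have F: "norm (F (p + embed y) - F ?u - DF ?u ?w) \<le> \<delta> * norm ?w" by simp
    have "(\<Sum>j<m. jacobian ?u $$ (i, j) * (y j - x j))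
        = (\<Sum>j<m. if i = j then y j - x j else 0) + (\<Sum>j<m. (y j - x j) * inner (dual i) (DF ?u (e j)))"
      unfolding sum.distrib[symmetric] using i by (intro sum.cong) (auto simp: jacobian_def algebra_simps)
    also have "(\<Sum>j<m. (y j - x j) * inner (dual i) (DF ?u (e j))) = inner (dual i) (DF ?u ?w)"
      unfolding embed_diff by (simp add: embed_def linear_sum[OF linear_DF] linear_scale[OF linear_DF] inner_sum_right)
    finally have "slice p y i - slice p x i - (\<Sum>j<m. jacobian ?u $$ (i, j) * (y j - x j))
        = inner (dual i) (F (p + embed y) - F ?u - DF ?u ?w)"
      using i by (simp add: slice_def inner_diff_right)
    also have "\<bar>\<dots>\<bar> \<le> norm (dual i) * norm (F (p + embed y) - F ?u - DF ?u ?w)"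
      by (rule Cauchy_Schwarz_ineq2)
    also have "\<dots> \<le> A * (\<delta> * (c * ?s))"
    proof (rule mult_mono)
      show "norm (dual i) \<le> A" unfolding A_def using i by (intro member_le_sum) auto
      show "norm (F (p + embed y) - F ?u - DF ?u ?w) \<le> \<delta> * (c * ?s)"
        using F w \<delta> by (meson mult_left_mono less_imp_le order_trans)
    qed (use A in auto)
    also have "\<dots> = (A * c / ((c + 1) * (A + 1))) * (\<epsilon> * ?s)" by (simp add: \<delta>_def)
    also have "\<dots> \<le> 1 * (\<epsilon> * ?s)"
    proof (rule mult_right_mono)
      have "A * c \<le> (c + 1) * (A + 1)" using A c by (simp add: algebra_simps)
      then show "A * c / ((c + 1) * (A + 1)) \<le> 1" using A c by (simp add: divide_le_eq_1)
    qed (use \<epsilon> in simp)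
    finally show "\<bar>slice p y i - slice p x i - (\<Sum>j<m. jacobian ?u $$ (i, j) * (y j - x j))\<bar> \<le> \<epsilon> * ?s" by simp
  qed
qed

definition weight :: "'a \<Rightarrow> real" where
  "weight u = \<bar>fredholm_det1 (frechet_derivative (\<lambda>u. u + F u) (at u))\<bar>
     * exp (- (cm_inner C (F u) (F u) / 2) - (\<Sum>x\<in>E. coord x u * cm_inner C (F u) x))"

lemma weight_eq: "weight u = \<bar>Determinant.det (jacobian u)\<bar>
     * exp (- ((\<Sum>i<m. (inner (dual i) (F u))\<^sup>2) / 2) - (\<Sum>i<m. coord (e i) u * inner (dual i) (F u)))"
proof -
  have "cm_inner C (F u) (F u) = (\<Sum>i<m. (inner (dual i) (F u))\<^sup>2)"
    unfolding cm_parseval[OF orthonormal F_span] sum_E by (rule sum.cong) (auto simp: dual[OF _ F_span])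
  moreover have "(\<Sum>x\<in>E. coord x u * cm_inner C (F u) x) = (\<Sum>i<m. coord (e i) u * inner (dual i) (F u))"
    unfolding sum_E by (rule sum.cong) (auto simp: dual[OF _ F_span])
  ultimately show ?thesis unfolding weight_def fredholm_det1_layer by simp
qed

lemma measurable_weight [measurable]: "weight \<in> borel_measurable borel"
  unfolding weight_eq[abs_def] by measurable

lemma weight_pos: "weight u > 0"
  using det_jacobian[of u] by (simp add: weight_eq)

lemma layer_change_of_variables:
  assumes [measurable]: "\<phi> \<in> borel_measurable borel"
  shows "(\<integral>\<^sup>+u. \<phi> (u + F u) * ennreal (weight u) \<partial>M) = (\<integral>\<^sup>+u. \<phi> u \<partial>M)"
proof -
  have "(\<integral>\<^sup>+x. \<phi> ((proj u + embed x) + F (proj u + embed x)) * ennreal (weight (proj u + embed x)) \<partial>gauss_n m)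
      = (\<integral>\<^sup>+x. \<phi> (proj u + embed x) \<partial>gauss_n m)" if u: "u \<in> good E" for u
  proof -
    let ?p = "proj u"
    interpret V: coords_diffeo m "slice ?p" "\<lambda>x. jacobian (?p + embed x)" by (rule coords_diffeo_slice)
    define g where "g x = (\<Prod>i<m. std_normal_density (x i))" for x :: "nat \<Rightarrow> real"
    have gm[measurable]: "g \<in> borel_measurable (lborel_n m)"
      unfolding g_def by (rule measurable_std_normal_prod)
    have g0: "g x \<ge> 0" for x unfolding g_def by (rule prod_nonneg) simp
    have pu: "?p = u + embed (\<lambda>i. - coord (e i) u)"
      by (simp add: proj_def embed_def sum_negf)
    have pgood: "?p \<in> good E" unfolding pu by (rule good_add(1)[OF E_H u embed_H])
    have pc: "coord (e i) ?p = 0" if "i < m" for i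
      unfolding pu using good_add(2)[OF E_H u embed_H e_E[OF that]] cm_inner_embed[OF that] by simp
    have xc: "coord (e i) (?p + embed x) = x i" if "i < m" for i x
      using good_add(2)[OF E_H pgood embed_H e_E[OF that]] cm_inner_embed[OF that] pc[OF that] by simp
    have point: "ennreal (g x) * (\<phi> ((?p + embed x) + F (?p + embed x)) * ennreal (weight (?p + embed x)))
        = ennreal \<bar>Determinant.det (jacobian (?p + embed x))\<bar> * (ennreal (g (slice ?p x)) * \<phi> (?p + embed (slice ?p x)))" for x
    proof -
      let ?f = "\<lambda>i. inner (dual i) (F (?p + embed x))"
      have "g (slice ?p x) = g x * exp (- ((\<Sum>i<m. (?f i)\<^sup>2) / 2) - (\<Sum>i<m. x i * ?f i))"
      proof -
        have "g (slice ?p x) = (\<Prod>i<m. std_normal_density (x i) * exp (- ((?f i)\<^sup>2 / 2) - x i * ?f i))"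
          unfolding g_def
        proof (rule prod.cong)
          fix i assume "i \<in> {..<m}"
          then have "slice ?p x i = x i + ?f i" by (simp add: slice_def)
          moreover have "exp (- (a + b)\<^sup>2 / 2) = exp (- a\<^sup>2 / 2) * exp (- (b\<^sup>2 / 2) - a * b)" for a b :: real
            by (simp add: exp_add[symmetric] power2_sum add_divide_distrib diff_divide_distrib)
          ultimately show "std_normal_density (slice ?p x i) = std_normal_density (x i) * exp (- ((?f i)\<^sup>2 / 2) - x i * ?f i)"
            by (simp add: std_normal_density_def)
        qed simp
        also have "\<dots> = g x * exp (\<Sum>i<m. - ((?f i)\<^sup>2 / 2) - x i * ?f i)"
          by (simp add: prod.distrib exp_sum g_def)
        finally show ?thesis by (simp add: sum_subtractf sum_negf sum_divide_distrib)
      qed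
      moreover have "weight (?p + embed x) = \<bar>Determinant.det (jacobian (?p + embed x))\<bar>
          * exp (- ((\<Sum>i<m. (?f i)\<^sup>2) / 2) - (\<Sum>i<m. x i * ?f i))"
        unfolding weight_eq using xc by simp
      ultimately have "g x * weight (?p + embed x) = \<bar>Determinant.det (jacobian (?p + embed x))\<bar> * g (slice ?p x)"
        by simp
      then have "ennreal (g x) * ennreal (weight (?p + embed x)) = ennreal \<bar>Determinant.det (jacobian (?p + embed x))\<bar> * ennreal (g (slice ?p x))"
        using g0 weight_pos[of "?p + embed x"] by (simp add: less_imp_le flip: ennreal_mult)
      then have "(ennreal (g x) * ennreal (weight (?p + embed x))) * \<phi> ((?p + embed x) + F (?p + embed x))
          = (ennreal \<bar>Determinant.det (jacobian (?p + embed x))\<bar> * ennreal (g (slice ?p x))) * \<phi> ((?p + embed x) + F (?p + embed x))"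
        by simp
      then show ?thesis unfolding embed_slice add.assoc[symmetric]
        by (simp only: mult.assoc mult.commute[of "\<phi> ((?p + embed x) + F (?p + embed x))"])
    qed
    have "(\<integral>\<^sup>+x. \<phi> ((?p + embed x) + F (?p + embed x)) * ennreal (weight (?p + embed x)) \<partial>gauss_n m)
        = (\<integral>\<^sup>+x. ennreal (g x) * (\<phi> ((?p + embed x) + F (?p + embed x)) * ennreal (weight (?p + embed x))) \<partial>lborel_n m)"
      unfolding gauss_n_def g_def[symmetric] by (rule nn_integral_density) measurable
    also have "\<dots> = (\<integral>\<^sup>+x. ennreal (g x) * \<phi> (?p + embed x) \<partial>lborel_n m)"
      unfolding point by (rule V.change_of_variables) measurable
    also have "\<dots> = (\<integral>\<^sup>+x. \<phi> (?p + embed x) \<partial>gauss_n m)"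
      unfolding gauss_n_def g_def[symmetric] by (rule nn_integral_density[symmetric]) measurable
    finally show ?thesis .
  qed
  moreover have "AE u in M. u \<in> good E" using AE_coord[OF finite_E E_H] by eventually_elim simp
  ultimately have "(\<integral>\<^sup>+u. (\<integral>\<^sup>+x. \<phi> ((proj u + embed x) + F (proj u + embed x)) * ennreal (weight (proj u + embed x)) \<partial>gauss_n m) \<partial>M)
      = (\<integral>\<^sup>+u. (\<integral>\<^sup>+x. \<phi> (proj u + embed x) \<partial>gauss_n m) \<partial>M)"
    by (intro nn_integral_cong_AE) (auto elim: eventually_mono)
  then show ?thesis
    using nn_integral_decomposition[of "\<lambda>u. \<phi> (u + F u) * ennreal (weight u)"] nn_integral_decomposition[of \<phi>] by simp
qed

end

section \<open>Composition of layers\<close>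

text \<open>
  A continuous injective map need not have an everywhere measurable inverse at our disposal, but by
  inner regularity the measure lives on a countable union of compact sets, where it does.
\<close>

lemma RN_deriv_of_change_of_variables:
  fixes M :: "'a::polish_space measure" and f :: "'a \<Rightarrow> 'a" and \<rho> :: "'a \<Rightarrow> real"
  assumes M: "prob_space M" "sets M = sets borel"
    and f: "continuous_on UNIV f" "inj f"
    and \<rho>: "\<rho> \<in> borel_measurable borel" "\<And>u. \<rho> u > 0"
    and cv: "\<And>\<phi>. \<phi> \<in> borel_measurable borel \<Longrightarrow> (\<integral>\<^sup>+u. \<phi> (f u) * ennreal (\<rho> u) \<partial>M) = (\<integral>\<^sup>+u. \<phi> u \<partial>M)"
  shows "absolutely_continuous M (distr M borel f)"
    and "absolutely_continuous (distr M borel f) M"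
    and "AE u in M. RN_deriv M (distr M borel f) (f u) = ennreal (inverse (\<rho> u))"
proof -
  interpret M: prob_space M by (rule M)
  note [measurable_cong] = M(2) and [measurable] = \<rho>(1)
  have spM: "space M = UNIV" using sets_eq_imp_space_eq[OF M(2)] by simp
  have fm[measurable]: "f \<in> borel_measurable borel" by (rule borel_measurable_continuous_onI[OF f(1)])
  have fM: "f \<in> measurable M borel" by measurable
  let ?N = "distr M borel f"
  have zero: "emeasure M B = 0 \<longleftrightarrow> emeasure ?N B = 0" if B[measurable]: "B \<in> sets borel" for B
  proof -
    have "emeasure M B = (\<integral>\<^sup>+u. indicator B (f u) * ennreal (\<rho> u) \<partial>M)"
      using cv[of "indicator B"] B M(2) by simp
    then have "emeasure M B = 0 \<longleftrightarrow> (AE u in M. indicator B (f u) * ennreal (\<rho> u) = 0)"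
      by (simp add: nn_integral_0_iff_AE)
    also have "\<dots> \<longleftrightarrow> (AE u in M. indicator B (f u) = (0::ennreal))"
    proof (rule AE_cong)
      fix u
      have "ennreal (\<rho> u) \<noteq> 0" using \<rho>(2)[of u] by simp
      then show "indicator B (f u) * ennreal (\<rho> u) = 0 \<longleftrightarrow> indicator B (f u) = (0::ennreal)"
        unfolding mult_eq_0_iff by blast
    qed
    also have "\<dots> \<longleftrightarrow> (\<integral>\<^sup>+u. indicator B (f u) \<partial>M) = 0"
      by (simp add: nn_integral_0_iff_AE)
    also have "(\<integral>\<^sup>+u. indicator B (f u) \<partial>M) = (\<integral>\<^sup>+y. indicator B y \<partial>?N)"
      by (subst nn_integral_distr[OF fM]) auto
    finally show ?thesis using B by simp
  qed
  show ac: "absolutely_continuous M ?N"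
    unfolding absolutely_continuous_def by (auto simp: null_sets_def M(2) zero)
  show "absolutely_continuous ?N M"
    unfolding absolutely_continuous_def by (auto simp: null_sets_def M(2) zero)
  have "\<exists>K. compact K \<and> emeasure M K > ennreal (1 - 1 / real (Suc n))" for n
  proof -
    have "emeasure M UNIV = (SUP K\<in>{K. K \<subseteq> UNIV \<and> compact K}. emeasure M K)"
      by (rule inner_regular) (use M(2) in auto)
    moreover have "emeasure M UNIV = 1" using M.emeasure_space_1 spM by simp
    moreover have "ennreal (1 - 1 / real (Suc n)) < 1" by (simp add: ennreal_less_one_iff)
    ultimately show ?thesis using less_SUP_iff by (metis (no_types, lifting) mem_Collect_eq)
  qed
  then obtain K where K: "\<And>n. compact (K n)" "\<And>n. emeasure M (K n) > ennreal (1 - 1 / real (Suc n))" by metis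
  define U where "U = (\<Union>n. K n)"
  have Ks: "K n \<in> sets borel" for n using K(1) by (simp add: compact_imp_closed borel_closed)
  have Us[measurable]: "U \<in> sets borel" unfolding U_def using Ks by auto
  have "1 - 1 / real (Suc n) \<le> measure M U" for n
  proof -
    have "ennreal (1 - 1 / real (Suc n)) \<le> emeasure M U"
      using K(2)[of n] emeasure_mono[of "K n" U M] Us M(2) by (force simp: U_def)
    then show ?thesis by (simp add: M.emeasure_eq_measure)
  qed
  moreover have "(\<lambda>n. 1 - 1 / real (Suc n)) \<longlonglongrightarrow> 1 - 0"
    by (intro tendsto_intros LIMSEQ_Suc[OF lim_1_over_n])
  ultimately have "1 - 0 \<le> measure M U" by (intro LIMSEQ_le_const2) auto
  then have "measure M U = 1" using M.prob_le_1[of U] by linarith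
  then have AEU: "AE u in M. u \<in> U" by (subst M.AE_in_set_eq_1) (use M(2) in auto)
  have imgs: "f ` (A \<inter> U) \<in> sets borel" if "A \<in> sets borel" for A
    unfolding U_def
    by (rule borel_image_inj_sigma_compact[OF K(1) _ _ that])
      (auto intro: continuous_on_subset[OF f(1)] inj_on_subset[OF f(2)])
  define g where "g y = (if y \<in> f ` U then inverse (\<rho> (inv_into UNIV f y)) else 0)" for y
  have gf: "g (f u) = inverse (\<rho> u)" if "u \<in> U" for u using that f(2) by (simp add: g_def)
  have g[measurable]: "g \<in> borel_measurable borel"
  proof (rule measurableI)
    fix A :: "real set" assume A[measurable]: "A \<in> sets borel"
    have "g -` A \<inter> space borel = f ` ({u. inverse (\<rho> u) \<in> A} \<inter> U) \<union> (if 0 \<in> A then - f ` U else {})"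
      using f(2) by (auto simp: g_def split: if_splits)
    moreover have "{u. inverse (\<rho> u) \<in> A} \<in> sets borel"
    proof -
      have "(\<lambda>u. inverse (\<rho> u)) -` A \<inter> space borel \<in> sets borel" by measurable
      then show ?thesis by (simp add: vimage_def)
    qed
    moreover have "- f ` U \<in> sets borel" using imgs[of UNIV] by (auto simp: Compl_eq_Diff_UNIV)
    ultimately show "g -` A \<inter> space borel \<in> sets borel" using imgs by auto
  qed simp
  have dens: "density M (\<lambda>y. ennreal (g y)) = ?N"
  proof (rule measure_eqI)
    fix B assume "B \<in> sets (density M (\<lambda>y. ennreal (g y)))"
    then have B[measurable]: "B \<in> sets borel" using M(2) by simp
    have "emeasure (density M (\<lambda>y. ennreal (g y))) B = (\<integral>\<^sup>+y. ennreal (g y) * indicator B y \<partial>M)"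
      by (rule emeasure_density) (use M(2) in auto)
    also have "\<dots> = (\<integral>\<^sup>+u. (ennreal (g (f u)) * indicator B (f u)) * ennreal (\<rho> u) \<partial>M)"
      by (rule cv[symmetric]) measurable
    also have "\<dots> = (\<integral>\<^sup>+u. indicator B (f u) \<partial>M)"
    proof (rule nn_integral_cong_AE, use AEU in eventually_elim)
      fix u assume "u \<in> U"
      then have "ennreal (g (f u)) * ennreal (\<rho> u) = 1"
        using gf \<rho>(2)[of u] by (simp add: less_imp_le flip: ennreal_mult)
      then show "(ennreal (g (f u)) * indicator B (f u)) * ennreal (\<rho> u) = indicator B (f u)"
        by (metis (no_types, lifting) mult.assoc mult.commute mult.left_neutral)
    qed
    also have "\<dots> = (\<integral>\<^sup>+y. indicator B y \<partial>?N)" by (subst nn_integral_distr[OF fM]) auto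
    also have "\<dots> = emeasure ?N B" by simp
    finally show "emeasure (density M (\<lambda>y. ennreal (g y))) B = emeasure ?N B" .
  qed (use M(2) in simp)
  have "AE y in M. ennreal (g y) = RN_deriv M ?N y"
    by (rule M.RN_deriv_unique) (use dens in auto)
  then have "AE y in ?N. ennreal (g y) = RN_deriv M ?N y"
    by (rule absolutely_continuous_AE[OF _ ac, rotated]) (use M(2) in simp)
  then have "AE u in M. ennreal (g (f u)) = RN_deriv M ?N (f u)" by (rule AE_distrD[OF fM])
  then show "AE u in M. RN_deriv M ?N (f u) = ennreal (inverse (\<rho> u))"
    using AEU by eventually_elim (simp add: gf)
qed

context gaussian_measure
begin

text \<open>
  A system \<open>E'\<close> whose span contains all \<open>f u - u\<close> need not contain the ranges of the single layers,
  so the pairing is computed in a larger system \<open>E\<close> and then transferred.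
\<close>

lemma AE_pairing_eq:
  assumes E: "cm_orthonormal C E" and E': "cm_orthonormal C E'"
  shows "AE u in M. \<forall>v\<in>span E \<inter> span E'. (\<Sum>x\<in>E. coord x u * cm_inner C v x) = cm_pairing M C E' u v"
proof -
  have fin: "finite E" "finite E'" and sub: "E \<subseteq> H" "E' \<subseteq> H"
    using E E' by (auto simp: cm_orthonormal_def)
  obtain D where D: "D \<subseteq> span E \<inter> span E'" "independent D" "span E \<inter> span E' \<subseteq> span D"
    using maximal_independent_subset by blast
  have finD: "finite D" using independent_span_bound[OF fin(1) D(2)] D(1) by blast
  have DH: "D \<subseteq> H" using D(1) span_subset_H[OF sub(1)] by blast
  have basis: "AE u in M. \<forall>d\<in>D. (\<Sum>x\<in>E. cm_inner C d x * cm_functional M x u) = (\<Sum>x\<in>E'. cm_inner C d x * cm_functional M x u)"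
  proof (rule AE_finite_allI[OF finD])
    fix d assume "d \<in> D"
    then have d: "d \<in> span E" "d \<in> span E'" using D(1) by auto
    show "AE u in M. (\<Sum>x\<in>E. cm_inner C d x * cm_functional M x u) = (\<Sum>x\<in>E'. cm_inner C d x * cm_functional M x u)"
      using cm_functional_sum[OF fin(1) sub(1) cm_expansion[OF E d(1)]]
        cm_functional_sum[OF fin(2) sub(2) cm_expansion[OF E' d(2)]]
      by eventually_elim simp
  qed
  show ?thesis using basis AE_coord[OF fin(1) sub(1)]
  proof eventually_elim
    case (elim u)
    show ?case
    proof
      fix v assume "v \<in> span E \<inter> span E'"
      then obtain b where v: "v = (\<Sum>d\<in>D. b d *\<^sub>R d)" using D(3) span_finite[OF finD] by auto
      have vx: "cm_inner C v x = (\<Sum>d\<in>D. b d * cm_inner C d x)" for x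
        unfolding v using DH by (subst cm_inner_sum) (auto intro!: subspace_scale[OF subspace_H] sum.cong cm_inner_scale)
      have *: "(\<Sum>x\<in>G. cm_functional M x u * cm_inner C v x) = (\<Sum>d\<in>D. b d * (\<Sum>x\<in>G. cm_inner C d x * cm_functional M x u))" for G
        unfolding vx sum_distrib_left by (subst sum.swap) (simp add: mult_ac)
      have "(\<Sum>x\<in>E. coord x u * cm_inner C v x) = (\<Sum>x\<in>E. cm_functional M x u * cm_inner C v x)"
        using elim by (intro sum.cong) auto
      also have "\<dots> = (\<Sum>x\<in>E'. cm_functional M x u * cm_inner C v x)"
        unfolding * using elim by (intro sum.cong) auto
      finally show "(\<Sum>x\<in>E. coord x u * cm_inner C v x) = cm_pairing M C E' u v"
        by (simp add: cm_pairing_def)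
    qed
  qed
qed

end

context gaussian_frame
begin

lemma exponent_add:
  assumes a: "a \<in> span E" and b: "b \<in> span E" and u: "u \<in> good E"
  shows "(cm_inner C a a / 2 + (\<Sum>x\<in>E. coord x u * cm_inner C a x))
      + (cm_inner C b b / 2 + (\<Sum>x\<in>E. coord x (u + a) * cm_inner C b x))
    = cm_inner C (a + b) (a + b) / 2 + (\<Sum>x\<in>E. coord x u * cm_inner C (a + b) x)"
proof -
  have aH: "a \<in> H" and bH: "b \<in> H" using a b span_subset_H[OF E_H] by auto
  have ab: "a + b \<in> span E" using a b by (rule span_add)
  have "coord x (u + a) = coord x u + cm_inner C a x" if "x \<in> E" for x
    by (rule good_add(2)[OF E_H u aH that])
  then show ?thesis
    unfolding cm_parseval[OF orthonormal a] cm_parseval[OF orthonormal b] cm_parseval[OF orthonormal ab]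
      sum_divide_distrib sum.distrib[symmetric]
    by (intro sum.cong refl) (simp add: cm_inner_add[OF aH bH] power2_eq_square field_simps)
qed

lemma flow_change_of_variables:
  fixes G :: "nat \<Rightarrow> 'a \<Rightarrow> 'a" and f :: "nat \<Rightarrow> 'a \<Rightarrow> 'a"
  assumes layers: "\<And>n. n \<in> {1..l} \<Longrightarrow> gaussian_layer C M E m e (G n)"
    and f0: "\<And>u. f 0 u = u" and fS: "\<And>n u. f (Suc n) u = f n u + G (Suc n) (f n u)"
    and n: "n \<le> l"
  shows "continuous_on UNIV (f n) \<and> inj (f n) \<and> (\<forall>u. f n u - u \<in> span E) \<and>
    (\<exists>\<rho>. \<rho> \<in> borel_measurable borel \<and> (\<forall>u. \<rho> u > 0) \<and>
      (\<forall>\<phi>\<in>borel_measurable borel. (\<integral>\<^sup>+u. \<phi> (f n u) * ennreal (\<rho> u) \<partial>M) = (\<integral>\<^sup>+u. \<phi> u \<partial>M)) \<and>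
      (\<forall>u\<in>good E. \<rho> u = (\<Prod>k = 1..n. \<bar>fredholm_det1 (frechet_derivative (\<lambda>u. u + G k u) (at (f (k - 1) u)))\<bar>)
         * exp (- (cm_inner C (f n u - u) (f n u - u) / 2 + (\<Sum>x\<in>E. coord x u * cm_inner C (f n u - u) x)))))"
  using n
proof (induction n)
  case 0
  have "cm_inner C 0 x = 0" for x using cm_inner_scale[OF subspace_0[OF subspace_H], of 0 x] by simp
  then have "\<exists>\<rho>. \<rho> \<in> borel_measurable borel \<and> (\<forall>u. \<rho> u > 0) \<and>
      (\<forall>\<phi>\<in>borel_measurable borel. (\<integral>\<^sup>+u. \<phi> (f 0 u) * ennreal (\<rho> u) \<partial>M) = (\<integral>\<^sup>+u. \<phi> u \<partial>M)) \<and>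
      (\<forall>u\<in>good E. \<rho> u = (\<Prod>k = 1..0. \<bar>fredholm_det1 (frechet_derivative (\<lambda>u. u + G k u) (at (f (k - 1) u)))\<bar>)
         * exp (- (cm_inner C (f 0 u - u) (f 0 u - u) / 2 + (\<Sum>x\<in>E. coord x u * cm_inner C (f 0 u - u) x))))"
    by (intro exI[of _ "\<lambda>_. 1"]) (simp add: f0)
  then show ?case using f0 by (simp add: f0[abs_def] span_zero fun_eq_iff inj_def continuous_on_id)
next
  case (Suc n)
  interpret L: gaussian_layer C M E m e "G (Suc n)" by (rule layers) (use Suc in simp)
  from Suc obtain \<rho> where cont: "continuous_on UNIV (f n)" and inj: "inj (f n)" and sp: "\<And>u. f n u - u \<in> span E"
    and \<rho>[measurable]: "\<rho> \<in> borel_measurable borel" and \<rho>0: "\<And>u. \<rho> u > 0"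
    and cv: "\<And>\<phi>. \<phi> \<in> borel_measurable borel \<Longrightarrow> (\<integral>\<^sup>+u. \<phi> (f n u) * ennreal (\<rho> u) \<partial>M) = (\<integral>\<^sup>+u. \<phi> u \<partial>M)"
    and eq: "\<And>u. u \<in> good E \<Longrightarrow> \<rho> u = (\<Prod>k = 1..n. \<bar>fredholm_det1 (frechet_derivative (\<lambda>u. u + G k u) (at (f (k - 1) u)))\<bar>)
         * exp (- (cm_inner C (f n u - u) (f n u - u) / 2 + (\<Sum>x\<in>E. coord x u * cm_inner C (f n u - u) x)))"
    by auto
  have fm[measurable]: "f n \<in> borel_measurable borel" by (rule borel_measurable_continuous_onI[OF cont])
  have split: "f (Suc n) u - u = (f n u - u) + G (Suc n) (f n u)" for u by (simp add: fS)
  have "continuous_on UNIV (f (Suc n))"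
    unfolding fS[abs_def] by (intro continuous_on_add cont continuous_on_compose2[OF L.continuous_F cont]) auto
  moreover have "inj (f (Suc n))"
  proof -
    have "f (Suc n) = (\<lambda>u. u + G (Suc n) u) \<circ> f n" by (simp add: fS fun_eq_iff)
    then show ?thesis using inj_compose[OF bij_is_inj[OF L.bij] inj] by simp
  qed
  moreover have "f (Suc n) u - u \<in> span E" for u unfolding split by (intro span_add sp L.F_span)
  moreover have "\<exists>\<rho>. \<rho> \<in> borel_measurable borel \<and> (\<forall>u. \<rho> u > 0) \<and>
      (\<forall>\<phi>\<in>borel_measurable borel. (\<integral>\<^sup>+u. \<phi> (f (Suc n) u) * ennreal (\<rho> u) \<partial>M) = (\<integral>\<^sup>+u. \<phi> u \<partial>M)) \<and>
      (\<forall>u\<in>good E. \<rho> u = (\<Prod>k = 1..Suc n. \<bar>fredholm_det1 (frechet_derivative (\<lambda>u. u + G k u) (at (f (k - 1) u)))\<bar>)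
         * exp (- (cm_inner C (f (Suc n) u - u) (f (Suc n) u - u) / 2 + (\<Sum>x\<in>E. coord x u * cm_inner C (f (Suc n) u - u) x))))"
  proof (intro exI[of _ "\<lambda>u. \<rho> u * L.weight (f n u)"] conjI allI ballI)
    show "(\<lambda>u. \<rho> u * L.weight (f n u)) \<in> borel_measurable borel" by measurable
    show "\<rho> u * L.weight (f n u) > 0" for u by (intro mult_pos_pos \<rho>0 L.weight_pos)
  next
    fix \<phi> :: "'a \<Rightarrow> ennreal" assume [measurable]: "\<phi> \<in> borel_measurable borel"
    have "(\<integral>\<^sup>+u. \<phi> (f (Suc n) u) * ennreal (\<rho> u * L.weight (f n u)) \<partial>M)
        = (\<integral>\<^sup>+u. (\<phi> (f n u + G (Suc n) (f n u)) * ennreal (L.weight (f n u))) * ennreal (\<rho> u) \<partial>M)"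
      using \<rho>0 L.weight_pos by (intro nn_integral_cong) (simp add: fS ennreal_mult less_imp_le mult_ac)
    also have "\<dots> = (\<integral>\<^sup>+u. \<phi> (u + G (Suc n) u) * ennreal (L.weight u) \<partial>M)"
      by (rule cv) measurable
    also have "\<dots> = (\<integral>\<^sup>+u. \<phi> u \<partial>M)" by (rule L.layer_change_of_variables) measurable
    finally show "(\<integral>\<^sup>+u. \<phi> (f (Suc n) u) * ennreal (\<rho> u * L.weight (f n u)) \<partial>M) = (\<integral>\<^sup>+u. \<phi> u \<partial>M)" .
  next
    fix u assume u: "u \<in> good E"
    have "u + (f n u - u) = f n u" by simp
    then have ex: "(cm_inner C (f n u - u) (f n u - u) / 2 + (\<Sum>x\<in>E. coord x u * cm_inner C (f n u - u) x))
      + (cm_inner C (G (Suc n) (f n u)) (G (Suc n) (f n u)) / 2 + (\<Sum>x\<in>E. coord x (f n u) * cm_inner C (G (Suc n) (f n u)) x))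
      = cm_inner C (f (Suc n) u - u) (f (Suc n) u - u) / 2 + (\<Sum>x\<in>E. coord x u * cm_inner C (f (Suc n) u - u) x)"
      using exponent_add[OF sp L.F_span u, of u "f n u"] unfolding split by simp
    have "L.weight (f n u) = \<bar>fredholm_det1 (frechet_derivative (\<lambda>u. u + G (Suc n) u) (at (f n u)))\<bar>
      * exp (- (cm_inner C (G (Suc n) (f n u)) (G (Suc n) (f n u)) / 2 + (\<Sum>x\<in>E. coord x (f n u) * cm_inner C (G (Suc n) (f n u)) x)))"
      by (simp add: L.weight_def)
    then show "\<rho> u * L.weight (f n u) = (\<Prod>k = 1..Suc n. \<bar>fredholm_det1 (frechet_derivative (\<lambda>u. u + G k u) (at (f (k - 1) u)))\<bar>)
         * exp (- (cm_inner C (f (Suc n) u - u) (f (Suc n) u - u) / 2 + (\<Sum>x\<in>E. coord x u * cm_inner C (f (Suc n) u - u) x)))"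
      unfolding eq[OF u] ex[symmetric] by (simp add: algebra_simps flip: exp_add)
  qed
  ultimately show ?case by blast
qed

end

context gaussian_measure
begin

lemma ex_common_frame:
  assumes I: "finite I" and rng: "\<And>n. n \<in> I \<Longrightarrow> range (G n) \<subseteq> H"
    and fin: "\<And>n. n \<in> I \<Longrightarrow> \<exists>B. finite B \<and> range (G n) \<subseteq> span B"
  shows "\<exists>E. cm_orthonormal C E \<and> (\<forall>n\<in>I. \<forall>u. G n u \<in> span E)"
proof -
  obtain B where B: "\<And>n. n \<in> I \<Longrightarrow> finite (B n) \<and> range (G n) \<subseteq> span (B n)" using fin by metis
  define T where "T = (\<Union>n\<in>I. range (G n))"
  have TB: "T \<subseteq> span (\<Union>n\<in>I. B n)"
  proof
    fix x assume "x \<in> T"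
    then obtain n where n: "n \<in> I" "x \<in> range (G n)" by (auto simp: T_def)
    then have "x \<in> span (B n)" using B by blast
    moreover have "span (B n) \<subseteq> span (\<Union>n\<in>I. B n)" by (rule span_mono) (use n in blast)
    ultimately show "x \<in> span (\<Union>n\<in>I. B n)" by blast
  qed
  obtain D where D: "D \<subseteq> T" "independent D" "T \<subseteq> span D"
    using maximal_independent_subset by blast
  have "finite (\<Union>n\<in>I. B n)" using I B by blast
  then have finD: "finite D" using independent_span_bound[OF _ D(2)] D(1) TB by (metis subset_trans)
  have DH: "D \<subseteq> H" using D(1) rng by (auto simp: T_def)
  obtain E where E: "cm_orthonormal C E" "D \<subseteq> span E" using ex_cm_orthonormal[OF finD DH] by blast
  have "span D \<subseteq> span E" by (rule span_minimal[OF E(2)]) simp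
  then show ?thesis using E(1) D(3) by (force simp: T_def)
qed

end

theorem theorem2p3:
  fixes \<mu>\<^sub>0 :: "'a::{real_inner, polish_space} measure"
    and C :: "'a \<Rightarrow> 'a"
    and N :: nat
    and \<Theta> :: "nat \<Rightarrow> 'p set"
    and F :: "nat \<Rightarrow> 'p \<Rightarrow> 'a \<Rightarrow> 'a"
  assumes "covariance_operator C"
    and "centered_gaussian \<mu>\<^sub>0 C"
    and "1 \<le> N"
    and differentiable: "\<And>\<theta> n u. \<theta> \<in> PiE {1..N} \<Theta> \<Longrightarrow> n \<in> {1..N} \<Longrightarrow>
          F n (\<theta> n) differentiable (at u)"
    and range_cm: "\<And>\<theta> n. \<theta> \<in> PiE {1..N} \<Theta> \<Longrightarrow> n \<in> {1..N} \<Longrightarrow>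
          range (F n (\<theta> n)) \<subseteq> cameron_martin C"
    and finite_dim_range: "\<And>\<theta> n. \<theta> \<in> PiE {1..N} \<Theta> \<Longrightarrow> n \<in> {1..N} \<Longrightarrow>
          \<exists>B. finite B \<and> range (F n (\<theta> n)) \<subseteq> span B"
    and bijective: "\<And>\<theta> n. \<theta> \<in> PiE {1..N} \<Theta> \<Longrightarrow> n \<in> {1..N} \<Longrightarrow>
          bij (layer F \<theta> n)"
    and spectrum: "\<And>\<theta> n u. \<theta> \<in> PiE {1..N} \<Theta> \<Longrightarrow> n \<in> {1..N} \<Longrightarrow>
          point_spectrum (frechet_derivative (F n (\<theta> n)) (at u)) \<inter> {..-1} = {}"
  shows "\<forall>\<theta> \<in> PiE {1..N} \<Theta>.
    let f = flow F \<theta> N; \<mu>\<^sub>f = distr \<mu>\<^sub>0 borel f in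
      absolutely_continuous \<mu>\<^sub>0 \<mu>\<^sub>f \<and> absolutely_continuous \<mu>\<^sub>f \<mu>\<^sub>0 \<and>
      (\<exists>E. cm_orthonormal C E \<and> (\<forall>u. f u - u \<in> span E)) \<and>
      (\<forall>E. cm_orthonormal C E \<and> (\<forall>u. f u - u \<in> span E) \<longrightarrow>
        (AE u in \<mu>\<^sub>0. RN_deriv \<mu>\<^sub>0 \<mu>\<^sub>f (f u) =
           ennreal ((\<Prod>n=1..N. inverse \<bar>fredholm_det1
                       (frechet_derivative (layer F \<theta> n) (at (flow F \<theta> (n - 1) u)))\<bar>)
              * exp (1 / 2 * cm_inner C (f u - u) (f u - u) + cm_pairing \<mu>\<^sub>0 C E u (f u - u)))))"
proof
  fix \<theta> assume \<theta>: "\<theta> \<in> PiE {1..N} \<Theta>"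
  interpret gaussian_measure C \<mu>\<^sub>0
    by unfold_locales (use assms(1,2) in \<open>simp_all add: covariance_operator_def\<close>)
  define G where "G n = F n (\<theta> n)" for n
  define f where "f = flow F \<theta> N"
  have layer_eq: "layer F \<theta> n = (\<lambda>u. u + G n u)" for n
    by (simp add: layer_def G_def fun_eq_iff)
  obtain E where E: "cm_orthonormal C E" "\<And>n u. n \<in> {1..N} \<Longrightarrow> G n u \<in> span E"
    using ex_common_frame[of "{1..N}" G] range_cm[OF \<theta>] finite_dim_range[OF \<theta>] by (auto simp: G_def)
  obtain e where "bij_betw e {0..<card E} E"
    using ex_bij_betw_nat_finite[of E] E(1) by (auto simp: cm_orthonormal_def)
  then have e: "bij_betw e {..<card E} E" by (simp add: lessThan_atLeast0)
  interpret gaussian_frame C \<mu>\<^sub>0 E "card E" e by unfold_locales (rule E(1), rule e)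
  have layers: "gaussian_layer C \<mu>\<^sub>0 E (card E) e (G n)" if n: "n \<in> {1..N}" for n
  proof
    show "G n differentiable (at u)" for u unfolding G_def by (rule differentiable[OF \<theta> n])
    show "G n u \<in> span E" for u by (rule E(2)[OF n])
    show "bij (\<lambda>u. u + G n u)" using bijective[OF \<theta> n] by (simp only: layer_eq)
    fix u v assume v: "frechet_derivative (G n) (at u) v = - v"
    show "v = 0"
    proof (rule ccontr)
      assume "v \<noteq> 0"
      then have "-1 \<in> point_spectrum (frechet_derivative (F n (\<theta> n)) (at u))"
        using v unfolding point_spectrum_def G_def by auto
      then show False using spectrum[OF \<theta> n, of u] by auto
    qed
  qed
  have cv: "continuous_on UNIV f \<and> inj f \<and> (\<forall>u. f u - u \<in> span E) \<and>
    (\<exists>\<rho>. \<rho> \<in> borel_measurable borel \<and> (\<forall>u. \<rho> u > 0) \<and>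
      (\<forall>\<phi>\<in>borel_measurable borel. (\<integral>\<^sup>+u. \<phi> (f u) * ennreal (\<rho> u) \<partial>\<mu>\<^sub>0) = (\<integral>\<^sup>+u. \<phi> u \<partial>\<mu>\<^sub>0)) \<and>
      (\<forall>u\<in>good E. \<rho> u = (\<Prod>k = 1..N. \<bar>fredholm_det1 (frechet_derivative (\<lambda>u. u + G k u) (at (flow F \<theta> (k - 1) u)))\<bar>)
         * exp (- (cm_inner C (f u - u) (f u - u) / 2 + (\<Sum>x\<in>E. coord x u * cm_inner C (f u - u) x)))))"
    unfolding f_def
    by (rule flow_change_of_variables[where l = N and G = G and f = "flow F \<theta>"]) (simp_all add: layer_eq layers)
  then have spE: "f u - u \<in> span E" for u by blast
  from cv obtain \<rho> where \<rho>: "\<rho> \<in> borel_measurable borel" "\<And>u. \<rho> u > 0"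
    "\<And>\<phi>. \<phi> \<in> borel_measurable borel \<Longrightarrow> (\<integral>\<^sup>+u. \<phi> (f u) * ennreal (\<rho> u) \<partial>\<mu>\<^sub>0) = (\<integral>\<^sup>+u. \<phi> u \<partial>\<mu>\<^sub>0)"
    and \<rho>_eq: "\<And>u. u \<in> good E \<Longrightarrow> \<rho> u = (\<Prod>k = 1..N. \<bar>fredholm_det1 (frechet_derivative (\<lambda>u. u + G k u) (at (flow F \<theta> (k - 1) u)))\<bar>)
         * exp (- (cm_inner C (f u - u) (f u - u) / 2 + (\<Sum>x\<in>E. coord x u * cm_inner C (f u - u) x)))"
    by blast
  note RN = RN_deriv_of_change_of_variables[OF prob_space_axioms sets_M _ _ \<rho>]
  have "AE u in \<mu>\<^sub>0. RN_deriv \<mu>\<^sub>0 (distr \<mu>\<^sub>0 borel f) (f u) =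
      ennreal ((\<Prod>n=1..N. inverse \<bar>fredholm_det1 (frechet_derivative (layer F \<theta> n) (at (flow F \<theta> (n - 1) u)))\<bar>)
        * exp (1 / 2 * cm_inner C (f u - u) (f u - u) + cm_pairing \<mu>\<^sub>0 C E' u (f u - u)))"
    if E': "cm_orthonormal C E'" "\<forall>u. f u - u \<in> span E'" for E'
  proof -
    have "AE u in \<mu>\<^sub>0. RN_deriv \<mu>\<^sub>0 (distr \<mu>\<^sub>0 borel f) (f u) = ennreal (inverse (\<rho> u))"
      using RN(3) cv by blast
    then show ?thesis using AE_pairing_eq[OF E(1) E'(1)] AE_coord[OF finite_E E_H]
    proof eventually_elim
      case (elim u)
      have "(\<Sum>x\<in>E. coord x u * cm_inner C (f u - u) x) = cm_pairing \<mu>\<^sub>0 C E' u (f u - u)"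
        using elim(2) spE E'(2) by blast
      moreover have "inverse (exp (- (a / 2 + b))) = exp (1 / 2 * a + b)" for a b :: real
        by (subst exp_minus) simp
      ultimately have "inverse (\<rho> u) = (\<Prod>n=1..N. inverse \<bar>fredholm_det1 (frechet_derivative (layer F \<theta> n) (at (flow F \<theta> (n - 1) u)))\<bar>)
        * exp (1 / 2 * cm_inner C (f u - u) (f u - u) + cm_pairing \<mu>\<^sub>0 C E' u (f u - u))"
        using \<rho>_eq[of u] elim(3)
        by (simp only: layer_eq inverse_mult_distrib prod_inversef[symmetric] comp_def)
      with elim(1) show ?case by simp
    qed
  qed
  then show "let f = flow F \<theta> N; \<mu>\<^sub>f = distr \<mu>\<^sub>0 borel f in
      absolutely_continuous \<mu>\<^sub>0 \<mu>\<^sub>f \<and> absolutely_continuous \<mu>\<^sub>f \<mu>\<^sub>0 \<and>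
      (\<exists>E. cm_orthonormal C E \<and> (\<forall>u. f u - u \<in> span E)) \<and>
      (\<forall>E. cm_orthonormal C E \<and> (\<forall>u. f u - u \<in> span E) \<longrightarrow>
        (AE u in \<mu>\<^sub>0. RN_deriv \<mu>\<^sub>0 \<mu>\<^sub>f (f u) =
           ennreal ((\<Prod>n=1..N. inverse \<bar>fredholm_det1
                       (frechet_derivative (layer F \<theta> n) (at (flow F \<theta> (n - 1) u)))\<bar>)
              * exp (1 / 2 * cm_inner C (f u - u) (f u - u) + cm_pairing \<mu>\<^sub>0 C E u (f u - u)))))"
    unfolding Let_def f_def[symmetric] using RN(1,2) cv E(1) spE by blast
qed

end
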